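(* Let $n$ be a positive integer, $\Gamma$ a finitely generated group, and let $G_{\mathbb{C}}$ be one of the groups $\mathrm{GL}(n,\mathbb{C})$, $\mathrm{SL}(n,\mathbb{C})$, $\mathrm{O}(n,\mathbb{C})$, $\mathrm{SO}(n,\mathbb{C})$ or $\mathrm{Sp}(2n,\mathbb{C})$. Let $\Phi$ be the anti-holomorphic involution of the character variety $\mathcal{X}_{G_{\mathbb{C}}}(\Gamma)$ induced by one of the involutions $A \mapsto \overline{A}$ or $A \mapsto (\overline{A}^{T})^{-1}$. Let $\rho \in \mathrm{Hom}(\Gamma,G_{\mathbb{C}})$ be an irreducible representation such that $\Phi(\chi_\rho) = \chi_\rho$. Then there exist a real form $G_{\mathbb{R}}$ of $G_{\mathbb{C}}$ (one of the groups listed in the context), $\sigma \in \mathrm{Hom}(\Gamma,G_{\mathbb{R}})$ and $P \in G_{\mathbb{C}}$ such that for all $\gamma \in \Gamma$, $P\rho(\gamma)P^{-1} = \sigma(\gamma)$.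
   Context: Complex groups. $I_n$ is the identity matrix, $J=J_{2n}=\begin{pmatrix}0&I_n\\-I_n&0\end{pmatrix}$, $I_{p,q}=\begin{pmatrix}I_p&0\\0&-I_q\end{pmatrix}$, $K_{p,q}=\begin{pmatrix}I_{p,q}&0\\0&I_{p,q}\end{pmatrix}$ (size $2(p+q)$), $D_{p,q}=\begin{pmatrix}I_p&0\\0&iI_q\end{pmatrix}$. $\mathrm{O}(n,\mathbb{C})=\{M\in\mathrm{GL}(n,\mathbb{C}): M^{T}M=I_n\}$, $\mathrm{SO}(n,\mathbb{C})=\mathrm{O}(n,\mathbb{C})\cap\mathrm{SL}(n,\mathbb{C})$, $\mathrm{Sp}(2n,\mathbb{C})=\{M\in\mathrm{SL}(2n,\mathbb{C}): M^{T}J_{2n}M=J_{2n}\}$. Each $G_{\mathbb{C}}$ is thus a subgroup of $\mathrm{GL}(N,\mathbb{C})$, with $N=2n$ for $\mathrm{Sp}(2n,\mathbb{C})$ and $N=n$ otherwise. Irreducible: $\rho:\Gamma\to G_{\mathbb{C}}\subset\mathrm{GL}(N,\mathbb{C})$ is irreducible if the only subspaces of $\mathbb{C}^N$ stable under the image of $\rho$ are $\{0\}$ and $\mathbb{C}^N$. Character variety. $\mathrm{Hom}(\Gamma,G_{\mathbb{C}})$ is an affine algebraic set (via the images of a finite generating set of $\Gamma$), on which $G_{\mathbb{C}}$ acts by conjugation. $\mathcal{X}_{G_{\mathbb{C}}}(\Gamma)=\mathrm{Hom}(\Gamma,G_{\mathbb{C}})//G_{\mathbb{C}}$ is the GIT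 quotient, viewed as an affine algebraic set with ring of functions generated by the (finitely generated) ring $\mathbb{C}[\mathrm{Hom}(\Gamma,G_{\mathbb{C}})]^{G_{\mathbb{C}}}$ of conjugation-invariant regular functions. $\chi_\rho$ is the image of $\rho$ in $\mathcal{X}_{G_{\mathbb{C}}}(\Gamma)$; so $\chi_\rho=\chi_{\rho'}$ iff $f(\rho)=f(\rho')$ for every invariant regular function $f$. For $\theta$ equal to $A\mapsto\overline{A}$ or $A\mapsto(\overline{A}^{T})^{-1}$, which preserves $G_{\mathbb{C}}$, the induced involution is $\Phi(\chi_\rho)=\chi_{\theta\circ\rho}$. Real forms. "A real form of $G_{\mathbb{C}}$" means one of the following subgroups, where $p\ge q\ge 0$: - $\mathrm{GL}(n,\mathbb{C})$: $\mathrm{GL}(n,\mathbb{R})$; $\mathrm{U}(p,q)$ with $p+q=n$; and, if $n=2m$ is even, $\mathrm{GL}(m,\mathbb{H})$. - $\mathrm{SL}(n,\mathbb{C})$: $\mathrm{SL}(n,\mathbb{R})$; $\mathrm{SU}(p,q)$ with $p+q=n$; and, if $n=2m$ is even, $\mathrm{SL}(m,\mathbb{H})$. - $\mathrm{Sp}(2n,\mathbb{C})$: $\mathrm{Sp}(2n,\mathbb{R})$; $\mathrm{Sp}(2p,2q)$ with $p+q=n$. - $\mathrm{O}(n,\mathbb{C})$: $\mathcal{O}(p,q)$ with $p+q=n$; and, if $n=2m$ is even, $\mathrm{O}(m,\mathbb{H})$. - $\mathrm{SO}(n,\mathbb{C})$: $\mathcal{SO}(p,q)$ with $p+q=n$;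 if $n=4m+2$, also $\mathrm{SO}(2m+1,\mathbb{H})$; if $n=4m$, also $\mathrm{SO}(2m,\mathbb{H})$ and $\mathrm{SO}^{-}(2m,\mathbb{H})$. Here $\mathrm{U}(p,q)=\{M\in\mathrm{GL}(p+q,\mathbb{C}):\overline{M}^{T}I_{p,q}M=I_{p,q}\}$; $\mathrm{SU}(p,q)=\mathrm{U}(p,q)\cap\mathrm{SL}(p+q,\mathbb{C})$; $\mathrm{GL}(m,\mathbb{H})=\{M\in\mathrm{GL}(2m,\mathbb{C}):MJ_{2m}=J_{2m}\overline{M}\}$; $\mathrm{SL}(m,\mathbb{H})=\mathrm{GL}(m,\mathbb{H})\cap\mathrm{SL}(2m,\mathbb{C})$; $\mathrm{Sp}(2n,\mathbb{R})$ is the group of matrices of $\mathrm{Sp}(2n,\mathbb{C})$ with real entries; $\mathrm{Sp}(2p,2q)=\{M\in\mathrm{Sp}(2(p+q),\mathbb{C}):\overline{M}^{T}K_{p,q}M=K_{p,q}\}$; $\mathrm{O}(p,q)=\{M\in\mathrm{GL}(p+q,\mathbb{R}):M^{T}I_{p,q}M=I_{p,q}\}$, $\mathrm{SO}(p,q)=\mathrm{O}(p,q)\cap\mathrm{SL}(p+q,\mathbb{C})$; $\mathcal{O}(p,q)=D_{p,q}\,\mathrm{O}(p,q)\,D_{p,q}^{-1}\subset\mathrm{O}(p+q,\mathbb{C})$ and $\mathcal{SO}(p,q)=D_{p,q}\,\mathrm{SO}(p,q)\,D_{p,q}^{-1}\subset\mathrm{SO}(p+q,\mathbb{C})$; $\mathrm{O}(m,\mathbb{H})=\{M\in\mathrm{O}(2m,\mathbb{C}):J_{2m}M=\overline{M}J_{2m}\}$,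 $\mathrm{SO}(m,\mathbb{H})=\mathrm{O}(m,\mathbb{H})\cap\mathrm{SL}(2m,\mathbb{C})$ (these two coincide); and $\mathrm{SO}^{-}(2m,\mathbb{H})=P_0\,\mathrm{SO}(2m,\mathbb{H})\,P_0^{-1}$, where $P_0\in\mathrm{O}(4m,\mathbb{C})$ is a matrix with $\det P_0=-1$ fixed once and for all. *)

theory Defs
  imports
    "HOL-Algebra.Generated_Groups"
    "Jordan_Normal_Form.VS_Connect"
    "Jordan_Normal_Form.Determinant"
begin

section \<open>The complex groups\<close>

abbreviation GL :: "nat \<Rightarrow> complex mat monoid" where
  "GL N \<equiv> units_of (ring_mat TYPE(complex) N ())"

abbreviation conj_mat :: "complex mat \<Rightarrow> complex mat" where
  "conj_mat \<equiv> map_mat cnj"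

definition J_mat :: "nat \<Rightarrow> complex mat" where
  "J_mat n = four_block_mat (0\<^sub>m n n) (1\<^sub>m n) (- 1\<^sub>m n) (0\<^sub>m n n)"

definition I_mat :: "nat \<Rightarrow> nat \<Rightarrow> complex mat" where
  "I_mat p q = four_block_mat (1\<^sub>m p) (0\<^sub>m p q) (0\<^sub>m q p) (- 1\<^sub>m q)"

definition K_mat :: "nat \<Rightarrow> nat \<Rightarrow> complex mat" where
  "K_mat p q = four_block_mat (I_mat p q) (0\<^sub>m (p + q) (p + q)) (0\<^sub>m (p + q) (p + q)) (I_mat p q)"

definition D_mat :: "nat \<Rightarrow> nat \<Rightarrow> complex mat" where
  "D_mat p q = four_block_mat (1\<^sub>m p) (0\<^sub>m p q) (0\<^sub>m q p) (\<i> \<cdot>\<^sub>m 1\<^sub>m q)"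

definition GL_C :: "nat \<Rightarrow> complex mat set" where
  "GL_C n = carrier (GL n)"

definition SL_C :: "nat \<Rightarrow> complex mat set" where
  "SL_C n = {M \<in> GL_C n. det M = 1}"

definition O_C :: "nat \<Rightarrow> complex mat set" where
  "O_C n = {M \<in> GL_C n. M\<^sup>T * M = 1\<^sub>m n}"

definition SO_C :: "nat \<Rightarrow> complex mat set" where
  "SO_C n = O_C n \<inter> SL_C n"

text \<open>The argument of \<open>Sp_C\<close> is half the matrix size.\<close>

definition Sp_C :: "nat \<Rightarrow> complex mat set" where
  "Sp_C n = {M \<in> SL_C (2 * n). M\<^sup>T * J_mat n * M = J_mat n}"

datatype family = GL_fam | SL_fam | O_fam | SO_fam | Sp_fam

fun mat_size :: "family \<Rightarrow> nat \<Rightarrow> nat" where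
  "mat_size Sp_fam n = 2 * n"
| "mat_size _ n = n"

fun cgroup_set :: "family \<Rightarrow> nat \<Rightarrow> complex mat set" where
  "cgroup_set GL_fam n = GL_C n"
| "cgroup_set SL_fam n = SL_C n"
| "cgroup_set O_fam n = O_C n"
| "cgroup_set SO_fam n = SO_C n"
| "cgroup_set Sp_fam n = Sp_C n"

definition cgroup :: "family \<Rightarrow> nat \<Rightarrow> complex mat monoid" where
  "cgroup F n = (GL (mat_size F n))\<lparr>carrier := cgroup_set F n\<rparr>"

section \<open>Real forms\<close>

definition real_entries :: "complex mat \<Rightarrow> bool" where
  "real_entries M \<longleftrightarrow> elements_mat M \<subseteq> \<real>"

definition GL_R :: "nat \<Rightarrow> complex mat set" where
  "GL_R n = {M \<in> GL_C n. real_entries M}"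

definition SL_R :: "nat \<Rightarrow> complex mat set" where
  "SL_R n = {M \<in> SL_C n. real_entries M}"

definition U_pq :: "nat \<Rightarrow> nat \<Rightarrow> complex mat set" where
  "U_pq p q = {M \<in> GL_C (p + q). (conj_mat M)\<^sup>T * I_mat p q * M = I_mat p q}"

definition SU_pq :: "nat \<Rightarrow> nat \<Rightarrow> complex mat set" where
  "SU_pq p q = U_pq p q \<inter> SL_C (p + q)"

text \<open>The quaternionic groups of index \<open>m\<close> consist of complex matrices of size \<open>2 * m\<close>.\<close>

definition GL_H :: "nat \<Rightarrow> complex mat set" where
  "GL_H m = {M \<in> GL_C (2 * m). M * J_mat m = J_mat m * conj_mat M}"

definition SL_H :: "nat \<Rightarrow> complex mat set" where
  "SL_H m = GL_H m \<inter> SL_C (2 * m)"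

definition Sp_R :: "nat \<Rightarrow> complex mat set" where
  "Sp_R n = {M \<in> Sp_C n. real_entries M}"

text \<open>\<open>Sp_pq p q\<close> is the group usually written \<open>Sp(2p,2q)\<close>.\<close>

definition Sp_pq :: "nat \<Rightarrow> nat \<Rightarrow> complex mat set" where
  "Sp_pq p q = {M \<in> Sp_C (p + q). (conj_mat M)\<^sup>T * K_mat p q * M = K_mat p q}"

definition O_pq :: "nat \<Rightarrow> nat \<Rightarrow> complex mat set" where
  "O_pq p q = {M \<in> GL_R (p + q). M\<^sup>T * I_mat p q * M = I_mat p q}"

definition SO_pq :: "nat \<Rightarrow> nat \<Rightarrow> complex mat set" where
  "SO_pq p q = O_pq p q \<inter> SL_C (p + q)"

text \<open>\<open>O_pq\<close> and \<open>SO_pq\<close> preserve the form \<open>I_mat p q\<close>. Conjugating by \<open>D_mat p q\<close> moves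
  them into the group of the standard form.\<close>

definition conj_set :: "nat \<Rightarrow> complex mat \<Rightarrow> complex mat set \<Rightarrow> complex mat set" where
  "conj_set N P H = (\<lambda>M. P * M * inv\<^bsub>GL N\<^esub> P) ` H"

definition O_std :: "nat \<Rightarrow> nat \<Rightarrow> complex mat set" where
  "O_std p q = conj_set (p + q) (D_mat p q) (O_pq p q)"

definition SO_std :: "nat \<Rightarrow> nat \<Rightarrow> complex mat set" where
  "SO_std p q = conj_set (p + q) (D_mat p q) (SO_pq p q)"

definition O_H :: "nat \<Rightarrow> complex mat set" where
  "O_H m = {M \<in> O_C (2 * m). J_mat m * M = conj_mat M * J_mat m}"

definition SO_H :: "nat \<Rightarrow> complex mat set" where
  "SO_H m = O_H m \<inter> SL_C (2 * m)"

text \<open>\<open>SO_H_minus P m\<close> is \<open>SO\<^sup>-(2m,\<H>)\<close>, for the choice \<open>P\<close> of an orthogonal matrix of size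
  \<open>4 * m\<close> and determinant \<open>- 1\<close>.\<close>

definition SO_H_minus :: "complex mat \<Rightarrow> nat \<Rightarrow> complex mat set" where
  "SO_H_minus P m = conj_set (4 * m) P (SO_H (2 * m))"

text \<open>\<open>P0 m\<close> is the fixed matrix of size \<open>4 * m\<close> entering \<open>SO_H_minus\<close>.\<close>

fun real_forms :: "(nat \<Rightarrow> complex mat) \<Rightarrow> family \<Rightarrow> nat \<Rightarrow> complex mat set set" where
  "real_forms P0 GL_fam n =
     {GL_R n} \<union> {U_pq p q | p q. q \<le> p \<and> p + q = n} \<union> {GL_H m | m. n = 2 * m}"
| "real_forms P0 SL_fam n =
     {SL_R n} \<union> {SU_pq p q | p q. q \<le> p \<and> p + q = n} \<union> {SL_H m | m. n = 2 * m}"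
| "real_forms P0 Sp_fam n =
     {Sp_R n} \<union> {Sp_pq p q | p q. q \<le> p \<and> p + q = n}"
| "real_forms P0 O_fam n =
     {O_std p q | p q. q \<le> p \<and> p + q = n} \<union> {O_H m | m. n = 2 * m}"
| "real_forms P0 SO_fam n =
     {SO_std p q | p q. q \<le> p \<and> p + q = n}
     \<union> {SO_H (2 * m + 1) | m. n = 4 * m + 2}
     \<union> {SO_H (2 * m) | m. n = 4 * m}
     \<union> {SO_H_minus (P0 m) m | m. n = 4 * m}"

section \<open>Representations and the character variety\<close>

definition irreducible_rep :: "('g, 'm) monoid_scheme \<Rightarrow> nat \<Rightarrow> ('g \<Rightarrow> complex mat) \<Rightarrow> bool" where
  "irreducible_rep \<Gamma> N \<rho> \<longleftrightarrow>
     (\<forall>W. VectorSpace.subspace class_ring W (module_vec TYPE(complex) N) \<longrightarrow>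
        (\<forall>\<gamma>\<in>carrier \<Gamma>. \<forall>w\<in>W. \<rho> \<gamma> *\<^sub>v w \<in> W) \<longrightarrow>
        W = {0\<^sub>v N} \<or> W = carrier_vec N)"

text \<open>\<open>Hom(\<Gamma>, G)\<close> is an affine algebraic set through \<open>\<rho> \<mapsto> (\<rho> s)\<close>, where \<open>s\<close> runs through a
  finite generating set \<open>S\<close> of \<open>\<Gamma>\<close>. Its regular functions are the restrictions of the
  polynomials in the entries and the inverse determinants of the matrices \<open>\<rho> s\<close>.\<close>

inductive_set regular_functions ::
    "('g, 'm) monoid_scheme \<Rightarrow> 'g set \<Rightarrow> nat \<Rightarrow> complex mat monoid \<Rightarrow> (('g \<Rightarrow> complex mat) \<Rightarrow> complex) set"
  for \<Gamma> :: "('g, 'm) monoid_scheme" and S :: "'g set" and N :: nat and G :: "complex mat monoid"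
where
  rf_const: "(\<lambda>\<rho>\<in>hom \<Gamma> G. c) \<in> regular_functions \<Gamma> S N G"
| rf_entry: "s \<in> S \<Longrightarrow> i < N \<Longrightarrow> j < N \<Longrightarrow>
    (\<lambda>\<rho>\<in>hom \<Gamma> G. \<rho> s $$ (i, j)) \<in> regular_functions \<Gamma> S N G"
| rf_inv_det: "s \<in> S \<Longrightarrow> (\<lambda>\<rho>\<in>hom \<Gamma> G. 1 / det (\<rho> s)) \<in> regular_functions \<Gamma> S N G"
| rf_add: "f \<in> regular_functions \<Gamma> S N G \<Longrightarrow> g \<in> regular_functions \<Gamma> S N G \<Longrightarrow>
    (\<lambda>\<rho>\<in>hom \<Gamma> G. f \<rho> + g \<rho>) \<in> regular_functions \<Gamma> S N G"
| rf_mult: "f \<in> regular_functions \<Gamma> S N G \<Longrightarrow> g \<in> regular_functions \<Gamma> S N G \<Longrightarrow>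
    (\<lambda>\<rho>\<in>hom \<Gamma> G. f \<rho> * g \<rho>) \<in> regular_functions \<Gamma> S N G"

definition conj_rep :: "complex mat monoid \<Rightarrow> complex mat \<Rightarrow> ('g \<Rightarrow> complex mat) \<Rightarrow> 'g \<Rightarrow> complex mat" where
  "conj_rep G g \<rho> = (\<lambda>\<gamma>. g \<otimes>\<^bsub>G\<^esub> \<rho> \<gamma> \<otimes>\<^bsub>G\<^esub> inv\<^bsub>G\<^esub> g)"

definition invariant_functions ::
    "('g, 'm) monoid_scheme \<Rightarrow> 'g set \<Rightarrow> nat \<Rightarrow> complex mat monoid \<Rightarrow> (('g \<Rightarrow> complex mat) \<Rightarrow> complex) set"
where
  "invariant_functions \<Gamma> S N G =
     {f \<in> regular_functions \<Gamma> S N G. \<forall>\<rho>\<in>hom \<Gamma> G. \<forall>g\<in>carrier G. f (conj_rep G g \<rho>) = f \<rho>}"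

text \<open>The points of the affine algebraic set whose ring of functions is the invariant ring are
  the unital \<open>\<complex>\<close>-algebra homomorphisms from that ring to \<open>\<complex>\<close>.\<close>

definition char_variety ::
    "('g, 'm) monoid_scheme \<Rightarrow> 'g set \<Rightarrow> nat \<Rightarrow> complex mat monoid \<Rightarrow>
     ((('g \<Rightarrow> complex mat) \<Rightarrow> complex) \<Rightarrow> complex) set"
where
  "char_variety \<Gamma> S N G =
     {x \<in> extensional (invariant_functions \<Gamma> S N G).
        x (\<lambda>\<rho>\<in>hom \<Gamma> G. 1) = 1 \<and>
        (\<forall>c. \<forall>f\<in>invariant_functions \<Gamma> S N G. x (\<lambda>\<rho>\<in>hom \<Gamma> G. c * f \<rho>) = c * x f) \<and>
        (\<forall>f\<in>invariant_functions \<Gamma> S N G. \<forall>g\<in>invariant_functions \<Gamma> S N G.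
           x (\<lambda>\<rho>\<in>hom \<Gamma> G. f \<rho> + g \<rho>) = x f + x g \<and>
           x (\<lambda>\<rho>\<in>hom \<Gamma> G. f \<rho> * g \<rho>) = x f * x g)}"

definition chi ::
    "('g, 'm) monoid_scheme \<Rightarrow> 'g set \<Rightarrow> nat \<Rightarrow> complex mat monoid \<Rightarrow> ('g \<Rightarrow> complex mat) \<Rightarrow>
     (('g \<Rightarrow> complex mat) \<Rightarrow> complex) \<Rightarrow> complex"
where
  "chi \<Gamma> S N G \<rho> = (\<lambda>f\<in>invariant_functions \<Gamma> S N G. f \<rho>)"

definition involutions :: "nat \<Rightarrow> (complex mat \<Rightarrow> complex mat) set" where
  "involutions N = {conj_mat, \<lambda>A. inv\<^bsub>GL N\<^esub> ((conj_mat A)\<^sup>T)}"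

text \<open>An anti-holomorphic map is given on points by the semilinear pullback
  \<open>f \<mapsto> cnj \<circ> f \<circ> (\<theta> \<circ> _)\<close> of functions. The lemma \<open>Phi_chi\<close> below shows that \<open>Phi\<close> maps
  the class of \<open>\<rho>\<close> to the class of \<open>\<theta> \<circ> \<rho>\<close>.\<close>

definition theta_pullback ::
    "('g, 'm) monoid_scheme \<Rightarrow> complex mat monoid \<Rightarrow> (complex mat \<Rightarrow> complex mat) \<Rightarrow>
     (('g \<Rightarrow> complex mat) \<Rightarrow> complex) \<Rightarrow> ('g \<Rightarrow> complex mat) \<Rightarrow> complex"
where
  "theta_pullback \<Gamma> G \<theta> f = (\<lambda>\<rho>\<in>hom \<Gamma> G. cnj (f (\<theta> \<circ> \<rho>)))"

definition Phi ::
    "('g, 'm) monoid_scheme \<Rightarrow> 'g set \<Rightarrow> nat \<Rightarrow> complex mat monoid \<Rightarrow> (complex mat \<Rightarrow> complex mat) \<Rightarrow>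
     ((('g \<Rightarrow> complex mat) \<Rightarrow> complex) \<Rightarrow> complex) \<Rightarrow> (('g \<Rightarrow> complex mat) \<Rightarrow> complex) \<Rightarrow> complex"
where
  "Phi \<Gamma> S N G \<theta> =
     (\<lambda>x\<in>char_variety \<Gamma> S N G. \<lambda>f\<in>invariant_functions \<Gamma> S N G. cnj (x (theta_pullback \<Gamma> G \<theta> f)))"

section \<open>The groups are groups, and \<open>Phi\<close> maps \<open>chi \<rho>\<close> to \<open>chi (\<theta> \<circ> \<rho>)\<close>\<close>

lemma group_GL: "group (GL N)"
  by (intro monoid.units_group ring.is_monoid ring_mat)

lemma GL_carrier: "A \<in> carrier (GL N) \<longleftrightarrow> A \<in> carrier_mat N N \<and> det A \<noteq> 0"
  using unit_imp_det_non_zero[of A N "()"] det_non_zero_imp_unit[of A N "()"]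
  by (auto simp: units_of_def Units_def ring_mat_simps)

lemma GL_ops: "mult (GL N) = (*)" "one (GL N) = 1\<^sub>m N"
  by (simp_all add: units_of_def ring_mat_simps)

lemma GL_inv:
  assumes "A \<in> carrier (GL N)"
  shows "inv\<^bsub>GL N\<^esub> A \<in> carrier_mat N N" "det (inv\<^bsub>GL N\<^esub> A) \<noteq> 0"
    "A * inv\<^bsub>GL N\<^esub> A = 1\<^sub>m N" "inv\<^bsub>GL N\<^esub> A * A = 1\<^sub>m N"
    "det A * det (inv\<^bsub>GL N\<^esub> A) = 1"
proof -
  interpret group "GL N" by (rule group_GL)
  have i: "inv\<^bsub>GL N\<^esub> A \<in> carrier (GL N)" using assms by simp
  then show c: "inv\<^bsub>GL N\<^esub> A \<in> carrier_mat N N" "det (inv\<^bsub>GL N\<^esub> A) \<noteq> 0"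
    by (auto simp: GL_carrier)
  show m: "A * inv\<^bsub>GL N\<^esub> A = 1\<^sub>m N" "inv\<^bsub>GL N\<^esub> A * A = 1\<^sub>m N"
    using r_inv[OF assms] l_inv[OF assms] by (simp_all add: GL_ops)
  have "det (A * inv\<^bsub>GL N\<^esub> A) = det A * det (inv\<^bsub>GL N\<^esub> A)"
    using assms c by (intro det_mult) (auto simp: GL_carrier)
  then show "det A * det (inv\<^bsub>GL N\<^esub> A) = 1" using m by simp
qed

lemma GL_inv_unique:
  assumes "A \<in> carrier_mat N N" "B \<in> carrier_mat N N" "B * A = 1\<^sub>m N"
  shows "A \<in> carrier (GL N)" "inv\<^bsub>GL N\<^esub> A = B"
proof -
  interpret group "GL N" by (rule group_GL)
  have "det B * det A = 1" using det_mult[of B N A] assms by simp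
  then have c: "A \<in> carrier (GL N)" "B \<in> carrier (GL N)" using assms by (auto simp: GL_carrier)
  then show "A \<in> carrier (GL N)" by simp
  show "inv\<^bsub>GL N\<^esub> A = B" using inv_equality[of B A] c assms by (simp add: GL_ops)
qed

lemma conj_mult:
  "A \<in> carrier_mat a b \<Longrightarrow> B \<in> carrier_mat b c \<Longrightarrow> conj_mat (A * B) = conj_mat A * conj_mat B"
  by (rule eq_matI) (auto simp: scalar_prod_def)

lemma conj_one: "conj_mat (1\<^sub>m n) = 1\<^sub>m n"
  by (rule eq_matI) auto

lemma conj_transpose: "conj_mat (A\<^sup>T) = (conj_mat A)\<^sup>T"
  by (rule eq_matI) auto

lemma det_conj: "det (conj_mat A) = cnj (det A)"
proof -
  interpret comm_ring_hom cnj by unfold_locales auto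
  show ?thesis by simp
qed

lemma transpose_one: "(1\<^sub>m n :: complex mat)\<^sup>T = 1\<^sub>m n" by (rule eq_matI) auto

lemma form_mult:
  fixes A C B :: "complex mat"
  assumes [simp]: "A \<in> carrier_mat N N" "C \<in> carrier_mat N N" "B \<in> carrier_mat N N"
    and "A\<^sup>T * B * A = B" "C\<^sup>T * B * C = B"
  shows "(A * C)\<^sup>T * B * (A * C) = B"
proof -
  have "(A * C)\<^sup>T * B * (A * C) = C\<^sup>T * (A\<^sup>T * B * A) * C"
    by (simp add: transpose_mult[of A N N C N] assoc_mult_mat[of _ N N _ N _ N] mult_carrier_mat[of _ N N _ N])
  then show ?thesis using assms by simp
qed

lemma form_inv:
  fixes A C B :: "complex mat"
  assumes [simp]: "A \<in> carrier_mat N N" "C \<in> carrier_mat N N" "B \<in> carrier_mat N N"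
    and "A\<^sup>T * B * A = B" and AC: "A * C = 1\<^sub>m N"
  shows "C\<^sup>T * B * C = B"
proof -
  have "C\<^sup>T * B * C = C\<^sup>T * (A\<^sup>T * B * A) * C" using assms by simp
  also have "\<dots> = (C\<^sup>T * A\<^sup>T) * B * (A * C)"
    by (simp add: assoc_mult_mat[of _ N N _ N _ N] mult_carrier_mat[of _ N N _ N])
  also have "C\<^sup>T * A\<^sup>T = 1\<^sub>m N" using transpose_mult[of A N N C N] AC transpose_one by simp
  finally show ?thesis using AC assms(3) by (simp add: left_mult_one_mat[of _ N N] right_mult_one_mat[of _ N N] mult_carrier_mat[of _ N N _ N])
qed

lemma form_transpose:
  fixes A B :: "complex mat"
  assumes [simp]: "A \<in> carrier_mat N N" "B \<in> carrier_mat N N"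
    and f: "A\<^sup>T * B * A = B" and BB: "B * B = c \<cdot>\<^sub>m 1\<^sub>m N" and c: "c \<noteq> 0"
  shows "A * B * A\<^sup>T = B"
proof -
  let ?C = "(1 / c) \<cdot>\<^sub>m B"
  have BC: "B * ?C = 1\<^sub>m N" "?C * B = 1\<^sub>m N" using BB c
    by (simp_all add: mult_smult_distrib[of _ N N _ N] mult_smult_assoc_mat[of _ N N _ N])
      (rule eq_matI; simp)+
  have "(?C * A\<^sup>T * B) * A = ?C * (A\<^sup>T * B * A)" by (simp add: assoc_mult_mat[of _ N N _ N _ N] mult_carrier_mat[of _ N N _ N])
  also have "\<dots> = 1\<^sub>m N" using f BC by simp
  finally have l: "(?C * A\<^sup>T * B) * A = 1\<^sub>m N" .
  have "A * (?C * A\<^sup>T * B) = 1\<^sub>m N"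
    by (rule mat_mult_left_right_inverse[OF _ _ l]) (simp_all add: mult_carrier_mat[of _ N N _ N])
  then have "A * (?C * A\<^sup>T * B) * ?C = ?C" by (simp add: left_mult_one_mat[of _ N N])
  moreover have "A * (?C * A\<^sup>T * B) * ?C = A * ?C * A\<^sup>T * (B * ?C)"
    by (simp add: assoc_mult_mat[of _ N N _ N _ N] mult_carrier_mat[of _ N N _ N])
  ultimately have "A * ?C * A\<^sup>T = ?C" using BC by (simp add: right_mult_one_mat[of _ N N] mult_carrier_mat[of _ N N _ N])
  moreover have "A * ?C * A\<^sup>T = (1 / c) \<cdot>\<^sub>m (A * B * A\<^sup>T)"
    by (simp add: mult_smult_distrib[of _ N N _ N] mult_smult_assoc_mat[of _ N N _ N] mult_carrier_mat[of _ N N _ N])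
  ultimately have e: "(1 / c) \<cdot>\<^sub>m (A * B * A\<^sup>T) = (1 / c) \<cdot>\<^sub>m B" by simp
  have "A * B * A\<^sup>T = c \<cdot>\<^sub>m ((1 / c) \<cdot>\<^sub>m (A * B * A\<^sup>T))" using c by (intro eq_matI) auto
  also have "\<dots> = c \<cdot>\<^sub>m ((1 / c) \<cdot>\<^sub>m B)" unfolding e ..
  also have "\<dots> = B" using c by (intro eq_matI) auto
  finally show ?thesis .
qed

definition form_group :: "nat \<Rightarrow> complex mat \<Rightarrow> complex mat set" where
  "form_group N B = {M \<in> carrier (GL N). M\<^sup>T * B * M = B}"

lemma subgroup_form_group:
  assumes "B \<in> carrier_mat N N" shows "subgroup (form_group N B) (GL N)"
proof -
  interpret group "GL N" by (rule group_GL)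
  show ?thesis
  proof (rule subgroupI)
    show "form_group N B \<subseteq> carrier (GL N)" by (auto simp: form_group_def)
    have "1\<^sub>m N \<in> form_group N B" using assms by (auto simp: form_group_def GL_carrier transpose_one)
    then show "form_group N B \<noteq> {}" by auto
  next
    fix a assume a: "a \<in> form_group N B"
    then have c: "a \<in> carrier (GL N)" by (auto simp: form_group_def)
    have "(inv\<^bsub>GL N\<^esub> a)\<^sup>T * B * inv\<^bsub>GL N\<^esub> a = B"
      by (rule form_inv[of a N]) (use a c GL_inv[OF c] assms in \<open>auto simp: form_group_def GL_carrier\<close>)
    then show "inv\<^bsub>GL N\<^esub> a \<in> form_group N B" using c by (auto simp: form_group_def)
  next
    fix a b assume a: "a \<in> form_group N B" and b: "b \<in> form_group N B"
    have "(a * b)\<^sup>T * B * (a * b) = B"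
      by (rule form_mult[of a N]) (use a b assms in \<open>auto simp: form_group_def GL_carrier\<close>)
    then show "a \<otimes>\<^bsub>GL N\<^esub> b \<in> form_group N B"
      using a b m_closed[of a b] by (auto simp: form_group_def GL_ops)
  qed
qed

lemma subgroup_SL: "subgroup (SL_C N) (GL N)"
proof -
  interpret group "GL N" by (rule group_GL)
  show ?thesis
  proof (rule subgroupI)
    show "SL_C N \<subseteq> carrier (GL N)" by (auto simp: SL_C_def GL_C_def)
    have "1\<^sub>m N \<in> SL_C N" by (auto simp: SL_C_def GL_C_def GL_carrier)
    then show "SL_C N \<noteq> {}" by auto
  next
    fix a assume a: "a \<in> SL_C N"
    then show "inv\<^bsub>GL N\<^esub> a \<in> SL_C N" using GL_inv(5)[of a N] by (auto simp: SL_C_def GL_C_def)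
  next
    fix a b assume a: "a \<in> SL_C N" and b: "b \<in> SL_C N"
    then show "a \<otimes>\<^bsub>GL N\<^esub> b \<in> SL_C N"
      using m_closed[of a b] det_mult[of a N b] by (auto simp: SL_C_def GL_C_def GL_ops GL_carrier)
  qed
qed

lemma J_carrier: "J_mat n \<in> carrier_mat (2 * n) (2 * n)"
proof -
  have "J_mat n \<in> carrier_mat (n + n) (n + n)" unfolding J_mat_def by (rule four_block_carrier_mat) auto
  then show ?thesis by (simp add: mult_2)
qed

lemma J_square: "J_mat n * J_mat n = (- 1) \<cdot>\<^sub>m 1\<^sub>m (2 * n)"
proof -
  have "J_mat n * J_mat n = four_block_mat (- 1\<^sub>m n) (0\<^sub>m n n) (0\<^sub>m n n) (- 1\<^sub>m n)"
    unfolding J_mat_def by (subst mult_four_block_mat[of _ n n _ n _ n _ _ n _ n]) auto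
  also have "\<dots> = (- 1) \<cdot>\<^sub>m 1\<^sub>m (2 * n)" by (rule eq_matI) auto
  finally show ?thesis .
qed

lemma conj_J: "conj_mat (J_mat n) = J_mat n"
  unfolding J_mat_def by (rule eq_matI) auto

lemma cgroup_set_eq:
  "cgroup_set F n = (case F of GL_fam \<Rightarrow> carrier (GL n) | SL_fam \<Rightarrow> SL_C n
    | O_fam \<Rightarrow> form_group n (1\<^sub>m n) | SO_fam \<Rightarrow> form_group n (1\<^sub>m n) \<inter> SL_C n
    | Sp_fam \<Rightarrow> form_group (2 * n) (J_mat n) \<inter> SL_C (2 * n))"
  by (cases F) (auto simp: GL_C_def O_C_def SO_C_def Sp_C_def SL_C_def form_group_def GL_carrier)

lemma subgroup_cgroup: "subgroup (cgroup_set F n) (GL (mat_size F n))"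
proof -
  interpret group "GL (mat_size F n)" by (rule group_GL)
  show ?thesis
    unfolding cgroup_set_eq
    by (cases F) (auto intro!: group.subgroups_Inter_pair[OF group_GL] subgroup_SL subgroup_form_group
        J_carrier group.subgroup_self[OF group_GL])
qed

lemma group_cgroup: "group (cgroup F n)"
  unfolding cgroup_def by (rule subgroup.subgroup_is_group[OF subgroup_cgroup group_GL])

lemma theta_eq:
  assumes "A \<in> carrier (GL N)"
  shows "inv\<^bsub>GL N\<^esub> ((conj_mat A)\<^sup>T) = (conj_mat (inv\<^bsub>GL N\<^esub> A))\<^sup>T"
proof (rule GL_inv_unique)
  have [simp]: "A \<in> carrier_mat N N" using assms by (simp add: GL_carrier)
  note i = GL_inv[OF assms]
  show "(conj_mat A)\<^sup>T \<in> carrier_mat N N" by simp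
  show "(conj_mat (inv\<^bsub>GL N\<^esub> A))\<^sup>T \<in> carrier_mat N N" using i by simp
  have "(conj_mat (inv\<^bsub>GL N\<^esub> A))\<^sup>T * (conj_mat A)\<^sup>T = (conj_mat (A * inv\<^bsub>GL N\<^esub> A))\<^sup>T"
    using i(1) by (subst conj_mult[of A N N _ N], simp, simp) (subst transpose_mult[of "conj_mat A" N N _ N], simp_all)
  then show "(conj_mat (inv\<^bsub>GL N\<^esub> A))\<^sup>T * (conj_mat A)\<^sup>T = 1\<^sub>m N"
    using i by (simp add: conj_one transpose_one)
qed

lemma GL_conj: "A \<in> carrier (GL N) \<Longrightarrow> conj_mat A \<in> carrier (GL N)"
  by (auto simp: GL_carrier det_conj)

lemma GL_transpose: "A \<in> carrier (GL N) \<Longrightarrow> A\<^sup>T \<in> carrier (GL N)"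
  by (auto simp: GL_carrier det_transpose)

lemma theta_mult:
  assumes "\<theta> \<in> involutions N" "A \<in> carrier (GL N)" "B \<in> carrier (GL N)"
  shows "\<theta> (A * B) = \<theta> A * \<theta> B"
proof -
  interpret group "GL N" by (rule group_GL)
  have c[simp]: "A \<in> carrier_mat N N" "B \<in> carrier_mat N N" using assms by (auto simp: GL_carrier)
  note iA = GL_inv[OF assms(2)] and iB = GL_inv[OF assms(3)]
  have AB: "A * B \<in> carrier (GL N)" using m_closed[OF assms(2,3)] by (simp add: GL_ops)
  have inv: "inv\<^bsub>GL N\<^esub> (A * B) = inv\<^bsub>GL N\<^esub> B * inv\<^bsub>GL N\<^esub> A"
    using inv_mult_group[OF assms(2,3)] by (simp add: GL_ops)
  have "inv\<^bsub>GL N\<^esub> ((conj_mat (A * B))\<^sup>T) = inv\<^bsub>GL N\<^esub> ((conj_mat A)\<^sup>T) * inv\<^bsub>GL N\<^esub> ((conj_mat B)\<^sup>T)"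
    unfolding theta_eq[OF AB] theta_eq[OF assms(2)] theta_eq[OF assms(3)] inv
    using iA iB by (simp add: conj_mult[of _ N N _ N] transpose_mult[of _ N N _ N])
  then show ?thesis using assms(1) by (auto simp: involutions_def conj_mult[of _ N N _ N])
qed

lemma form_group_conj:
  assumes "A \<in> form_group N B" "B \<in> carrier_mat N N" "conj_mat B = B"
  shows "conj_mat A \<in> form_group N B"
proof -
  have A: "A \<in> carrier (GL N)" and [simp]: "A \<in> carrier_mat N N" and f: "A\<^sup>T * B * A = B"
    using assms by (auto simp: form_group_def GL_carrier)
  have "conj_mat (A\<^sup>T * B * A) = (conj_mat A)\<^sup>T * conj_mat B * conj_mat A"
    using assms(2) by (simp add: conj_mult[of _ N N _ N] mult_carrier_mat[of _ N N _ N] conj_transpose)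
  then show ?thesis using GL_conj[OF A] f assms by (simp add: form_group_def)
qed

lemma form_group_transpose:
  assumes "A \<in> form_group N B" "B \<in> carrier_mat N N" "B * B = c \<cdot>\<^sub>m 1\<^sub>m N" "c \<noteq> 0"
  shows "A\<^sup>T \<in> form_group N B"
  using assms form_transpose[of A N B c] GL_transpose[of A N]
  by (auto simp: form_group_def GL_carrier)

lemma cgroup_conj: "A \<in> cgroup_set F n \<Longrightarrow> conj_mat A \<in> cgroup_set F n"
  unfolding cgroup_set_eq
  by (cases F) (auto intro!: form_group_conj GL_conj J_carrier conj_J conj_one simp: SL_C_def GL_C_def det_conj)

lemma cgroup_transpose: "A \<in> cgroup_set F n \<Longrightarrow> A\<^sup>T \<in> cgroup_set F n"
proof -
  have O: "A\<^sup>T \<in> form_group n (1\<^sub>m n)" if "A \<in> form_group n (1\<^sub>m n)"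
    by (rule form_group_transpose[OF that, of 1]) auto
  have Sp: "A\<^sup>T \<in> form_group (2 * n) (J_mat n)" if "A \<in> form_group (2 * n) (J_mat n)"
    by (rule form_group_transpose[OF that J_carrier J_square]) auto
  have SL: "A\<^sup>T \<in> SL_C N" if "A \<in> SL_C N" for N
    using that GL_transpose[of A N] det_transpose[of A N] by (auto simp: SL_C_def GL_C_def GL_carrier)
  show "A \<in> cgroup_set F n \<Longrightarrow> A\<^sup>T \<in> cgroup_set F n"
    unfolding cgroup_set_eq using O Sp SL by (cases F) (auto intro: GL_transpose)
qed

lemma theta_hom:
  assumes "\<theta> \<in> involutions (mat_size F n)" shows "\<theta> \<in> hom (cgroup F n) (cgroup F n)"
proof (rule homI)
  have sub: "cgroup_set F n \<subseteq> carrier (GL (mat_size F n))"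
    using subgroup_cgroup by (rule subgroup.subset)
  { fix x assume "x \<in> carrier (cgroup F n)"
    then have x: "x \<in> cgroup_set F n" by (simp add: cgroup_def)
    then have "inv\<^bsub>GL (mat_size F n)\<^esub> ((conj_mat x)\<^sup>T) \<in> cgroup_set F n"
      by (intro subgroup.m_inv_closed[OF subgroup_cgroup] cgroup_transpose cgroup_conj)
    then show "\<theta> x \<in> carrier (cgroup F n)"
      using assms cgroup_conj[OF x] by (auto simp: involutions_def cgroup_def) }
  fix x y assume "x \<in> carrier (cgroup F n)" "y \<in> carrier (cgroup F n)"
  then show "\<theta> (x \<otimes>\<^bsub>cgroup F n\<^esub> y) = \<theta> x \<otimes>\<^bsub>cgroup F n\<^esub> \<theta> y"
    using theta_mult[OF assms, of x y] sub by (auto simp: cgroup_def GL_ops)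
qed

lemma hom_comp_rep: "h \<in> hom G H \<Longrightarrow> i \<in> hom H I \<Longrightarrow> i \<circ> h \<in> hom G I"
  by (auto simp: hom_def Pi_def)

lemma rf_cong:
  assumes "f \<in> regular_functions \<Gamma> S N G" "\<rho> \<in> hom \<Gamma> G" "\<rho>' \<in> hom \<Gamma> G" "\<And>s. s \<in> S \<Longrightarrow> \<rho> s = \<rho>' s"
  shows "f \<rho> = f \<rho>'"
  using assms by (induction rule: regular_functions.induct) auto

lemma rf_sum:
  assumes "finite A" "\<And>a. a \<in> A \<Longrightarrow> (\<lambda>\<rho>\<in>hom \<Gamma> G. f a \<rho>) \<in> regular_functions \<Gamma> S N G"
  shows "(\<lambda>\<rho>\<in>hom \<Gamma> G. \<Sum>a\<in>A. f a \<rho>) \<in> regular_functions \<Gamma> S N G"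
  using assms
proof (induction rule: finite_induct)
  case empty
  then show ?case using rf_const[where c = 0] by (simp only: sum.empty)
next
  case (insert a A)
  have "(\<lambda>\<rho>\<in>hom \<Gamma> G. \<Sum>a\<in>insert a A. f a \<rho>)
    = (\<lambda>\<rho>\<in>hom \<Gamma> G. (\<lambda>\<rho>\<in>hom \<Gamma> G. f a \<rho>) \<rho> + (\<lambda>\<rho>\<in>hom \<Gamma> G. \<Sum>a\<in>A. f a \<rho>) \<rho>)"
    using insert by (intro restrict_ext) simp
  moreover have "\<dots> \<in> regular_functions \<Gamma> S N G" using insert by (intro rf_add) auto
  ultimately show ?case by (simp only:)
qed

lemma rf_prod:
  assumes "finite A" "\<And>a. a \<in> A \<Longrightarrow> (\<lambda>\<rho>\<in>hom \<Gamma> G. f a \<rho>) \<in> regular_functions \<Gamma> S N G"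
  shows "(\<lambda>\<rho>\<in>hom \<Gamma> G. \<Prod>a\<in>A. f a \<rho>) \<in> regular_functions \<Gamma> S N G"
  using assms
proof (induction rule: finite_induct)
  case empty
  then show ?case using rf_const[where c = 1] by (simp only: prod.empty)
next
  case (insert a A)
  have "(\<lambda>\<rho>\<in>hom \<Gamma> G. \<Prod>a\<in>insert a A. f a \<rho>)
    = (\<lambda>\<rho>\<in>hom \<Gamma> G. (\<lambda>\<rho>\<in>hom \<Gamma> G. f a \<rho>) \<rho> * (\<lambda>\<rho>\<in>hom \<Gamma> G. \<Prod>a\<in>A. f a \<rho>) \<rho>)"
    using insert by (intro restrict_ext) simp
  moreover have "\<dots> \<in> regular_functions \<Gamma> S N G" using insert by (intro rf_mult) auto
  ultimately show ?case by (simp only:)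
qed

lemma rf_times:
  assumes "(\<lambda>\<rho>\<in>hom \<Gamma> G. f \<rho>) \<in> regular_functions \<Gamma> S N G" "(\<lambda>\<rho>\<in>hom \<Gamma> G. g \<rho>) \<in> regular_functions \<Gamma> S N G"
  shows "(\<lambda>\<rho>\<in>hom \<Gamma> G. f \<rho> * g \<rho>) \<in> regular_functions \<Gamma> S N G"
proof -
  have "(\<lambda>\<rho>\<in>hom \<Gamma> G. f \<rho> * g \<rho>)
    = (\<lambda>\<rho>\<in>hom \<Gamma> G. (\<lambda>\<rho>\<in>hom \<Gamma> G. f \<rho>) \<rho> * (\<lambda>\<rho>\<in>hom \<Gamma> G. g \<rho>) \<rho>)"
    by (intro restrict_ext) simp
  moreover have "\<dots> \<in> regular_functions \<Gamma> S N G" using assms by (rule rf_mult)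
  ultimately show ?thesis by (simp only:)
qed

lemma rf_det:
  assumes A: "\<And>\<rho>. \<rho> \<in> hom \<Gamma> G \<Longrightarrow> A \<rho> \<in> carrier_mat m m"
    and e: "\<And>i j. i < m \<Longrightarrow> j < m \<Longrightarrow> (\<lambda>\<rho>\<in>hom \<Gamma> G. A \<rho> $$ (i, j)) \<in> regular_functions \<Gamma> S N G"
  shows "(\<lambda>\<rho>\<in>hom \<Gamma> G. det (A \<rho>)) \<in> regular_functions \<Gamma> S N G"
proof -
  have "(\<lambda>\<rho>\<in>hom \<Gamma> G. det (A \<rho>)) = (\<lambda>\<rho>\<in>hom \<Gamma> G. \<Sum>p\<in>{p. p permutes {0..<m}}.
      signof p * (\<Prod>i=0..<m. A \<rho> $$ (i, p i)))"
    using A by (intro restrict_ext) (simp add: det_def')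
  also have "\<dots> \<in> regular_functions \<Gamma> S N G"
  proof (intro rf_sum rf_times rf_const rf_prod)
    show "finite {p. p permutes {0..<m}}" by (rule finite_permutations) simp
  qed (auto intro!: e dest: permutes_in_image)
  finally show ?thesis .
qed

lemma rf_theta_pullback:
  fixes \<Gamma> :: "('g, 'm) monoid_scheme"
  assumes S: "S \<subseteq> carrier \<Gamma>" and th: "\<theta> \<in> involutions (mat_size F n)"
    and f: "f \<in> regular_functions \<Gamma> S (mat_size F n) (cgroup F n)"
  shows "theta_pullback \<Gamma> (cgroup F n) \<theta> f \<in> regular_functions \<Gamma> S (mat_size F n) (cgroup F n)"
proof -
  define N where "N = mat_size F n"
  define G where "G = cgroup F n"
  have sub: "carrier G \<subseteq> carrier (GL N)"
    using subgroup.subset[OF subgroup_cgroup] by (simp add: G_def N_def cgroup_def)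
  have GL: "\<rho> s \<in> carrier (GL N)" if "\<rho> \<in> hom \<Gamma> G" "s \<in> S" for \<rho> s
    using hom_in_carrier[of \<rho> \<Gamma> G s] that S sub by auto
  have comp: "\<theta> \<circ> \<rho> \<in> hom \<Gamma> G" if "\<rho> \<in> hom \<Gamma> G" for \<rho>
    using hom_comp_rep[OF that] theta_hom[OF th] by (simp add: G_def)
  have th': "\<theta> = conj_mat \<or> \<theta> = (\<lambda>A. inv\<^bsub>GL N\<^esub> ((conj_mat A)\<^sup>T))"
    using th by (auto simp: involutions_def N_def)
  have carr: "\<rho> s \<in> carrier_mat N N" "det (\<rho> s) \<noteq> 0" if "\<rho> \<in> hom \<Gamma> G" "s \<in> S" for \<rho> s
    using GL[OF that] by (auto simp: GL_carrier)
  have det: "(\<lambda>\<rho>\<in>hom \<Gamma> G. det (\<rho> s)) \<in> regular_functions \<Gamma> S N G" if "s \<in> S" for s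
  proof (rule rf_det[where A = "\<lambda>\<rho>. \<rho> s" and m = N])
    show "\<rho> s \<in> carrier_mat N N" if "\<rho> \<in> hom \<Gamma> G" for \<rho>
      by (rule carr(1)[OF that \<open>s \<in> S\<close>])
    show "(\<lambda>\<rho>\<in>hom \<Gamma> G. \<rho> s $$ (i, j)) \<in> regular_functions \<Gamma> S N G" if "i < N" "j < N" for i j
      by (rule rf_entry[OF \<open>s \<in> S\<close> that])
  qed
  have entry: "(\<lambda>\<rho>\<in>hom \<Gamma> G. cnj (\<theta> (\<rho> s) $$ (i, j))) \<in> regular_functions \<Gamma> S N G"
    if s: "s \<in> S" and ij: "i < N" "j < N" for s i j
    using th'
  proof
    assume t: "\<theta> = conj_mat"
    have "(\<lambda>\<rho>\<in>hom \<Gamma> G. cnj (\<theta> (\<rho> s) $$ (i, j))) = (\<lambda>\<rho>\<in>hom \<Gamma> G. \<rho> s $$ (i, j))"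
    proof (rule restrict_ext)
      fix \<rho> assume r: "\<rho> \<in> hom \<Gamma> G"
      show "cnj (\<theta> (\<rho> s) $$ (i, j)) = \<rho> s $$ (i, j)"
        using carrier_matD[OF carr(1)[OF r s]] ij by (simp add: t)
    qed
    then show ?thesis using rf_entry[OF s ij] by simp
  next
    assume t: "\<theta> = (\<lambda>A. inv\<^bsub>GL N\<^esub> ((conj_mat A)\<^sup>T))"
    have "cnj (\<theta> (\<rho> s) $$ (i, j)) = 1 / det (\<rho> s) * ((- 1) ^ (i + j) * det (mat_delete (\<rho> s) i j))"
      if r: "\<rho> \<in> hom \<Gamma> G" for \<rho>
    proof -
      let ?A = "\<rho> s"
      note A = GL[OF r s] carr[OF r s]
      have [simp]: "?A \<in> carrier_mat N N" "det ?A \<noteq> 0" using A by auto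
      have [simp]: "adj_mat ?A \<in> carrier_mat N N" using adj_mat[OF A(2)] by simp
      have "(1 / det ?A) \<cdot>\<^sub>m adj_mat ?A * ?A = (1 / det ?A) \<cdot>\<^sub>m (det ?A \<cdot>\<^sub>m 1\<^sub>m N)"
        using adj_mat[OF A(2)] by (simp add: mult_smult_assoc_mat[of _ N N _ N])
      also have "\<dots> = 1\<^sub>m N" by (rule eq_matI) auto
      finally have "inv\<^bsub>GL N\<^esub> ?A = (1 / det ?A) \<cdot>\<^sub>m adj_mat ?A"
        by (intro GL_inv_unique) auto
      then have "\<theta> ?A = (conj_mat ((1 / det ?A) \<cdot>\<^sub>m adj_mat ?A))\<^sup>T"
        using theta_eq[OF A(1)] t by simp
      moreover have "dim_row ?A = N" "dim_col ?A = N" "dim_row (adj_mat ?A) = N" "dim_col (adj_mat ?A) = N"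
        using carrier_matD[OF A(2)] carrier_matD[of "adj_mat ?A" N N] by auto
      ultimately show ?thesis using ij by (simp add: adj_mat_def cofactor_def)
    qed
    then have "(\<lambda>\<rho>\<in>hom \<Gamma> G. cnj (\<theta> (\<rho> s) $$ (i, j)))
      = (\<lambda>\<rho>\<in>hom \<Gamma> G. 1 / det (\<rho> s) * ((- 1) ^ (i + j) * det (mat_delete (\<rho> s) i j)))"
      by (intro restrict_ext)
    also have "\<dots> \<in> regular_functions \<Gamma> S N G"
    proof (intro rf_times rf_inv_det rf_const rf_det[where m = "N - 1"] s)
      fix \<rho> assume r: "\<rho> \<in> hom \<Gamma> G"
      show "mat_delete (\<rho> s) i j \<in> carrier_mat (N - 1) (N - 1)"
        by (rule mat_delete_carrier[OF carr(1)[OF r s]])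
    next
      fix a b assume ab: "a < N - 1" "b < N - 1"
      let ?a = "if a < i then a else Suc a" and ?b = "if b < j then b else Suc b"
      have "(\<lambda>\<rho>\<in>hom \<Gamma> G. mat_delete (\<rho> s) i j $$ (a, b)) = (\<lambda>\<rho>\<in>hom \<Gamma> G. \<rho> s $$ (?a, ?b))"
      proof (rule restrict_ext)
        fix \<rho> assume r: "\<rho> \<in> hom \<Gamma> G"
        show "mat_delete (\<rho> s) i j $$ (a, b) = \<rho> s $$ (?a, ?b)"
          using carrier_matD[OF carr(1)[OF r s]] ab by (simp add: mat_delete_def)
      qed
      also have "\<dots> \<in> regular_functions \<Gamma> S N G" by (intro rf_entry s) (use ab in auto)
      finally show "(\<lambda>\<rho>\<in>hom \<Gamma> G. mat_delete (\<rho> s) i j $$ (a, b)) \<in> regular_functions \<Gamma> S N G" .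
    qed
    finally show ?thesis .
  qed
  have inv_det: "(\<lambda>\<rho>\<in>hom \<Gamma> G. cnj (1 / det (\<theta> (\<rho> s)))) \<in> regular_functions \<Gamma> S N G"
    if s: "s \<in> S" for s
    using th'
  proof
    assume t: "\<theta> = conj_mat"
    show ?thesis using rf_inv_det[OF s] by (simp add: t det_conj)
  next
    assume t: "\<theta> = (\<lambda>A. inv\<^bsub>GL N\<^esub> ((conj_mat A)\<^sup>T))"
    have "cnj (1 / det (\<theta> (\<rho> s))) = det (\<rho> s)" if r: "\<rho> \<in> hom \<Gamma> G" for \<rho>
    proof -
      note A = GL[OF r s]
      have "det (\<theta> (\<rho> s)) = cnj (det (inv\<^bsub>GL N\<^esub> (\<rho> s)))"
        using GL_inv[OF A] theta_eq[OF A] t by (simp add: det_transpose[of _ N] det_conj)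
      then show ?thesis using GL_inv(5)[OF A] GL_inv(2)[OF A] by (simp add: field_simps)
    qed
    then have "(\<lambda>\<rho>\<in>hom \<Gamma> G. cnj (1 / det (\<theta> (\<rho> s)))) = (\<lambda>\<rho>\<in>hom \<Gamma> G. det (\<rho> s))"
      by (intro restrict_ext)
    then show ?thesis using det[OF s] by (simp only:)
  qed
  have "f \<in> regular_functions \<Gamma> S N G" using f by (simp add: G_def N_def)
  then have "theta_pullback \<Gamma> G \<theta> f \<in> regular_functions \<Gamma> S N G"
  proof (induction rule: regular_functions.induct)
    case (rf_const c)
    have "theta_pullback \<Gamma> G \<theta> (\<lambda>\<rho>\<in>hom \<Gamma> G. c) = (\<lambda>\<rho>\<in>hom \<Gamma> G. cnj c)"
      unfolding theta_pullback_def using comp by (intro restrict_ext) simp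
    then show ?case using regular_functions.rf_const by (simp only:)
  next
    case (rf_entry s i j)
    have "theta_pullback \<Gamma> G \<theta> (\<lambda>\<rho>\<in>hom \<Gamma> G. \<rho> s $$ (i, j)) = (\<lambda>\<rho>\<in>hom \<Gamma> G. cnj (\<theta> (\<rho> s) $$ (i, j)))"
      unfolding theta_pullback_def using comp by (intro restrict_ext) simp
    then show ?case using entry rf_entry by (simp only:)
  next
    case (rf_inv_det s)
    have "theta_pullback \<Gamma> G \<theta> (\<lambda>\<rho>\<in>hom \<Gamma> G. 1 / det (\<rho> s)) = (\<lambda>\<rho>\<in>hom \<Gamma> G. cnj (1 / det (\<theta> (\<rho> s))))"
      unfolding theta_pullback_def using comp by (intro restrict_ext) simp
    then show ?case using inv_det rf_inv_det by (simp only:)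
  next
    case (rf_add f g)
    have "theta_pullback \<Gamma> G \<theta> (\<lambda>\<rho>\<in>hom \<Gamma> G. f \<rho> + g \<rho>)
      = (\<lambda>\<rho>\<in>hom \<Gamma> G. theta_pullback \<Gamma> G \<theta> f \<rho> + theta_pullback \<Gamma> G \<theta> g \<rho>)"
      unfolding theta_pullback_def using comp by (intro restrict_ext) simp
    then show ?case using regular_functions.rf_add[OF rf_add.IH] by (simp only:)
  next
    case (rf_mult f g)
    have "theta_pullback \<Gamma> G \<theta> (\<lambda>\<rho>\<in>hom \<Gamma> G. f \<rho> * g \<rho>)
      = (\<lambda>\<rho>\<in>hom \<Gamma> G. theta_pullback \<Gamma> G \<theta> f \<rho> * theta_pullback \<Gamma> G \<theta> g \<rho>)"
      unfolding theta_pullback_def using comp by (intro restrict_ext) simp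
    then show ?case using regular_functions.rf_mult[OF rf_mult.IH] by (simp only:)
  qed
  then show ?thesis by (simp add: G_def N_def)
qed

lemma conj_rep_hom:
  assumes "group G" "\<rho> \<in> hom \<Gamma> G" "g \<in> carrier G"
  shows "conj_rep G g \<rho> \<in> hom \<Gamma> G"
proof -
  interpret group G by fact
  show ?thesis
  proof (rule homI)
    fix x assume "x \<in> carrier \<Gamma>"
    then show "conj_rep G g \<rho> x \<in> carrier G"
      using assms hom_in_carrier[OF assms(2)] by (simp add: conj_rep_def)
  next
    fix x y assume xy: "x \<in> carrier \<Gamma>" "y \<in> carrier \<Gamma>"
    have c: "\<rho> x \<in> carrier G" "\<rho> y \<in> carrier G" using xy hom_in_carrier[OF assms(2)] by auto
    have "inv\<^bsub>G\<^esub> g \<otimes>\<^bsub>G\<^esub> (g \<otimes>\<^bsub>G\<^esub> (\<rho> y \<otimes>\<^bsub>G\<^esub> inv\<^bsub>G\<^esub> g)) = \<rho> y \<otimes>\<^bsub>G\<^esub> inv\<^bsub>G\<^esub> g"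
      using inv_solve_left[of "\<rho> y \<otimes>\<^bsub>G\<^esub> inv\<^bsub>G\<^esub> g" g "g \<otimes>\<^bsub>G\<^esub> (\<rho> y \<otimes>\<^bsub>G\<^esub> inv\<^bsub>G\<^esub> g)"] c assms(3) by simp
    then show "conj_rep G g \<rho> (x \<otimes>\<^bsub>\<Gamma>\<^esub> y) = conj_rep G g \<rho> x \<otimes>\<^bsub>G\<^esub> conj_rep G g \<rho> y"
      using c assms(3) by (simp add: conj_rep_def hom_mult[OF assms(2) xy] m_assoc)
  qed
qed

lemma theta_pullback_invariant:
  assumes S: "S \<subseteq> carrier \<Gamma>" and th: "\<theta> \<in> involutions (mat_size F n)"
    and f: "f \<in> invariant_functions \<Gamma> S (mat_size F n) (cgroup F n)"
  shows "theta_pullback \<Gamma> (cgroup F n) \<theta> f \<in> invariant_functions \<Gamma> S (mat_size F n) (cgroup F n)"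
proof -
  let ?G = "cgroup F n"
  interpret group ?G by (rule group_cgroup)
  interpret th: group_hom ?G ?G \<theta> by unfold_locales (rule theta_hom[OF th])
  have r: "f \<in> regular_functions \<Gamma> S (mat_size F n) ?G"
    and i: "\<And>\<rho> g. \<rho> \<in> hom \<Gamma> ?G \<Longrightarrow> g \<in> carrier ?G \<Longrightarrow> f (conj_rep ?G g \<rho>) = f \<rho>"
    using f by (auto simp: invariant_functions_def)
  have "theta_pullback \<Gamma> ?G \<theta> f (conj_rep ?G g \<rho>) = theta_pullback \<Gamma> ?G \<theta> f \<rho>"
    if h: "\<rho> \<in> hom \<Gamma> ?G" and g: "g \<in> carrier ?G" for \<rho> g
  proof -
    have c: "conj_rep ?G g \<rho> \<in> hom \<Gamma> ?G" by (rule conj_rep_hom[OF group_cgroup h g])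
    have t: "\<theta> \<circ> \<rho> \<in> hom \<Gamma> ?G" using hom_comp_rep[OF h th.homh] .
    have "f (\<theta> \<circ> conj_rep ?G g \<rho>) = f (conj_rep ?G (\<theta> g) (\<theta> \<circ> \<rho>))"
    proof (rule rf_cong[OF r])
      show "\<theta> \<circ> conj_rep ?G g \<rho> \<in> hom \<Gamma> ?G" using hom_comp_rep[OF c th.homh] .
      show "conj_rep ?G (\<theta> g) (\<theta> \<circ> \<rho>) \<in> hom \<Gamma> ?G"
        by (rule conj_rep_hom[OF group_cgroup t]) (use g in simp)
      fix s assume "s \<in> S"
      then have "\<rho> s \<in> carrier ?G" using S hom_in_carrier[OF h] by auto
      then show "(\<theta> \<circ> conj_rep ?G g \<rho>) s = conj_rep ?G (\<theta> g) (\<theta> \<circ> \<rho>) s"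
        using g by (simp add: conj_rep_def)
    qed
    then show ?thesis using i[OF t, of "\<theta> g"] g c h by (simp add: theta_pullback_def)
  qed
  then show ?thesis
    unfolding invariant_functions_def using rf_theta_pullback[OF S th r] by blast
qed

lemma chi_in_char_variety:
  assumes G: "group G" and h: "\<rho> \<in> hom \<Gamma> G"
  shows "chi \<Gamma> S N G \<rho> \<in> char_variety \<Gamma> S N G"
proof -
  let ?I = "invariant_functions \<Gamma> S N G"
  have R: "f \<in> regular_functions \<Gamma> S N G" if "f \<in> ?I" for f
    using that by (simp add: invariant_functions_def)
  have i: "f (conj_rep G g \<rho>) = f \<rho>" if "f \<in> ?I" "\<rho> \<in> hom \<Gamma> G" "g \<in> carrier G" for f \<rho> g
    using that by (simp add: invariant_functions_def)
  have c: "conj_rep G g \<rho> \<in> hom \<Gamma> G" if "\<rho> \<in> hom \<Gamma> G" "g \<in> carrier G" for \<rho> g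
    using conj_rep_hom[OF G that] .
  have I: "(\<lambda>\<rho>\<in>hom \<Gamma> G. f \<rho>) \<in> ?I"
    if "(\<lambda>\<rho>\<in>hom \<Gamma> G. f \<rho>) \<in> regular_functions \<Gamma> S N G"
      "\<And>\<rho> g. \<rho> \<in> hom \<Gamma> G \<Longrightarrow> g \<in> carrier G \<Longrightarrow> f (conj_rep G g \<rho>) = f \<rho>" for f
    unfolding invariant_functions_def using that
    by (intro CollectI conjI ballI) (simp_all only: restrict_apply' c)
  have const: "(\<lambda>\<rho>\<in>hom \<Gamma> G. c) \<in> ?I" for c
    by (rule I[OF rf_const]) (rule refl)
  have add: "(\<lambda>\<rho>\<in>hom \<Gamma> G. f \<rho> + g \<rho>) \<in> ?I" if "f \<in> ?I" "g \<in> ?I" for f g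
    using that by (intro I rf_add R) (simp_all only: i)
  have mult: "(\<lambda>\<rho>\<in>hom \<Gamma> G. f \<rho> * g \<rho>) \<in> ?I" if "f \<in> ?I" "g \<in> ?I" for f g
    using that by (intro I rf_mult R) (simp_all only: i)
  have smult: "(\<lambda>\<rho>\<in>hom \<Gamma> G. c * f \<rho>) \<in> ?I" if "f \<in> ?I" for f c
  proof -
    have "(\<lambda>\<rho>\<in>hom \<Gamma> G. c * f \<rho>) = (\<lambda>\<rho>\<in>hom \<Gamma> G. (\<lambda>\<rho>\<in>hom \<Gamma> G. c) \<rho> * f \<rho>)"
      by (intro restrict_ext) (simp only: restrict_apply')
    then show ?thesis using mult[OF const that] by (simp only:)
  qed
  have ev: "chi \<Gamma> S N G \<rho> f = f \<rho>" if "f \<in> ?I" for f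
    using that by (simp only: chi_def restrict_apply')
  show ?thesis
    unfolding char_variety_def
  proof (intro CollectI conjI allI ballI)
    show "chi \<Gamma> S N G \<rho> \<in> extensional ?I" by (simp only: chi_def restrict_extensional)
  qed (simp_all only: ev const add mult smult restrict_apply' h)
qed

lemma Phi_chi:
  assumes S: "S \<subseteq> carrier \<Gamma>" and th: "\<theta> \<in> involutions (mat_size F n)"
    and h: "\<rho> \<in> hom \<Gamma> (cgroup F n)"
  shows "Phi \<Gamma> S (mat_size F n) (cgroup F n) \<theta> (chi \<Gamma> S (mat_size F n) (cgroup F n) \<rho>)
    = chi \<Gamma> S (mat_size F n) (cgroup F n) (\<theta> \<circ> \<rho>)"
proof -
  let ?I = "invariant_functions \<Gamma> S (mat_size F n) (cgroup F n)"
  have "Phi \<Gamma> S (mat_size F n) (cgroup F n) \<theta> (chi \<Gamma> S (mat_size F n) (cgroup F n) \<rho>)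
    = (\<lambda>f\<in>?I. cnj (theta_pullback \<Gamma> (cgroup F n) \<theta> f \<rho>))"
    unfolding Phi_def restrict_apply'[OF chi_in_char_variety[OF group_cgroup h]]
    by (intro restrict_ext) (simp only: chi_def restrict_apply' theta_pullback_invariant[OF S th])
  also have "\<dots> = chi \<Gamma> S (mat_size F n) (cgroup F n) (\<theta> \<circ> \<rho>)"
    unfolding chi_def using h by (intro restrict_ext) (simp add: theta_pullback_def)
  finally show ?thesis .
qed

end

theory Submission
  imports Defs "Jordan_Normal_Form.Char_Poly"
begin

text \<open>The hypothesis says that \<open>\<rho>\<close> and \<open>\<theta> \<circ> \<rho>\<close> take the same value on every invariant function, in
particular on \<open>\<rho> \<mapsto> tr (\<rho> \<gamma>)\<close>. Two representations with the same traces, one of them irreducible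
and the other one obtained from it by \<open>\<theta>\<close>, are conjugate (\<open>conjugate_if_traces_agree\<close>), so there is
an invertible \<open>P\<close> with \<open>\<theta> (\<rho> \<gamma>) P = P \<rho> \<gamma>\<close>. By Schur's lemma \<open>P\<close> is unique up to a scalar, hence
whatever can be built from \<open>P\<close> and also intertwines is proportional to \<open>P\<close>. This gives \<open>P\<close> enough
symmetry to be brought to a normal form by a change of basis inside the group, and the normal form
is the equation of a real form.

For \<open>\<theta> = conj_mat\<close> in \<open>GL\<close> or \<open>SL\<close>, the product of the conjugate of \<open>P\<close> with \<open>P\<close> is a real scalar, and
\<open>P\<close> is a real or a quaternionic structure. An intertwiner to the standard structure is an explicit
combination \<open>z + e cnj z K P\<close> as in Hilbert's Theorem 90 (\<open>twisted_intertwiner\<close>).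

In all other cases there is an invariant sesquilinear form \<open>S\<close>, that is, \<open>adj A * S * A = S\<close> on the image of
\<open>\<rho>\<close>: for the inverse adjoint this is \<open>P\<close> itself, and for the conjugation in an orthogonal or symplectic
group with form \<open>F\<close> it is \<open>F * P\<close>. Schur's lemma makes \<open>S\<close> Hermitian or skew-Hermitian and an isometry
of \<open>F\<close>. With \<open>T = (adj S * S)\<^bsup>1/4\<^esup>\<close> one has \<open>S = T * W * T\<close>, where \<open>W\<close> is unitary of square \<open>\<plusminus> 1\<close> and both
factors preserve \<open>F\<close> (\<open>polar_normalisation\<close>). Such a \<open>W\<close> is similar to a standard matrix as soon as the
traces agree. The similarity is made compatible with \<open>F\<close> by averaging over a conjugate-linear
involution, as in Theorem 90, and then unitary by dividing by its absolute value
(\<open>twisted_averaging\<close>, \<open>unitary_intertwiner\<close>). The standard matrices are \<open>I_mat p q\<close>, \<open>K_mat p q\<close> and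
\<open>J_mat m\<close>; the trace of \<open>W\<close> fixes the signature.

Two points concern determinants. Isometries of a nondegenerate alternating form have determinant one
(\<open>det_isometry_alternating\<close>); so the change of basis lies in the symplectic group, and the multiplicity
of the eigenvalue \<open>- 1\<close> of a Hermitian \<open>W\<close> is even, as \<open>K_mat p q\<close> requires. For \<open>SO\<close> the change of
basis is orthogonal, and its determinant can be corrected by a diagonal sign matrix that respects the
normal form up to sign, except for the quaternionic structure in dimension \<open>4 k\<close>. There the two
values of the determinant lead to the two real forms \<open>SO_H\<close> and \<open>SO_H_minus\<close>.\<close>

section \<open>Eigenvectors in invariant subspaces\<close>

text \<open>Padding \<open>A\<close> with zero rows gives a square matrix of determinant zero.\<close>

lemma underdetermined_system_solution:
  fixes A :: "complex mat"
  assumes "A \<in> carrier_mat k m" "k < m"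
  shows "\<exists>v \<in> carrier_vec m. v \<noteq> 0\<^sub>v m \<and> A *\<^sub>v v = 0\<^sub>v k"
proof -
  define B where "B = mat m m (\<lambda>(i,j). if i < k then A $$ (i,j) else 0)"
  have B: "B \<in> carrier_mat m m" by (simp add: B_def)
  have "row B k = 0\<^sub>v m" using assms by (intro eq_vecI) (auto simp: B_def)
  then have "B $$ (k, j) = 0" if "j < m" for j using that assms by (simp add: B_def)
  then have "det B = 0" using assms by (subst laplace_expansion_row[OF B, of k]) auto
  then obtain v where v: "v \<in> carrier_vec m" "v \<noteq> 0\<^sub>v m" "B *\<^sub>v v = 0\<^sub>v m"
    using det_0_iff_vec_prod_zero[OF B] by auto
  have "A *\<^sub>v v = 0\<^sub>v k"
  proof (rule eq_vecI)
    fix i assume i: "i < dim_vec (0\<^sub>v k)"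
    then have "row A i = row B i" using assms by (intro eq_vecI) (auto simp: B_def)
    moreover have "(B *\<^sub>v v) $ i = 0" using v i assms by simp
    ultimately show "(A *\<^sub>v v) $ i = 0\<^sub>v k $ i" using i assms B by auto
  qed (use assms in auto)
  then show ?thesis using v by auto
qed

text \<open>This is \<open>q(A) y\<close>, evaluated by Horner's scheme.\<close>

definition poly_act :: "complex mat \<Rightarrow> complex vec \<Rightarrow> complex poly \<Rightarrow> complex vec" where
  "poly_act A y q = fold_coeffs (\<lambda>c w. c \<cdot>\<^sub>v y + A *\<^sub>v w) q (0\<^sub>v (dim_vec y))"

context
  fixes N :: nat and A :: "complex mat" and y :: "complex vec"
  assumes A: "A \<in> carrier_mat N N" and y: "y \<in> carrier_vec N"
begin

lemma poly_act_0: "poly_act A y 0 = 0\<^sub>v N"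
  using y by (simp add: poly_act_def)

lemma poly_act_pCons: "poly_act A y (pCons c q) = c \<cdot>\<^sub>v y + A *\<^sub>v poly_act A y q"
proof (cases "c = 0 \<and> q = 0")
  case True
  have "A *\<^sub>v 0\<^sub>v N = 0\<^sub>v N" using A by (intro eq_vecI) auto
  then show ?thesis using True A y by (auto simp: poly_act_def)
next
  case False
  then show ?thesis by (auto simp: poly_act_def)
qed

lemma poly_act_carrier: "poly_act A y q \<in> carrier_vec N"
  using A y by (induction q) (auto simp: poly_act_0 poly_act_pCons)

lemma poly_act_add: "poly_act A y (p + q) = poly_act A y p + poly_act A y q"
proof (induction p q rule: poly_induct2)
  case 0 then show ?case by (simp add: poly_act_0)
next
  case (pCons a p b q)
  have "A *\<^sub>v (poly_act A y p + poly_act A y q) = A *\<^sub>v poly_act A y p + A *\<^sub>v poly_act A y q"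
    by (rule mult_add_distrib_mat_vec[OF A]) (auto simp: poly_act_carrier)
  then show ?case using A y poly_act_carrier[of p] poly_act_carrier[of q]
    by (simp add: poly_act_pCons pCons.IH) (rule eq_vecI, auto simp: algebra_simps)
qed

lemma poly_act_smult: "poly_act A y (smult a q) = a \<cdot>\<^sub>v poly_act A y q"
proof (induction q)
  case 0 then show ?case by (auto simp: poly_act_0)
next
  case (pCons c q)
  then show ?case using A y poly_act_carrier[of q]
    by (simp add: poly_act_pCons mult_mat_vec[OF A]) (rule eq_vecI, auto simp: algebra_simps)
qed

lemma poly_act_linear_factor:
  "poly_act A y ([:- a, 1:] * q) = A *\<^sub>v poly_act A y q + (- a) \<cdot>\<^sub>v poly_act A y q"
proof -
  have e: "[:- a, 1:] * q = pCons 0 q + smult (- a) q" by simp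
  have "0 \<cdot>\<^sub>v y + A *\<^sub>v poly_act A y q = A *\<^sub>v poly_act A y q" using A y by (intro eq_vecI) auto
  then show ?thesis unfolding e poly_act_add poly_act_smult poly_act_pCons by simp
qed

lemma poly_act_eq_sum:
  assumes "degree q \<le> m" "i < N"
  shows "poly_act A y q $ i = (\<Sum>j\<le>m. coeff q j * ((A ^\<^sub>m j) *\<^sub>v y) $ i)"
  using assms
proof (induction q arbitrary: m i)
  case 0 then show ?case by (simp add: poly_act_0)
next
  case (pCons c q)
  show ?case
  proof (cases "q = 0")
    case True
    have "A *\<^sub>v 0\<^sub>v N = 0\<^sub>v N" using A by (intro eq_vecI) auto
    moreover have "(\<Sum>j\<le>m. coeff [:c:] j * ((A ^\<^sub>m j) *\<^sub>v y) $ i) = (\<Sum>j\<in>{0}. coeff [:c:] j * ((A ^\<^sub>m j) *\<^sub>v y) $ i)"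
      by (rule sum.mono_neutral_right) (auto simp: coeff_pCons split: nat.splits)
    ultimately show ?thesis using True A y pCons.prems by (simp add: poly_act_pCons poly_act_0)
  next
    case False
    then obtain m' where m: "m = Suc m'" "degree q \<le> m'" using pCons.prems by (cases m) auto
    have pow: "(A ^\<^sub>m Suc j) *\<^sub>v y = A *\<^sub>v ((A ^\<^sub>m j) *\<^sub>v y)" for j
    proof -
      have "A ^\<^sub>m Suc j = A * A ^\<^sub>m j" using A
      proof (induction j)
        case (Suc j)
        then show ?case by (metis assoc_mult_mat pow_carrier_mat pow_mat.simps(2))
      qed auto
      then show ?thesis using A y by (simp add: assoc_mult_mat_vec[of _ N N _ N])
    qed
    have "(A *\<^sub>v poly_act A y q) $ i = (\<Sum>k<N. A $$ (i,k) * (\<Sum>j\<le>m'. coeff q j * ((A ^\<^sub>m j) *\<^sub>v y) $ k))"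
      using A pCons.prems poly_act_carrier[of q] pCons.IH[OF m(2)]
      by (simp add: scalar_prod_def lessThan_atLeast0)
    also have "\<dots> = (\<Sum>j\<le>m'. coeff q j * (A *\<^sub>v ((A ^\<^sub>m j) *\<^sub>v y)) $ i)"
      unfolding sum_distrib_left using A y pCons.prems
      by (subst sum.swap) (simp add: scalar_prod_def lessThan_atLeast0 sum_distrib_left mult.left_commute row_def)
    finally have 1: "(A *\<^sub>v poly_act A y q) $ i = (\<Sum>j\<le>m'. coeff q j * (A *\<^sub>v ((A ^\<^sub>m j) *\<^sub>v y)) $ i)" .
    have "(\<Sum>j\<le>m. coeff (pCons c q) j * ((A ^\<^sub>m j) *\<^sub>v y) $ i)
      = c * y $ i + (\<Sum>j\<le>m'. coeff q j * (A *\<^sub>v ((A ^\<^sub>m j) *\<^sub>v y)) $ i)"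
      unfolding m(1) sum.atMost_Suc_shift pow using A y pCons.prems by simp
    moreover have "poly_act A y (pCons c q) $ i = c * y $ i + (A *\<^sub>v poly_act A y q) $ i"
      unfolding poly_act_pCons using A y pCons.prems by (simp del: index_mult_mat_vec)
    ultimately show ?thesis using 1 by simp
  qed
qed

text \<open>The \<open>N + 1\<close> vectors \<open>y, A y, \<dots>, A\<^sup>N y\<close> are linearly dependent, and a dependency is a polynomial.\<close>

lemma annihilating_polynomial: "\<exists>q. q \<noteq> 0 \<and> poly_act A y q = 0\<^sub>v N"
proof -
  define K where "K = mat N (Suc N) (\<lambda>(i,j). ((A ^\<^sub>m j) *\<^sub>v y) $ i)"
  have "K \<in> carrier_mat N (Suc N)" by (simp add: K_def)
  from underdetermined_system_solution[OF this] obtain c where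
    c: "c \<in> carrier_vec (Suc N)" "c \<noteq> 0\<^sub>v (Suc N)" "K *\<^sub>v c = 0\<^sub>v N" by auto
  define q where "q = Poly (list_of_vec c)"
  have co: "coeff q j = (if j < Suc N then c $ j else 0)" for j
    using c by (simp add: q_def coeff_Poly nth_default_def list_of_vec_index)
  have "q \<noteq> 0"
  proof
    assume "q = 0"
    then have "c $ j = 0" if "j < Suc N" for j using co[of j] that by simp
    then have "c = 0\<^sub>v (Suc N)" using c by (intro eq_vecI) auto
    then show False using c by simp
  qed
  moreover have "poly_act A y q = 0\<^sub>v N"
  proof (rule eq_vecI)
    fix i assume i: "i < dim_vec (0\<^sub>v N)"
    have "degree q \<le> N" by (rule degree_le) (simp add: co)
    then have "poly_act A y q $ i = (\<Sum>j\<le>N. c $ j * ((A ^\<^sub>m j) *\<^sub>v y) $ i)"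
      using poly_act_eq_sum[of q N i] i co by simp
    also have "\<dots> = (K *\<^sub>v c) $ i" using c(1) i
      by (simp del: sum.atMost_Suc add: K_def scalar_prod_def mult.commute lessThan_Suc_atMost[symmetric] lessThan_atLeast0)
    finally show "poly_act A y q $ i = 0\<^sub>v N $ i" using c by simp
  qed (use poly_act_carrier in auto)
  ultimately show ?thesis by blast
qed

end

text \<open>Split a linear factor \<open>X - a\<close> off a polynomial that annihilates \<open>y\<close>. Either the cofactor still
annihilates \<open>y\<close> and has smaller degree, or it maps \<open>y\<close> to an eigenvector. All these vectors are of the
form \<open>q(A) y\<close> and thus stay in \<open>V\<close>.\<close>

lemma eigenvector_in_invariant_subspace:
  fixes A :: "complex mat"
  assumes A: "A \<in> carrier_mat N N" and V: "V \<subseteq> carrier_vec N"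
    and add: "\<And>v w. v \<in> V \<Longrightarrow> w \<in> V \<Longrightarrow> v + w \<in> V"
    and smult: "\<And>c v. v \<in> V \<Longrightarrow> c \<cdot>\<^sub>v v \<in> V"
    and inv: "\<And>v. v \<in> V \<Longrightarrow> A *\<^sub>v v \<in> V"
    and y: "y \<in> V" "y \<noteq> 0\<^sub>v N"
  shows "\<exists>v a. v \<in> V \<and> v \<noteq> 0\<^sub>v N \<and> A *\<^sub>v v = a \<cdot>\<^sub>v v"
proof -
  have yc: "y \<in> carrier_vec N" using y V by auto
  note act = poly_act_0[OF A yc] poly_act_pCons[OF A yc] poly_act_carrier[OF A yc]
  have actV: "poly_act A y q \<in> V" for q
  proof (induction q)
    case 0
    have "0 \<cdot>\<^sub>v y = 0\<^sub>v N" using yc by auto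
    then show ?case using smult[OF y(1), of 0] by (simp add: act)
  next
    case (pCons c q) then show ?case by (simp add: act add smult inv y)
  qed
  obtain q where q: "q \<noteq> 0" "poly_act A y q = 0\<^sub>v N" using annihilating_polynomial[OF A yc] by blast
  then show ?thesis
  proof (induction "degree q" arbitrary: q)
    case 0
    then obtain c where c: "q = [:c:]" "c \<noteq> 0" using degree_0_id by (metis pCons_0_0)
    have "A *\<^sub>v 0\<^sub>v N = 0\<^sub>v N" using A by (intro eq_vecI) auto
    then have "c \<cdot>\<^sub>v y = 0\<^sub>v N" using 0 yc by (simp add: c act)
    then have "y = 0\<^sub>v N" using c yc by (auto simp: vec_eq_iff)
    then show ?case using y by simp
  next
    case (Suc d)
    then have "\<not> constant (poly q)" by (simp add: constant_degree)
    then obtain a where "poly q a = 0" using fundamental_theorem_of_algebra by blast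
    then obtain q1 where q1: "q = [:- a, 1:] * q1" by (auto simp: poly_eq_0_iff_dvd dvd_def)
    have n: "q1 \<noteq> 0" using q1 Suc.prems by auto
    have deg: "degree q1 = d" using Suc.hyps(2) n unfolding q1 by (subst (asm) degree_mult_eq) auto
    show ?case
    proof (cases "poly_act A y q1 = 0\<^sub>v N")
      case True
      then show ?thesis using Suc.hyps(1)[of q1] deg n by auto
    next
      case False
      have "A *\<^sub>v poly_act A y q1 + (- a) \<cdot>\<^sub>v poly_act A y q1 = 0\<^sub>v N"
        using Suc.prems unfolding q1 poly_act_linear_factor[OF A yc] by simp
      then have "A *\<^sub>v poly_act A y q1 = a \<cdot>\<^sub>v poly_act A y q1"
        using act(3)[of q1] A by (auto simp: vec_eq_iff)
      then show ?thesis using actV False by blast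
    qed
  qed
qed

section \<open>Dimensions of subspaces\<close>

definition linear_subspace :: "nat \<Rightarrow> complex vec set \<Rightarrow> bool" where
  "linear_subspace N V \<longleftrightarrow> V \<subseteq> carrier_vec N \<and> 0\<^sub>v N \<in> V \<and>
     (\<forall>v\<in>V. \<forall>w\<in>V. v + w \<in> V) \<and> (\<forall>c. \<forall>v\<in>V. c \<cdot>\<^sub>v v \<in> V)"

definition injective_map_into :: "nat \<Rightarrow> complex vec set \<Rightarrow> nat \<Rightarrow> complex mat \<Rightarrow> bool" where
  "injective_map_into N V k X \<longleftrightarrow> X \<in> carrier_mat N k \<and>
     (\<forall>c\<in>carrier_vec k. X *\<^sub>v c = 0\<^sub>v N \<longrightarrow> c = 0\<^sub>v k) \<and> (\<forall>c\<in>carrier_vec k. X *\<^sub>v c \<in> V)"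

text \<open>The largest \<open>k\<close> for which \<open>\<complex>\<^sup>k\<close> embeds linearly into \<open>V\<close>. It serves as a measure: it is bounded by \<open>N\<close> and
strictly monotone on subspaces.\<close>

definition subspace_dim :: "nat \<Rightarrow> complex vec set \<Rightarrow> nat" where
  "subspace_dim N V = Max {k. \<exists>X. injective_map_into N V k X}"

lemma injective_map_into_le: "injective_map_into N V k X \<Longrightarrow> k \<le> N"
  using underdetermined_system_solution[of X N k] unfolding injective_map_into_def by (meson not_le)

lemma subspace_dim_attained:
  assumes "0\<^sub>v N \<in> V"
  shows "\<exists>X. injective_map_into N V (subspace_dim N V) X"
proof -
  have "0\<^sub>m N 0 *\<^sub>v c = (0\<^sub>v N :: complex vec)" if "c \<in> carrier_vec 0" for c
    using that by (intro eq_vecI) (auto simp: scalar_prod_def)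
  then have "injective_map_into N V 0 (0\<^sub>m N 0)" using assms by (auto simp: injective_map_into_def)
  then have "{k. \<exists>X. injective_map_into N V k X} \<noteq> {}" by blast
  moreover have "finite {k. \<exists>X. injective_map_into N V k X}"
    by (rule finite_subset[of _ "{..N}"]) (auto dest: injective_map_into_le)
  ultimately have "subspace_dim N V \<in> {k. \<exists>X. injective_map_into N V k X}"
    unfolding subspace_dim_def by (rule Max_in[rotated])
  then show ?thesis by simp
qed

lemma subspace_dim_ge:
  assumes "injective_map_into N V k X" shows "k \<le> subspace_dim N V"
proof -
  have "finite {k. \<exists>X. injective_map_into N V k X}"
    by (rule finite_subset[of _ "{..N}"]) (auto dest: injective_map_into_le)
  then show ?thesis unfolding subspace_dim_def using assms by (intro Max_ge) auto
qed

lemma subspace_dim_le: "0\<^sub>v N \<in> V \<Longrightarrow> subspace_dim N V \<le> N"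
  using subspace_dim_attained injective_map_into_le by blast

text \<open>An embedding into \<open>V\<close> becomes an embedding into \<open>W\<close> of one more dimension by adding a column that lies
in \<open>W\<close> but not in \<open>V\<close>.\<close>

lemma subspace_dim_strict_mono:
  assumes V: "linear_subspace N V" and W: "linear_subspace N W" and sub: "V \<subset> W"
  shows "subspace_dim N V < subspace_dim N W"
proof -
  let ?k = "subspace_dim N V"
  obtain X where "injective_map_into N V ?k X"
    using subspace_dim_attained[of N V] V by (auto simp: linear_subspace_def)
  then have X: "X \<in> carrier_mat N ?k" "\<And>c. c \<in> carrier_vec ?k \<Longrightarrow> X *\<^sub>v c = 0\<^sub>v N \<Longrightarrow> c = 0\<^sub>v ?k"
    "\<And>c. c \<in> carrier_vec ?k \<Longrightarrow> X *\<^sub>v c \<in> V" by (auto simp: injective_map_into_def)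
  obtain y where y: "y \<in> W" "y \<notin> V" using sub by blast
  have yc: "y \<in> carrier_vec N" using y W by (auto simp: linear_subspace_def)
  define Y where "Y = mat N (Suc ?k) (\<lambda>(i,j). if j < ?k then X $$ (i,j) else y $ i)"
  have Y: "Y *\<^sub>v c = X *\<^sub>v vec ?k (($) c) + c $ ?k \<cdot>\<^sub>v y" if c: "c \<in> carrier_vec (Suc ?k)" for c
    using X(1) yc c by (intro eq_vecI) (auto simp: Y_def scalar_prod_def algebra_simps)
  have "injective_map_into N W (Suc ?k) Y"
    unfolding injective_map_into_def
  proof (intro conjI ballI impI)
    show "Y \<in> carrier_mat N (Suc ?k)" by (simp add: Y_def)
  next
    fix c :: "complex vec" assume c: "c \<in> carrier_vec (Suc ?k)" and z: "Y *\<^sub>v c = 0\<^sub>v N"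
    let ?c = "vec ?k (($) c)"
    have XV: "X *\<^sub>v ?c \<in> V" by (rule X(3)) simp
    have XC: "X *\<^sub>v ?c \<in> carrier_vec N" using X(1) by simp
    have e: "X *\<^sub>v ?c + c $ ?k \<cdot>\<^sub>v y = 0\<^sub>v N" using Y[OF c] z by simp
    have l: "c $ ?k = 0"
    proof (rule ccontr)
      assume n: "c $ ?k \<noteq> 0"
      have "y = (- 1 / c $ ?k) \<cdot>\<^sub>v (X *\<^sub>v ?c)"
      proof (rule eq_vecI)
        fix i assume i: "i < dim_vec ((- 1 / c $ ?k) \<cdot>\<^sub>v (X *\<^sub>v ?c))"
        then have iN: "i < N" using X(1) by simp
        have "(X *\<^sub>v ?c + c $ ?k \<cdot>\<^sub>v y) $ i = 0" unfolding e using iN by simp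
        then have "(X *\<^sub>v ?c) $ i + c $ ?k * y $ i = 0"
          using yc iN by (simp del: index_mult_mat_vec)
        then have "c $ ?k * y $ i = - (X *\<^sub>v ?c) $ i" by (metis add.commute eq_neg_iff_add_eq_0)
        then have "y $ i = (- 1 / c $ ?k) * (X *\<^sub>v ?c) $ i" 
        proof -
          assume h: "c $ ?k * y $ i = - (X *\<^sub>v ?c) $ i"
          have "(X *\<^sub>v ?c) $ i = - (c $ ?k * y $ i)" unfolding h by simp
          then show ?thesis using n by simp
        qed
        then show "y $ i = ((- 1 / c $ ?k) \<cdot>\<^sub>v (X *\<^sub>v ?c)) $ i" using i by (simp del: index_mult_mat_vec)
      qed (use yc X(1) in auto)
      moreover have "(- 1 / c $ ?k) \<cdot>\<^sub>v (X *\<^sub>v ?c) \<in> V"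
        using V XV unfolding linear_subspace_def by blast
      ultimately have "y \<in> V" by simp
      then show False using y by simp
    qed
    have "X *\<^sub>v ?c + 0\<^sub>v N = 0\<^sub>v N" using l 
    proof -
      assume "c $ ?k = 0"
      moreover have "0 \<cdot>\<^sub>v y = 0\<^sub>v N" using yc by (intro eq_vecI) auto
      ultimately show ?thesis using e by simp
    qed
    then have "X *\<^sub>v ?c = 0\<^sub>v N" using XC by simp
    then have "?c = 0\<^sub>v ?k" using X(2) by simp
    then have "c $ i = 0" if "i < ?k" for i using that by (auto simp: vec_eq_iff)
    then show "c = 0\<^sub>v (Suc ?k)" using c l by (intro eq_vecI) (auto simp: less_Suc_eq)
  next
    fix c :: "complex vec" assume c: "c \<in> carrier_vec (Suc ?k)"
    have "X *\<^sub>v vec ?k (($) c) \<in> W" using X(3)[of "vec ?k (($) c)"] sub by auto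
    moreover have "c $ ?k \<cdot>\<^sub>v y \<in> W" using W y by (auto simp: linear_subspace_def)
    ultimately show "Y *\<^sub>v c \<in> W" unfolding Y[OF c] using W by (auto simp: linear_subspace_def)
  qed
  from subspace_dim_ge[OF this] show ?thesis by simp
qed

definition kernel :: "nat \<Rightarrow> complex mat \<Rightarrow> complex vec set" where
  "kernel N A = {v \<in> carrier_vec N. A *\<^sub>v v = 0\<^sub>v N}"

lemma mult_zero_vec: "A \<in> carrier_mat n m \<Longrightarrow> A *\<^sub>v 0\<^sub>v m = (0\<^sub>v n :: complex vec)"
  by (intro eq_vecI) auto

lemma linear_subspace_kernel: "A \<in> carrier_mat N N \<Longrightarrow> linear_subspace N (kernel N A)"
  by (auto simp: linear_subspace_def kernel_def mult_zero_vec mult_add_distrib_mat_vec[of _ N N] mult_mat_vec[of _ N N])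

lemma mat_eq_by_action:
  fixes A B :: "complex mat"
  assumes "A \<in> carrier_mat N N" "B \<in> carrier_mat N N" "\<And>v. v \<in> carrier_vec N \<Longrightarrow> A *\<^sub>v v = B *\<^sub>v v"
  shows "A = B"
proof (rule eq_matI)
  fix i j assume ij: "i < dim_row B" "j < dim_col B"
  have "A *\<^sub>v unit_vec N j = B *\<^sub>v unit_vec N j" by (rule assms) simp
  then have "(A *\<^sub>v unit_vec N j) $ i = (B *\<^sub>v unit_vec N j) $ i" by simp
  then show "A $$ (i, j) = B $$ (i, j)" using assms(1,2) ij by simp
qed (use assms in auto)

section \<open>Irreducible matrix algebras\<close>

definition mat_trace :: "complex mat \<Rightarrow> complex" where
  "mat_trace A = (\<Sum>i<dim_row A. A $$ (i,i))"

lemma mat_trace_add: "A \<in> carrier_mat N N \<Longrightarrow> B \<in> carrier_mat N N \<Longrightarrow> mat_trace (A + B) = mat_trace A + mat_trace B"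
  by (simp add: mat_trace_def sum.distrib)

lemma mat_trace_smult: "A \<in> carrier_mat N N \<Longrightarrow> mat_trace (c \<cdot>\<^sub>m A) = c * mat_trace A"
  by (simp add: mat_trace_def sum_distrib_left)

lemma mat_trace_mult_comm:
  assumes "A \<in> carrier_mat N N" "B \<in> carrier_mat N N" shows "mat_trace (A * B) = mat_trace (B * A)"
proof -
  have "mat_trace (A * B) = (\<Sum>i<N. \<Sum>j<N. A $$ (i,j) * B $$ (j,i))"
    using assms by (simp add: mat_trace_def scalar_prod_def lessThan_atLeast0)
  also have "\<dots> = (\<Sum>j<N. \<Sum>i<N. B $$ (j,i) * A $$ (i,j))"
    by (subst sum.swap) (simp add: mult.commute)
  finally show ?thesis using assms by (simp add: mat_trace_def scalar_prod_def lessThan_atLeast0)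
qed

definition irreducible_mats :: "nat \<Rightarrow> complex mat set \<Rightarrow> bool" where
  "irreducible_mats N \<A> \<longleftrightarrow> (\<forall>W. linear_subspace N W \<longrightarrow> (\<forall>A\<in>\<A>. \<forall>w\<in>W. A *\<^sub>v w \<in> W) \<longrightarrow>
     W = {0\<^sub>v N} \<or> W = carrier_vec N)"

lemma irreducible_matsD:
  assumes "irreducible_mats N \<A>" "linear_subspace N W" "\<And>A w. A \<in> \<A> \<Longrightarrow> w \<in> W \<Longrightarrow> A *\<^sub>v w \<in> W"
  shows "W = {0\<^sub>v N} \<or> W = carrier_vec N"
  using assms unfolding irreducible_mats_def by simp

text \<open>By Burnside's theorem such an algebra contains all matrices. The comparison of traces rests on three
consequences: transitivity on nonzero vectors, an element of rank one, and the nondegeneracy of the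
trace form.\<close>

locale irreducible_algebra =
  fixes N :: nat and \<A> :: "complex mat set"
  assumes carrier: "\<A> \<subseteq> carrier_mat N N"
    and one: "1\<^sub>m N \<in> \<A>"
    and add: "A \<in> \<A> \<Longrightarrow> B \<in> \<A> \<Longrightarrow> A + B \<in> \<A>"
    and smult: "A \<in> \<A> \<Longrightarrow> c \<cdot>\<^sub>m A \<in> \<A>"
    and mult: "A \<in> \<A> \<Longrightarrow> B \<in> \<A> \<Longrightarrow> A * B \<in> \<A>"
    and irred: "irreducible_mats N \<A>"
begin

lemma smult_mat_vec: "A \<in> carrier_mat N N \<Longrightarrow> v \<in> carrier_vec N \<Longrightarrow> (c \<cdot>\<^sub>m A) *\<^sub>v v = c \<cdot>\<^sub>v (A *\<^sub>v v)"
  for A :: "complex mat"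
  by (intro eq_vecI) auto

text \<open>The orbit of \<open>x\<close> under \<open>\<A>\<close> is an invariant subspace that contains \<open>x\<close>.\<close>

lemma transitive:
  assumes x: "x \<in> carrier_vec N" "x \<noteq> 0\<^sub>v N" and z: "z \<in> carrier_vec N"
  shows "\<exists>S\<in>\<A>. S *\<^sub>v x = z"
proof -
  let ?W = "(\<lambda>S. S *\<^sub>v x) ` \<A>"
  have c: "S \<in> carrier_mat N N" if "S \<in> \<A>" for S using that carrier by auto
  have "linear_subspace N ?W"
    unfolding linear_subspace_def
  proof (intro conjI ballI allI)
    show "?W \<subseteq> carrier_vec N" using c x by fastforce
    have "0 \<cdot>\<^sub>m 1\<^sub>m N *\<^sub>v x = 0\<^sub>v N" using x by (intro eq_vecI) auto
    then show "0\<^sub>v N \<in> ?W" using smult[OF one, of 0] by (metis imageI)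
  next
    fix v w assume "v \<in> ?W" "w \<in> ?W"
    then obtain S T where S: "S \<in> \<A>" "T \<in> \<A>" "v = S *\<^sub>v x" "w = T *\<^sub>v x" by auto
    then have "v + w = (S + T) *\<^sub>v x" using c x by (simp add: add_mult_distrib_mat_vec[of _ N N])
    then show "v + w \<in> ?W" using add S by blast
  next
    fix a v assume "v \<in> ?W"
    then obtain S where S: "S \<in> \<A>" "v = S *\<^sub>v x" by auto
    then have "a \<cdot>\<^sub>v v = (a \<cdot>\<^sub>m S) *\<^sub>v x" using c x by (simp add: smult_mat_vec)
    then show "a \<cdot>\<^sub>v v \<in> ?W" using smult S by blast
  qed
  moreover have "A *\<^sub>v w \<in> ?W" if "A \<in> \<A>" "w \<in> ?W" for A w
  proof -
    obtain S where S: "S \<in> \<A>" "w = S *\<^sub>v x" using \<open>w \<in> ?W\<close> by auto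
    then have "A *\<^sub>v w = (A * S) *\<^sub>v x" using c x that by (simp add: assoc_mult_mat_vec[of _ N N _ N])
    then show ?thesis using mult that S by blast
  qed
  ultimately have "?W = {0\<^sub>v N} \<or> ?W = carrier_vec N" by (rule irreducible_matsD[OF irred])
  moreover have "x \<in> ?W" using one x by (metis imageI one_mult_mat_vec)
  ultimately have "z \<in> ?W" using x z by blast
  then show ?thesis by blast
qed

text \<open>Take a nonzero \<open>T\<close> with the largest possible kernel. For \<open>S\<close> in \<open>\<A>\<close> let \<open>a\<close> be an eigenvalue of \<open>T S\<close> on the
range of \<open>T\<close>. Then \<open>T S T - a T\<close> has a larger kernel, so it vanishes. As \<open>S\<close> moves a vector \<open>T x\<close> to an
arbitrary vector, every value of \<open>T\<close> is a multiple of \<open>T x\<close>.\<close>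

lemma rank_one_element:
  "\<exists>T\<in>\<A>. \<exists>u\<in>carrier_vec N. \<exists>f\<in>carrier_vec N. u \<noteq> 0\<^sub>v N \<and> f \<noteq> 0\<^sub>v N \<and> T = mat N N (\<lambda>(i,j). u $ i * f $ j)"
  if "N > 0"
proof -
  have c: "S \<in> carrier_mat N N" if "S \<in> \<A>" for S using that carrier by auto
  let ?P = "\<lambda>T. T \<in> \<A> \<and> T \<noteq> 0\<^sub>m N N"
  have "(1\<^sub>m N :: complex mat) $$ (0,0) \<noteq> 0\<^sub>m N N $$ (0,0)" using \<open>N > 0\<close> by simp
  then have "?P (1\<^sub>m N)" using one by metis
  moreover have "\<forall>T. ?P T \<longrightarrow> subspace_dim N (kernel N T) < Suc N"
  proof (intro allI impI)
    fix T assume "?P T"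
    then have "0\<^sub>v N \<in> kernel N T" using c[of T] by (auto simp: kernel_def mult_zero_vec)
    then show "subspace_dim N (kernel N T) < Suc N" using subspace_dim_le by (simp add: less_Suc_eq_le)
  qed
  ultimately obtain T where T: "?P T"
    and max: "\<And>T'. ?P T' \<Longrightarrow> subspace_dim N (kernel N T') \<le> subspace_dim N (kernel N T)"
    using ex_has_greatest_nat[of ?P "1\<^sub>m N" "\<lambda>T. subspace_dim N (kernel N T)"] by blast
  have TC: "T \<in> carrier_mat N N" using T c by auto
  obtain x where x: "x \<in> carrier_vec N" "T *\<^sub>v x \<noteq> 0\<^sub>v N"
  proof -
    have "\<not> (\<forall>v\<in>carrier_vec N. T *\<^sub>v v = 0\<^sub>m N N *\<^sub>v v)" using mat_eq_by_action[OF TC, of "0\<^sub>m N N"] T by auto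
    then obtain v where "v \<in> carrier_vec N" "T *\<^sub>v v \<noteq> 0\<^sub>m N N *\<^sub>v v" by auto
    moreover have "0\<^sub>m N N *\<^sub>v v = 0\<^sub>v N" if "v \<in> carrier_vec N" for v :: "complex vec" using that by (intro eq_vecI) auto
    ultimately show ?thesis using that by auto
  qed
  let ?u = "T *\<^sub>v x"
  have uC: "?u \<in> carrier_vec N" using TC x by simp
  have TST: "\<exists>l. T * S * T = l \<cdot>\<^sub>m T" if S: "S \<in> \<A>" for S
  proof -
    have SC: "S \<in> carrier_mat N N" using S c by auto
    let ?V = "(\<lambda>v. T *\<^sub>v v) ` carrier_vec N"
    have "\<exists>v a. v \<in> ?V \<and> v \<noteq> 0\<^sub>v N \<and> (T * S) *\<^sub>v v = a \<cdot>\<^sub>v v"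
    proof (rule eigenvector_in_invariant_subspace)
      show "T * S \<in> carrier_mat N N" using TC SC by simp
      show "?V \<subseteq> carrier_vec N" using TC by auto
      show "?u \<in> ?V" using x by simp
      show "?u \<noteq> 0\<^sub>v N" by (rule x)
    next
      fix v w assume "v \<in> ?V" "w \<in> ?V"
      then show "v + w \<in> ?V" using TC
        by (auto simp: mult_add_distrib_mat_vec[symmetric, of T N N] intro!: imageI)
    next
      fix a v assume "v \<in> ?V"
      then show "a \<cdot>\<^sub>v v \<in> ?V" using TC by (auto simp: mult_mat_vec[symmetric, of T N N] intro!: imageI)
    next
      fix v assume "v \<in> ?V"
      then show "T * S *\<^sub>v v \<in> ?V" using TC SC by (auto simp: assoc_mult_mat_vec[of T N N S N] intro!: imageI)
    qed
    \<comment> \<open>The eigenvector is taken inside the range of \<open>T\<close>, so that \<open>y\<close> is new in the kernel of \<open>T S T - a T\<close>.\<close>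
    then obtain y a where y: "y \<in> carrier_vec N" "T *\<^sub>v y \<noteq> 0\<^sub>v N" "(T * S) *\<^sub>v (T *\<^sub>v y) = a \<cdot>\<^sub>v (T *\<^sub>v y)" by auto
    define T' where "T' = T * S * T + (- a) \<cdot>\<^sub>m T"
    have T'A: "T' \<in> \<A>" unfolding T'_def using T S by (intro add smult mult) auto
    have act: "T' *\<^sub>v v = (T * S) *\<^sub>v (T *\<^sub>v v) + (- a) \<cdot>\<^sub>v (T *\<^sub>v v)" if "v \<in> carrier_vec N" for v
      unfolding T'_def using TC SC that
      by (simp add: add_mult_distrib_mat_vec[of _ N N] smult_mat_vec assoc_mult_mat_vec[of _ N N _ N])
    have "kernel N T \<subseteq> kernel N T'"
      unfolding kernel_def using TC SC by (auto simp: act mult_zero_vec[of _ N N])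
    moreover have "y \<in> kernel N T'" "y \<notin> kernel N T"
      unfolding kernel_def using y TC by (auto simp: act)
    ultimately have "kernel N T \<subset> kernel N T'" by blast
    then have "subspace_dim N (kernel N T) < subspace_dim N (kernel N T')"
      using TC c[OF T'A] by (intro subspace_dim_strict_mono linear_subspace_kernel) auto
    then have "T' = 0\<^sub>m N N" using max[of T'] T'A by fastforce
    then have "T * S * T = a \<cdot>\<^sub>m T"
      using TC SC unfolding T'_def by (auto simp: mat_eq_iff)
    then show ?thesis by blast
  qed
  have "\<exists>l. T *\<^sub>v z = l \<cdot>\<^sub>v ?u" if z: "z \<in> carrier_vec N" for z
  proof -
    obtain S where S: "S \<in> \<A>" "S *\<^sub>v ?u = z" using transitive[OF uC x(2) z] by auto
    obtain l where l: "T * S * T = l \<cdot>\<^sub>m T" using TST S by auto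
    have "T *\<^sub>v z = (T * S * T) *\<^sub>v x" using S TC c[OF S(1)] x by (simp add: assoc_mult_mat_vec[of _ N N _ N] mult_carrier_mat[of _ N N _ N])
    then show ?thesis using l TC x by (auto simp: smult_mat_vec)
  qed
  then have "\<forall>j<N. \<exists>l. T *\<^sub>v unit_vec N j = l \<cdot>\<^sub>v ?u" by simp
  then obtain l where l: "\<And>j. j < N \<Longrightarrow> T *\<^sub>v unit_vec N j = l j \<cdot>\<^sub>v ?u" by metis
  let ?f = "vec N l"
  have e: "T = mat N N (\<lambda>(i,j). ?u $ i * ?f $ j)"
  proof (rule eq_matI)
    fix i j assume "i < dim_row (mat N N (\<lambda>(i,j). ?u $ i * ?f $ j))" "j < dim_col (mat N N (\<lambda>(i,j). ?u $ i * ?f $ j))"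
    then have ij: "i < N" "j < N" by auto
    have "T $$ (i,j) = (T *\<^sub>v unit_vec N j) $ i" using TC ij by simp
    also have "\<dots> = ?u $ i * l j" unfolding l[OF ij(2)] using uC TC ij by (simp del: index_mult_mat_vec add: mult.commute)
    finally show "T $$ (i,j) = mat N N (\<lambda>(i,j). ?u $ i * ?f $ j) $$ (i,j)" using ij by simp
  qed (use TC in auto)
  have "?f \<noteq> 0\<^sub>v N"
  proof
    assume "?f = 0\<^sub>v N"
    then have "T = 0\<^sub>m N N" by (subst e) (intro eq_matI, auto)
    then show False using T by simp
  qed
  then show ?thesis using T uC x(2) e vec_carrier[of N l] by blast
qed

text \<open>For a rank one element \<open>T = u f\<^sup>T\<close> the trace of \<open>B S\<^sub>1 T S\<^sub>2\<close> is \<open>f \<bullet> (S\<^sub>2 B S\<^sub>1 u)\<close>. The vectors \<open>y\<close> with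
\<open>f \<bullet> (S y) = 0\<close> for all \<open>S\<close> form an invariant subspace other than the whole space, hence zero; and the
vectors \<open>S\<^sub>1 u\<close> exhaust the space.\<close>

lemma trace_form_nondegenerate:
  assumes N: "N > 0" and B: "B \<in> carrier_mat N N" and z: "\<And>X. X \<in> \<A> \<Longrightarrow> mat_trace (B * X) = 0"
  shows "B = 0\<^sub>m N N"
proof -
  have c: "S \<in> carrier_mat N N" if "S \<in> \<A>" for S using that carrier by auto
  obtain T u f where T: "T \<in> \<A>" and u: "u \<in> carrier_vec N" "u \<noteq> 0\<^sub>v N"
    and f: "f \<in> carrier_vec N" "f \<noteq> 0\<^sub>v N" and Te: "T = mat N N (\<lambda>(i,j). u $ i * f $ j)"
    using rank_one_element N by blast
  have tr: "mat_trace (X * T) = f \<bullet> (X *\<^sub>v u)" if X: "X \<in> carrier_mat N N" for X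
  proof -
    have "mat_trace (X * T) = (\<Sum>i<N. \<Sum>j<N. f $ i * (X $$ (i,j) * u $ j))"
      using X unfolding Te by (simp add: mat_trace_def scalar_prod_def lessThan_atLeast0 mult_ac)
    also have "\<dots> = f \<bullet> (X *\<^sub>v u)"
      using X f u by (simp add: scalar_prod_def lessThan_atLeast0 sum_distrib_left)
    finally show ?thesis .
  qed
  define Y where "Y = {y \<in> carrier_vec N. \<forall>S\<in>\<A>. f \<bullet> (S *\<^sub>v y) = 0}"
  have "linear_subspace N Y"
    unfolding linear_subspace_def
  proof (intro conjI ballI allI)
    show "Y \<subseteq> carrier_vec N" by (auto simp: Y_def)
    show "0\<^sub>v N \<in> Y" using f c by (auto simp: Y_def mult_zero_vec[of _ N N])
  next
    fix v w assume "v \<in> Y" "w \<in> Y"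
    then show "v + w \<in> Y" using c f by (auto simp: Y_def mult_add_distrib_mat_vec[of _ N N] scalar_prod_add_distrib[of _ N] mult_mat_vec_carrier[of _ N N])
  next
    fix a v assume "v \<in> Y"
    then show "a \<cdot>\<^sub>v v \<in> Y" using c f by (auto simp: Y_def mult_mat_vec[of _ N N] mult_mat_vec_carrier[of _ N N])
  qed
  moreover have "A *\<^sub>v y \<in> Y" if "A \<in> \<A>" "y \<in> Y" for A y
  proof -
    have "f \<bullet> (S *\<^sub>v (A *\<^sub>v y)) = 0" if S: "S \<in> \<A>" for S
    proof -
      have "f \<bullet> ((S * A) *\<^sub>v y) = 0" using mult[OF S \<open>A \<in> \<A>\<close>] \<open>y \<in> Y\<close> unfolding Y_def by blast
      then show ?thesis using c[OF S] c[OF \<open>A \<in> \<A>\<close>] \<open>y \<in> Y\<close> by (simp add: Y_def assoc_mult_mat_vec[of _ N N _ N])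
    qed
    then show ?thesis using that c[of A] by (auto simp: Y_def mult_mat_vec_carrier[of _ N N])
  qed
  ultimately have "Y = {0\<^sub>v N} \<or> Y = carrier_vec N" by (rule irreducible_matsD[OF irred])
  moreover have "Y \<noteq> carrier_vec N"
  proof
    assume "Y = carrier_vec N"
    then have "f \<bullet> (1\<^sub>m N *\<^sub>v unit_vec N i) = 0" if "i < N" for i using one unit_vec_carrier[of N i] unfolding Y_def by blast
    then have "f $ i = 0" if "i < N" for i using that f by simp
    then have "f = 0\<^sub>v N" using f by (intro eq_vecI) auto
    then show False using f by simp
  qed
  ultimately have Y0: "Y = {0\<^sub>v N}" by simp
  have "B *\<^sub>v v = 0\<^sub>m N N *\<^sub>v v" if v: "v \<in> carrier_vec N" for v
  proof -
    obtain S1 where S1: "S1 \<in> \<A>" "S1 *\<^sub>v u = v" using transitive[OF u v] by auto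
    have "f \<bullet> (S2 *\<^sub>v (B *\<^sub>v v)) = 0" if S2: "S2 \<in> \<A>" for S2
    proof -
      note [simp] = B c[OF S1(1)] c[OF S2] c[OF T]
      have "S2 *\<^sub>v (B *\<^sub>v v) = (S2 * B * S1) *\<^sub>v u"
        using u v S1(2) by (simp add: assoc_mult_mat_vec[of _ N N _ N] mult_carrier_mat[of _ N N _ N])
      then have "f \<bullet> (S2 *\<^sub>v (B *\<^sub>v v)) = mat_trace (S2 * B * S1 * T)"
        by (subst tr) (auto simp: mult_carrier_mat[of _ N N _ N])
      also have "\<dots> = mat_trace (S2 * (B * S1 * T))"
        by (simp add: assoc_mult_mat[of _ N N _ N _ N] mult_carrier_mat[of _ N N _ N])
      also have "\<dots> = mat_trace ((B * S1 * T) * S2)"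
        by (rule mat_trace_mult_comm[of _ N]) (simp_all add: mult_carrier_mat[of _ N N _ N])
      also have "\<dots> = mat_trace (B * (S1 * T * S2))"
        by (simp add: assoc_mult_mat[of _ N N _ N _ N] mult_carrier_mat[of _ N N _ N])
      also have "\<dots> = 0" by (intro z mult S1 S2 T)
      finally show ?thesis .
    qed
    then have "B *\<^sub>v v \<in> Y" using B v by (auto simp: Y_def)
    then have "B *\<^sub>v v = 0\<^sub>v N" using Y0 by simp
    also have "\<dots> = 0\<^sub>m N N *\<^sub>v v" using v by (intro eq_vecI) auto
    finally show ?thesis .
  qed
  then show ?thesis using B by (intro mat_eq_by_action[of _ N]) auto
qed

end

section \<open>Equal traces force conjugacy\<close>

text \<open>For pairs \<open>(\<rho> \<gamma>, \<rho>' \<gamma>)\<close> this span is the graph of the linear extension of \<open>\<rho> \<gamma> \<mapsto> \<rho>' \<gamma>\<close>, before it is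
known that this is a well-defined map.\<close>

inductive_set pair_span :: "nat \<Rightarrow> (complex mat \<times> complex mat) set \<Rightarrow> (complex mat \<times> complex mat) set"
  for N :: nat and P :: "(complex mat \<times> complex mat) set"
where
  zero: "(0\<^sub>m N N, 0\<^sub>m N N) \<in> pair_span N P"
| step: "(X, X') \<in> pair_span N P \<Longrightarrow> (A, A') \<in> P \<Longrightarrow> (X + c \<cdot>\<^sub>m A, X' + c \<cdot>\<^sub>m A') \<in> pair_span N P"

lemma mat_trace_zero: "mat_trace (0\<^sub>m N N) = 0"
  by (simp add: mat_trace_def)

lemma irreducible_mats_mono:
  assumes "irreducible_mats N \<A>" "\<A> \<subseteq> \<B>" shows "irreducible_mats N \<B>"
  unfolding irreducible_mats_def
proof (intro allI impI)
  fix W assume W: "linear_subspace N W" "\<forall>A\<in>\<B>. \<forall>w\<in>W. A *\<^sub>v w \<in> W"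
  show "W = {0\<^sub>v N} \<or> W = carrier_vec N"
    by (rule irreducible_matsD[OF assms(1) W(1)]) (use W(2) assms(2) in auto)
qed

locale matrix_pairs =
  fixes N :: nat and P :: "(complex mat \<times> complex mat) set"
  assumes P_carrier: "(A, A') \<in> P \<Longrightarrow> A \<in> carrier_mat N N \<and> A' \<in> carrier_mat N N"
    and P_one: "(1\<^sub>m N, 1\<^sub>m N) \<in> P"
    and P_mult: "(A, A') \<in> P \<Longrightarrow> (B, B') \<in> P \<Longrightarrow> (A * B, A' * B') \<in> P"
begin

abbreviation "R \<equiv> pair_span N P"

lemma R_carrier: "(X, X') \<in> R \<Longrightarrow> X \<in> carrier_mat N N \<and> X' \<in> carrier_mat N N"
  by (induction rule: pair_span.induct) (auto dest: P_carrier)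

lemma P_subset_R: assumes "(A, A') \<in> P" shows "(A, A') \<in> R"
proof -
  have "(0\<^sub>m N N + 1 \<cdot>\<^sub>m A, 0\<^sub>m N N + 1 \<cdot>\<^sub>m A') \<in> R" by (intro pair_span.intros assms)
  moreover have "0\<^sub>m N N + 1 \<cdot>\<^sub>m B = B" if "B \<in> carrier_mat N N" for B :: "complex mat" 
    using that by (intro eq_matI) auto
  ultimately show ?thesis using P_carrier[OF assms] by simp
qed

lemma R_add: "(Y, Y') \<in> R \<Longrightarrow> (X, X') \<in> R \<Longrightarrow> (X + Y, X' + Y') \<in> R"
proof (induction rule: pair_span.induct)
  case zero then show ?case using R_carrier[of X X'] by simp
next
  case (step Y Y' A A' c)
  then have "(X + Y + c \<cdot>\<^sub>m A, X' + Y' + c \<cdot>\<^sub>m A') \<in> R" by (intro pair_span.step) auto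
  moreover have "X + Y + c \<cdot>\<^sub>m A = X + (Y + c \<cdot>\<^sub>m A)" "X' + Y' + c \<cdot>\<^sub>m A' = X' + (Y' + c \<cdot>\<^sub>m A')"
    using step R_carrier P_carrier by (auto intro!: assoc_add_mat[of _ N N] simp: R_carrier P_carrier)
  ultimately show ?case by simp
qed

lemma R_smult: "(X, X') \<in> R \<Longrightarrow> (d \<cdot>\<^sub>m X, d \<cdot>\<^sub>m X') \<in> R"
proof (induction rule: pair_span.induct)
  case zero
  have "d \<cdot>\<^sub>m 0\<^sub>m N N = (0\<^sub>m N N :: complex mat)" by (intro eq_matI) auto
  then show ?case by (simp add: pair_span.zero)
next
  case (step X X' A A' c)
  have "(d \<cdot>\<^sub>m X + (d * c) \<cdot>\<^sub>m A, d \<cdot>\<^sub>m X' + (d * c) \<cdot>\<^sub>m A') \<in> R"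
    using step by (intro pair_span.step) auto
  moreover have "d \<cdot>\<^sub>m X + (d * c) \<cdot>\<^sub>m A = d \<cdot>\<^sub>m (X + c \<cdot>\<^sub>m A)" "d \<cdot>\<^sub>m X' + (d * c) \<cdot>\<^sub>m A' = d \<cdot>\<^sub>m (X' + c \<cdot>\<^sub>m A')"
    using R_carrier[OF step(1)] P_carrier[OF step(2)] by (auto intro!: eq_matI simp: algebra_simps)
  ultimately show ?case by simp
qed

lemma R_mult_P: "(X, X') \<in> R \<Longrightarrow> (B, B') \<in> P \<Longrightarrow> (X * B, X' * B') \<in> R"
proof (induction rule: pair_span.induct)
  case zero then show ?case using P_carrier[of B B'] by (auto simp: pair_span.zero left_mult_zero_mat[of _ N N])
next
  case (step X X' A A' c)
  have e: "(X + c \<cdot>\<^sub>m A) * B = X * B + c \<cdot>\<^sub>m (A * B)" 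
    if "X \<in> carrier_mat N N" "A \<in> carrier_mat N N" "B \<in> carrier_mat N N" for X A B :: "complex mat"
    using that by (simp add: add_mult_distrib_mat[of _ N N] mult_smult_assoc_mat[of _ N N])
  have "(X * B + c \<cdot>\<^sub>m (A * B), X' * B' + c \<cdot>\<^sub>m (A' * B')) \<in> R"
    using step by (intro pair_span.step P_mult) auto
  then show ?case using R_carrier[OF step(1)] P_carrier[OF step(2)] P_carrier[OF step(4)] by (simp add: e)
qed

lemma R_mult: "(Y, Y') \<in> R \<Longrightarrow> (X, X') \<in> R \<Longrightarrow> (X * Y, X' * Y') \<in> R"
proof (induction rule: pair_span.induct)
  case zero then show ?case using R_carrier[of X X'] by (auto simp: pair_span.zero right_mult_zero_mat[of _ N N])
next
  case (step Y Y' A A' c)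
  have e: "X * (Y + c \<cdot>\<^sub>m A) = X * Y + c \<cdot>\<^sub>m (X * A)" 
    if "X \<in> carrier_mat N N" "A \<in> carrier_mat N N" "Y \<in> carrier_mat N N" for X A Y :: "complex mat"
    using that by (simp add: mult_add_distrib_mat[of _ N N] mult_smult_distrib[of _ N N])
  have "(X * Y + c \<cdot>\<^sub>m (X * A), X' * Y' + c \<cdot>\<^sub>m (X' * A')) \<in> R"
    by (rule R_add[OF R_smult[OF R_mult_P[OF step.prems step(2)]] step.IH[OF step.prems]])
  then show ?case using R_carrier[OF step(1)] P_carrier[OF step(2)] R_carrier[OF step(4)] by (simp add: e)
qed

lemma R_trace:
  assumes "\<And>A A'. (A, A') \<in> P \<Longrightarrow> mat_trace A = mat_trace A'"
  shows "(X, X') \<in> R \<Longrightarrow> mat_trace X = mat_trace X'"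
proof (induction rule: pair_span.induct)
  case (step X X' A A' c)
  then show ?case using R_carrier[OF step(1)] P_carrier[OF step(2)] assms[OF step(2)]
    by (simp add: mat_trace_add[of _ N] mat_trace_smult[of _ N])
qed simp

lemma fst_irreducible_algebra:
  assumes "irreducible_mats N (fst ` P)"
  shows "irreducible_algebra N (fst ` R)"
proof
  show "fst ` R \<subseteq> carrier_mat N N" using R_carrier by auto
  show "1\<^sub>m N \<in> fst ` R" using imageI[OF P_subset_R[OF P_one], of fst] by simp
  show "A + B \<in> fst ` R" if "A \<in> fst ` R" "B \<in> fst ` R" for A B
    using that by (auto intro!: image_eqI[OF _ R_add])
  show "c \<cdot>\<^sub>m A \<in> fst ` R" if "A \<in> fst ` R" for A c
    using that by (auto intro!: image_eqI[OF _ R_smult])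
  show "A * B \<in> fst ` R" if "A \<in> fst ` R" "B \<in> fst ` R" for A B
    using that by (auto intro!: image_eqI[OF _ R_mult])
  show "irreducible_mats N (fst ` R)"
    by (rule irreducible_mats_mono[OF assms]) (auto intro!: image_eqI[OF _ P_subset_R])
qed

text \<open>Equal traces and the two nondegenerate trace forms show that in a pair of the span either both
components vanish or none of them. Fix a pair \<open>(T, T')\<close> whose first component \<open>T = u f\<^sup>T\<close> has rank one, and
a nonzero vector \<open>u'\<close> in the range of \<open>T'\<close>. The rule \<open>X u \<mapsto> X' u'\<close>, for pairs \<open>(X, X')\<close> of the span, is then
well defined: from \<open>X u = 0\<close> follows \<open>X T = 0\<close>, then \<open>X' T' = 0\<close> and \<open>X' u' = 0\<close>. Its matrix \<open>Q\<close> intertwines,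
and its kernel is an invariant subspace.\<close>

theorem conjugate_if_traces_agree:
  assumes N: "N > 0" and irr: "irreducible_mats N (fst ` P)"
    and tr: "\<And>A A'. (A, A') \<in> P \<Longrightarrow> mat_trace A = mat_trace A'"
    and nondeg: "\<And>B. B \<in> carrier_mat N N \<Longrightarrow> (\<And>X. X \<in> snd ` R \<Longrightarrow> mat_trace (B * X) = 0) \<Longrightarrow> B = 0\<^sub>m N N"
  shows "\<exists>Q\<in>carrier_mat N N. det Q \<noteq> 0 \<and> (\<forall>(A, A')\<in>P. A' * Q = Q * A)"
proof -
  interpret irreducible_algebra N "fst ` R" using fst_irreducible_algebra[OF irr] .
  have snd0: "X' = 0\<^sub>m N N" if X: "(X, X') \<in> R" "X = 0\<^sub>m N N" for X X'
  proof (rule nondeg)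
    show "X' \<in> carrier_mat N N" using R_carrier X by auto
    fix Y' assume "Y' \<in> snd ` R"
    then obtain Y where Y: "(Y, Y') \<in> R" by auto
    have "mat_trace (X' * Y') = mat_trace (X * Y)" using R_trace[OF tr R_mult[OF Y X(1)]] by simp
    then show "mat_trace (X' * Y') = 0" using X R_carrier[OF Y] by (auto simp: mat_trace_zero left_mult_zero_mat[of _ N N])
  qed
  have fst0: "X = 0\<^sub>m N N" if X: "(X, X') \<in> R" "X' = 0\<^sub>m N N" for X X'
  proof (rule trace_form_nondegenerate[OF N])
    show "X \<in> carrier_mat N N" using R_carrier X by auto
    fix Y assume "Y \<in> fst ` R"
    then obtain Y' where Y: "(Y, Y') \<in> R" by auto
    have "mat_trace (X * Y) = mat_trace (X' * Y')" using R_trace[OF tr R_mult[OF Y X(1)]] by simp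
    then show "mat_trace (X * Y) = 0" using X R_carrier[OF Y] by (auto simp: mat_trace_zero left_mult_zero_mat[of _ N N])
  qed
  obtain T u f where T: "T \<in> fst ` R" and u: "u \<in> carrier_vec N" "u \<noteq> 0\<^sub>v N"
    and f: "f \<in> carrier_vec N" "f \<noteq> 0\<^sub>v N" and Te: "T = mat N N (\<lambda>(i,j). u $ i * f $ j)"
    using rank_one_element N by blast
  obtain T' where T': "(T, T') \<in> R" using T by auto
  have TC: "T \<in> carrier_mat N N" "T' \<in> carrier_mat N N" using R_carrier[OF T'] by auto
  have Tv: "T *\<^sub>v v = (f \<bullet> v) \<cdot>\<^sub>v u" if "v \<in> carrier_vec N" for v
    using that u f by (intro eq_vecI) (auto simp: Te scalar_prod_def sum_distrib_left mult_ac)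
  have "T \<noteq> 0\<^sub>m N N"
  proof
    assume z: "T = 0\<^sub>m N N"
    obtain i where i: "i < N" "u $ i \<noteq> 0" using u by (auto simp: vec_eq_iff)
    obtain j where j: "j < N" "f $ j \<noteq> 0" using f by (auto simp: vec_eq_iff)
    have "T $$ (i,j) = u $ i * f $ j" using i j by (simp add: Te)
    then show False using z i j by simp
  qed
  then have "T' \<noteq> 0\<^sub>m N N" using fst0[OF T'] by auto
  then obtain x' where x': "x' \<in> carrier_vec N" "T' *\<^sub>v x' \<noteq> 0\<^sub>m N N *\<^sub>v x'"
    using mat_eq_by_action[OF TC(2), of "0\<^sub>m N N"] by auto
  let ?u' = "T' *\<^sub>v x'"
  have u': "?u' \<in> carrier_vec N" "?u' \<noteq> 0\<^sub>v N"
  proof -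
    have "0\<^sub>m N N *\<^sub>v x' = 0\<^sub>v N" using x' by (intro eq_vecI) auto
    then show "?u' \<noteq> 0\<^sub>v N" using x' by simp
  qed (use TC x' in simp)
  have wd: "X' *\<^sub>v ?u' = 0\<^sub>v N" if X: "(X, X') \<in> R" "X *\<^sub>v u = 0\<^sub>v N" for X X'
  proof -
    have XC: "X \<in> carrier_mat N N" "X' \<in> carrier_mat N N" using R_carrier[OF X(1)] by auto
    have "X * T = 0\<^sub>m N N"
    proof (rule mat_eq_by_action)
      fix v :: "complex vec" assume v: "v \<in> carrier_vec N"
      have "X * T *\<^sub>v v = (f \<bullet> v) \<cdot>\<^sub>v 0\<^sub>v N"
        using XC TC v X u by (simp add: assoc_mult_mat_vec[of _ N N _ N] Tv mult_mat_vec[of _ N N])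
      also have "\<dots> = 0\<^sub>m N N *\<^sub>v v" using v by (intro eq_vecI) auto
      finally show "X * T *\<^sub>v v = 0\<^sub>m N N *\<^sub>v v" .
    qed (use XC TC in auto)
    then have "X' * T' = 0\<^sub>m N N" using snd0[OF R_mult[OF T' X(1)]] by simp
    moreover have "X' *\<^sub>v ?u' = (X' * T') *\<^sub>v x'" using XC TC x' by (simp add: assoc_mult_mat_vec[of _ N N _ N])
    ultimately show ?thesis using x' by (auto intro: eq_vecI)
  qed
  have "\<exists>S S'. (S, S') \<in> R \<and> S *\<^sub>v u = unit_vec N k" for k
    using transitive[OF u, of "unit_vec N k"] by force
  then obtain S S' where S: "\<And>k. (S k, S' k) \<in> R" "\<And>k. S k *\<^sub>v u = unit_vec N k" by metis
  have SC: "S k \<in> carrier_mat N N" "S' k \<in> carrier_mat N N" for k using R_carrier[OF S(1)] by auto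
  define Q where "Q = mat N N (\<lambda>(i,k). (S' k *\<^sub>v ?u') $ i)"
  have QC: "Q \<in> carrier_mat N N" by (simp add: Q_def)
  have key: "X' *\<^sub>v ?u' = Q *\<^sub>v (X *\<^sub>v u)" if X: "(X, X') \<in> R" for X X'
  proof -
    let ?w = "X *\<^sub>v u"
    have XC: "X \<in> carrier_mat N N" "X' \<in> carrier_mat N N" using R_carrier[OF X(1)] by auto
    \<comment> \<open>The pair \<open>(Y, Y')\<close> combines the pairs \<open>(S k, S' k)\<close>, with the first \<open>m\<close> coordinates of \<open>X u\<close> as coefficients.\<close>
    have part: "\<exists>Y Y'. (Y, Y') \<in> R \<and> (\<forall>i<N. (Y *\<^sub>v u) $ i = (if i < m then ?w $ i else 0))
      \<and> (\<forall>i<N. (Y' *\<^sub>v ?u') $ i = (\<Sum>k<m. Q $$ (i,k) * ?w $ k))" if "m \<le> N" for m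
      using that
    proof (induction m)
      case 0
      show ?case
        by (rule exI[of _ "0\<^sub>m N N"], rule exI[of _ "0\<^sub>m N N"]) (use u u' in \<open>auto simp: pair_span.zero\<close>)
    next
      case (Suc m)
      then obtain Y Y' where Y: "(Y, Y') \<in> R" "\<forall>i<N. (Y *\<^sub>v u) $ i = (if i < m then ?w $ i else 0)"
        "\<forall>i<N. (Y' *\<^sub>v ?u') $ i = (\<Sum>k<m. Q $$ (i,k) * ?w $ k)" by auto
      have YC: "Y \<in> carrier_mat N N" "Y' \<in> carrier_mat N N" using R_carrier[OF Y(1)] by auto
      have f1: "(Y + ?w $ m \<cdot>\<^sub>m S m, Y' + ?w $ m \<cdot>\<^sub>m S' m) \<in> R" by (intro R_add R_smult S Y)
      have f2: "(Y + ?w $ m \<cdot>\<^sub>m S m) *\<^sub>v u = Y *\<^sub>v u + ?w $ m \<cdot>\<^sub>v unit_vec N m"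
        using YC SC u S(2) by (simp add: add_mult_distrib_mat_vec[of _ N N] smult_mat_vec)
      have f3: "(Y' + ?w $ m \<cdot>\<^sub>m S' m) *\<^sub>v ?u' = Y' *\<^sub>v ?u' + ?w $ m \<cdot>\<^sub>v (S' m *\<^sub>v ?u')"
        using YC SC u' by (simp add: add_mult_distrib_mat_vec[of _ N N] smult_mat_vec)
      have f4: "(Y *\<^sub>v u + ?w $ m \<cdot>\<^sub>v unit_vec N m) $ i = (if i < Suc m then ?w $ i else 0)" if "i < N" for i
      proof -
        have "(Y *\<^sub>v u + ?w $ m \<cdot>\<^sub>v unit_vec N m) $ i = (Y *\<^sub>v u) $ i + ?w $ m * unit_vec N m $ i"
          using that by (simp del: index_mult_mat_vec)
        then show ?thesis using Y(2) that Suc.prems by (auto simp del: index_mult_mat_vec simp: less_Suc_eq)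
      qed
      have f5: "(Y' *\<^sub>v ?u' + ?w $ m \<cdot>\<^sub>v (S' m *\<^sub>v ?u')) $ i = (\<Sum>k<Suc m. Q $$ (i,k) * ?w $ k)" if "i < N" for i
      proof -
        have "(Y' *\<^sub>v ?u' + ?w $ m \<cdot>\<^sub>v (S' m *\<^sub>v ?u')) $ i = (Y' *\<^sub>v ?u') $ i + ?w $ m * (S' m *\<^sub>v ?u') $ i"
          using that SC[of m] by (simp del: index_mult_mat_vec)
        also have "(S' m *\<^sub>v ?u') $ i = Q $$ (i, m)" using that Suc.prems by (simp add: Q_def)
        finally show ?thesis using Y(3) that by (simp del: index_mult_mat_vec add: mult.commute)
      qed
      show ?case
        by (rule exI[of _ "Y + ?w $ m \<cdot>\<^sub>m S m"], rule exI[of _ "Y' + ?w $ m \<cdot>\<^sub>m S' m"])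
          (simp only: f1 f2 f3 simp_thms, use f4 f5 in blast)
    qed
    from part[OF order_refl] obtain Y Y' where Y: "(Y, Y') \<in> R" "\<forall>i<N. (Y *\<^sub>v u) $ i = ?w $ i"
        "\<forall>i<N. (Y' *\<^sub>v ?u') $ i = (\<Sum>k<N. Q $$ (i,k) * ?w $ k)" by auto
    have YC: "Y \<in> carrier_mat N N" "Y' \<in> carrier_mat N N" using R_carrier[OF Y(1)] by auto
    have Yu: "Y *\<^sub>v u = ?w" using Y(2) YC XC by (intro eq_vecI) auto
    have "(X + (-1) \<cdot>\<^sub>m Y, X' + (-1) \<cdot>\<^sub>m Y') \<in> R" by (intro R_add R_smult X Y)
    moreover have "(X + (-1) \<cdot>\<^sub>m Y) *\<^sub>v u = ?w + (-1) \<cdot>\<^sub>v ?w"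
      using YC XC u Yu by (simp add: add_mult_distrib_mat_vec[of _ N N] smult_mat_vec)
    moreover have "?w + (-1) \<cdot>\<^sub>v ?w = 0\<^sub>v N" using XC by (intro eq_vecI) auto
    ultimately have "(X' + (-1) \<cdot>\<^sub>m Y') *\<^sub>v ?u' = 0\<^sub>v N" by (intro wd) auto
    then have "X' *\<^sub>v ?u' + (-1) \<cdot>\<^sub>v (Y' *\<^sub>v ?u') = 0\<^sub>v N"
      using YC XC u' by (simp add: add_mult_distrib_mat_vec[of _ N N] smult_mat_vec)
    then have "(X' *\<^sub>v ?u' + (-1) \<cdot>\<^sub>v (Y' *\<^sub>v ?u')) $ i = 0" if "i < N" for i using that by simp
    then have "(X' *\<^sub>v ?u') $ i = (Y' *\<^sub>v ?u') $ i" if "i < N" for i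
      using that YC XC by (simp del: index_mult_mat_vec)
    then have "(X' *\<^sub>v ?u') $ i = (Q *\<^sub>v ?w) $ i" if "i < N" for i
      using that Y(3) QC XC by (simp add: scalar_prod_def lessThan_atLeast0)
    then show ?thesis using XC QC by (intro eq_vecI) (auto simp del: index_mult_mat_vec)
  qed
  have comm: "A' * Q = Q * A" if A: "(A, A') \<in> P" for A A'
  proof (rule mat_eq_by_action)
    have AC: "A \<in> carrier_mat N N" "A' \<in> carrier_mat N N" using P_carrier[OF A] by auto
    then show "A' * Q \<in> carrier_mat N N" "Q * A \<in> carrier_mat N N" using QC by auto
    fix v :: "complex vec" assume v: "v \<in> carrier_vec N"
    obtain X where "X \<in> fst ` R" "X *\<^sub>v u = v" using transitive[OF u v] by auto
    then obtain X' where X: "(X, X') \<in> R" "X *\<^sub>v u = v" by auto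
    have XC: "X \<in> carrier_mat N N" "X' \<in> carrier_mat N N" using R_carrier[OF X(1)] by auto
    have "A' * Q *\<^sub>v v = A' *\<^sub>v (Q *\<^sub>v (X *\<^sub>v u))" using AC QC v X by (simp add: assoc_mult_mat_vec[of _ N N _ N])
    also have "\<dots> = A' *\<^sub>v (X' *\<^sub>v ?u')" by (simp only: key[OF X(1)])
    also have "\<dots> = (A' * X') *\<^sub>v ?u'" using AC XC u' by (simp add: assoc_mult_mat_vec[of _ N N _ N])
    also have "\<dots> = Q *\<^sub>v ((A * X) *\<^sub>v u)" by (rule key[OF R_mult[OF X(1) P_subset_R[OF A]]])
    also have "\<dots> = Q * A *\<^sub>v v" using AC XC u QC v X(2) by (simp add: assoc_mult_mat_vec[of _ N N _ N])
    finally show "A' * Q *\<^sub>v v = Q * A *\<^sub>v v" .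
  qed
  have "kernel N Q = {0\<^sub>v N} \<or> kernel N Q = carrier_vec N"
  proof -
    have "A *\<^sub>v w \<in> kernel N Q" if A: "A \<in> fst ` P" and w: "w \<in> kernel N Q" for A w
    proof -
      obtain A' where A': "(A, A') \<in> P" using A by auto
      have AC: "A \<in> carrier_mat N N" "A' \<in> carrier_mat N N" using P_carrier[OF A'] by auto
      have wC: "w \<in> carrier_vec N" "Q *\<^sub>v w = 0\<^sub>v N" using w by (auto simp: kernel_def)
      have "Q *\<^sub>v (A *\<^sub>v w) = (Q * A) *\<^sub>v w" using AC QC wC by (simp add: assoc_mult_mat_vec[of _ N N _ N])
      also have "\<dots> = (A' * Q) *\<^sub>v w" by (simp only: comm[OF A'])
      also have "\<dots> = 0\<^sub>v N" using AC QC wC by (simp add: assoc_mult_mat_vec[of _ N N _ N] mult_zero_vec)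
      finally show ?thesis using AC wC by (auto simp: kernel_def)
    qed
    then show ?thesis by (rule irreducible_matsD[OF irr linear_subspace_kernel[OF QC]])
  qed
  moreover have "kernel N Q \<noteq> carrier_vec N"
  proof
    assume "kernel N Q = carrier_vec N"
    then have "Q *\<^sub>v u = 0\<^sub>v N" using u by (auto simp: kernel_def)
    moreover have "Q *\<^sub>v (1\<^sub>m N *\<^sub>v u) = 1\<^sub>m N *\<^sub>v ?u'" using key[OF P_subset_R[OF P_one]] by simp
    ultimately show False using u u' by simp
  qed
  ultimately have "kernel N Q = {0\<^sub>v N}" by blast
  then have "det Q \<noteq> 0" using det_0_iff_vec_prod_zero[OF QC] by (auto simp: kernel_def)
  then show ?thesis using QC comm by blast
qed

end

text \<open>Schur's lemma: an eigenspace of \<open>B\<close> is invariant under \<open>\<A>\<close>.\<close>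

lemma commutant_scalar:
  assumes N: "N > 0" and irr: "irreducible_mats N \<A>" and C: "\<A> \<subseteq> carrier_mat N N"
    and B: "B \<in> carrier_mat N N" and comm: "\<And>A. A \<in> \<A> \<Longrightarrow> A * B = B * A"
  shows "\<exists>c. B = c \<cdot>\<^sub>m 1\<^sub>m N"
proof -
  have "unit_vec N 0 $ 0 \<noteq> (0\<^sub>v N :: complex vec) $ 0" using N by simp
  then have n: "unit_vec N 0 \<noteq> (0\<^sub>v N :: complex vec)" by metis
  obtain v c where v: "v \<in> carrier_vec N" "v \<noteq> 0\<^sub>v N" "B *\<^sub>v v = c \<cdot>\<^sub>v v"
    using eigenvector_in_invariant_subspace[OF B, of "carrier_vec N" "unit_vec N 0"] B n by auto
  define D where "D = B + (- c) \<cdot>\<^sub>m 1\<^sub>m N"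
  have DC: "D \<in> carrier_mat N N" using B by (simp add: D_def)
  have Dw: "D *\<^sub>v w = B *\<^sub>v w + (- c) \<cdot>\<^sub>v w" if "w \<in> carrier_vec N" for w
  proof -
    have "((- c) \<cdot>\<^sub>m 1\<^sub>m N) *\<^sub>v w = (- c) \<cdot>\<^sub>v w" using that by (intro eq_vecI) auto
    then show ?thesis unfolding D_def using B that by (simp add: add_mult_distrib_mat_vec[of _ N N])
  qed
  have "kernel N D = {0\<^sub>v N} \<or> kernel N D = carrier_vec N"
  proof -
    have "A *\<^sub>v w \<in> kernel N D" if A: "A \<in> \<A>" and w: "w \<in> kernel N D" for A w
    proof -
      have AC: "A \<in> carrier_mat N N" using A C by auto
      have wC: "w \<in> carrier_vec N" "B *\<^sub>v w + (- c) \<cdot>\<^sub>v w = 0\<^sub>v N" using w Dw by (auto simp: kernel_def)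
      have "D *\<^sub>v (A *\<^sub>v w) = (B * A) *\<^sub>v w + (- c) \<cdot>\<^sub>v (A *\<^sub>v w)" using AC B wC by (simp add: Dw assoc_mult_mat_vec[of _ N N _ N])
      also have "\<dots> = (A * B) *\<^sub>v w + (- c) \<cdot>\<^sub>v (A *\<^sub>v w)" by (simp only: comm[OF A])
      also have "\<dots> = A *\<^sub>v (B *\<^sub>v w + (- c) \<cdot>\<^sub>v w)" using AC B wC(1)
        by (simp add: assoc_mult_mat_vec[of _ N N _ N] mult_add_distrib_mat_vec[of _ N N] mult_mat_vec[of _ N N])
      also have "\<dots> = 0\<^sub>v N" using AC by (simp add: wC mult_zero_vec)
      finally show ?thesis using AC wC by (auto simp: kernel_def)
    qed
    then show ?thesis by (rule irreducible_matsD[OF irr linear_subspace_kernel[OF DC]])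
  qed
  moreover have "v \<in> kernel N D" using v by (auto simp: kernel_def Dw)
  ultimately have K: "kernel N D = carrier_vec N" using v by auto
  have "D = 0\<^sub>m N N"
  proof (rule mat_eq_by_action)
    fix w :: "complex vec" assume w: "w \<in> carrier_vec N"
    then have "D *\<^sub>v w = 0\<^sub>v N" using K by (auto simp: kernel_def)
    also have "\<dots> = 0\<^sub>m N N *\<^sub>v w" using w by (intro eq_vecI) auto
    finally show "D *\<^sub>v w = 0\<^sub>m N N *\<^sub>v w" .
  qed (use DC in auto)
  then have "B = c \<cdot>\<^sub>m 1\<^sub>m N" using B unfolding D_def by (auto simp: mat_eq_iff)
  then show ?thesis by blast
qed

section \<open>Square complex matrices\<close>

abbreviation adj :: "complex mat \<Rightarrow> complex mat" where
  "adj A \<equiv> (conj_mat A)\<^sup>T"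

abbreviation unitary_for :: "complex mat \<Rightarrow> complex mat \<Rightarrow> bool" where
  "unitary_for S A \<equiv> adj A * S * A = S"

abbreviation isometry :: "complex mat \<Rightarrow> complex mat \<Rightarrow> bool" where
  "isometry F A \<equiv> A\<^sup>T * F * A = F"

lemma dim_mat_diag [simp]: "dim_row (mat_diag n f) = n" "dim_col (mat_diag n f) = n"
  by (simp_all add: mat_diag_def)

text \<open>With the size fixed, membership in \<open>M\<close> decides all side conditions of the matrix laws, and
\<open>mat_simps\<close> is a set of rewrite rules that pushes conjugation and transposition inwards
and associates products to the right.\<close>

locale square_mats =
  fixes N :: nat
begin

abbreviation M :: "complex mat set" where "M \<equiv> carrier_mat N N"

lemma mult_M: "A \<in> M \<Longrightarrow> B \<in> M \<Longrightarrow> A * B \<in> M" by simp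
lemma assoc_M: "A \<in> M \<Longrightarrow> B \<in> M \<Longrightarrow> C \<in> M \<Longrightarrow> A * B * C = A * (B * C)" by simp
lemma one_M: "1\<^sub>m N \<in> M" by simp
lemma transpose_M: "A \<in> M \<Longrightarrow> A\<^sup>T \<in> M" by simp
lemma conj_M: "A \<in> M \<Longrightarrow> conj_mat A \<in> M" by simp
lemma smult_M: "A \<in> M \<Longrightarrow> c \<cdot>\<^sub>m A \<in> M" by simp
lemma add_M: "A \<in> M \<Longrightarrow> B \<in> M \<Longrightarrow> A + B \<in> M" by simp
lemma one_left: "A \<in> M \<Longrightarrow> 1\<^sub>m N * A = A" by simp
lemma one_right: "A \<in> M \<Longrightarrow> A * 1\<^sub>m N = A" by simp
lemma smult_left: "A \<in> M \<Longrightarrow> B \<in> M \<Longrightarrow> (c \<cdot>\<^sub>m A) * B = c \<cdot>\<^sub>m (A * B)"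
  by (rule mult_smult_assoc_mat)
lemma smult_right: "A \<in> M \<Longrightarrow> B \<in> M \<Longrightarrow> A * (c \<cdot>\<^sub>m B) = c \<cdot>\<^sub>m (A * B)"
  by (rule mult_smult_distrib)
lemma smult_smult: "a \<cdot>\<^sub>m (b \<cdot>\<^sub>m A) = (a * b) \<cdot>\<^sub>m (A :: complex mat)"
  by (intro eq_matI) auto
lemma smult_one: "1 \<cdot>\<^sub>m (A :: complex mat) = A"
  by (intro eq_matI) auto
lemma conj_mult_M: "A \<in> M \<Longrightarrow> B \<in> M \<Longrightarrow> conj_mat (A * B) = conj_mat A * conj_mat B"
  by (rule conj_mult)
lemma transpose_mult_M: "A \<in> M \<Longrightarrow> B \<in> M \<Longrightarrow> (A * B)\<^sup>T = B\<^sup>T * A\<^sup>T" for A B :: "complex mat"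
  by (rule transpose_mult)
lemma conj_smult: "conj_mat (c \<cdot>\<^sub>m A) = cnj c \<cdot>\<^sub>m conj_mat A" by (intro eq_matI) auto
lemma transpose_smult: "(c \<cdot>\<^sub>m A)\<^sup>T = c \<cdot>\<^sub>m (A :: complex mat)\<^sup>T" by (intro eq_matI) auto
lemma conj_add: "A \<in> M \<Longrightarrow> B \<in> M \<Longrightarrow> conj_mat (A + B) = conj_mat A + conj_mat B" by (intro eq_matI) auto
lemma transpose_add_M: "A \<in> M \<Longrightarrow> B \<in> M \<Longrightarrow> (A + B)\<^sup>T = A\<^sup>T + (B :: complex mat)\<^sup>T" by (intro eq_matI) auto
lemma conj_conj: "conj_mat (conj_mat A) = A" by (intro eq_matI) auto
lemma add_mult: "A \<in> M \<Longrightarrow> B \<in> M \<Longrightarrow> C \<in> M \<Longrightarrow> (A + B) * C = A * C + B * C"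
  by (rule add_mult_distrib_mat)
lemma mult_add: "A \<in> M \<Longrightarrow> B \<in> M \<Longrightarrow> C \<in> M \<Longrightarrow> A * (B + C) = A * B + A * C"
  by (rule mult_add_distrib_mat)
lemma smult_add: "A \<in> M \<Longrightarrow> B \<in> M \<Longrightarrow> c \<cdot>\<^sub>m (A + B) = c \<cdot>\<^sub>m A + c \<cdot>\<^sub>m B"
  by (intro eq_matI) (auto simp: algebra_simps)

lemmas mat_simps = mult_M assoc_M one_M transpose_M conj_M smult_M add_M one_left one_right smult_left
  smult_right smult_smult smult_one conj_mult_M transpose_mult_M conj_smult transpose_smult conj_conj
  conj_one transpose_one conj_transpose transpose_transpose conj_add transpose_add_M

text \<open>In a product that is associated to the right, the factors \<open>A\<close> and \<open>B\<close> are adjacent only in the form \<open>A * (B * X)\<close>.\<close>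

lemma cancel: "A * B = 1\<^sub>m N \<Longrightarrow> A \<in> M \<Longrightarrow> B \<in> M \<Longrightarrow> X \<in> M \<Longrightarrow> A * (B * X) = X"
  by (simp add: assoc_M[symmetric] del: assoc_mult_mat)

lemma rewrite_prefix: "A * B = C \<Longrightarrow> A \<in> M \<Longrightarrow> B \<in> M \<Longrightarrow> X \<in> M \<Longrightarrow> A * (B * X) = C * X"
  by (simp add: assoc_M[symmetric] del: assoc_mult_mat)

lemma mult_entry: "A \<in> M \<Longrightarrow> B \<in> M \<Longrightarrow> i < N \<Longrightarrow> j < N \<Longrightarrow> (A * B) $$ (i,j) = (\<Sum>k<N. A $$ (i,k) * B $$ (k,j))"
  by (simp add: scalar_prod_def lessThan_atLeast0)

lemma adj_entry: "A \<in> M \<Longrightarrow> i < N \<Longrightarrow> j < N \<Longrightarrow> adj A $$ (i,j) = cnj (A $$ (j,i))"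
  by simp

lemma det_M_mult: "A \<in> M \<Longrightarrow> B \<in> M \<Longrightarrow> det (A * B) = det A * det B"
  by (rule det_mult)

lemma inverse_exists:
  assumes "A \<in> M" "det A \<noteq> 0" obtains B where "B \<in> M" "A * B = 1\<^sub>m N" "B * A = 1\<^sub>m N" "det B \<noteq> 0"
  using GL_inv[of A N] assms by (auto simp: GL_carrier)

lemma right_inverse_imp_left: "A \<in> M \<Longrightarrow> B \<in> M \<Longrightarrow> A * B = 1\<^sub>m N \<Longrightarrow> B * A = 1\<^sub>m N" for A B :: "complex mat"
  by (rule mat_mult_left_right_inverse)

lemma det_adj: "A \<in> M \<Longrightarrow> det (adj A) = cnj (det A)"
  by (simp add: det_transpose[of _ N] det_conj)

lemma mult_left_cancel:
  assumes "A \<in> M" "X \<in> M" "Y \<in> M" "det A \<noteq> 0" "A * X = A * Y" shows "X = Y"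
proof -
  obtain B where B: "B \<in> M" "B * A = 1\<^sub>m N" using inverse_exists assms by metis
  have "B * (A * X) = B * (A * Y)" using assms(5) by simp
  then show ?thesis using B assms(1-3) by (simp add: cancel)
qed

lemma mult_right_cancel:
  assumes "A \<in> M" "X \<in> M" "Y \<in> M" "det A \<noteq> 0" "X * A = Y * A" shows "X = Y"
proof -
  obtain B where B: "B \<in> M" "A * B = 1\<^sub>m N" using inverse_exists assms by metis
  have "(X * A) * B = (Y * A) * B" using assms(5) by simp
  then show ?thesis using B assms(1-3) by (simp add: assoc_M one_right)
qed

subsection \<open>Spectral theorem for Hermitian matrices\<close>

lemma cprod_sum: "y \<in> carrier_vec N \<Longrightarrow> w \<in> carrier_vec N \<Longrightarrow> y \<bullet>c w = (\<Sum>i<N. y $ i * cnj (w $ i))"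
  by (simp add: scalar_prod_def lessThan_atLeast0)

lemma mult_vec_entry: "B \<in> M \<Longrightarrow> y \<in> carrier_vec N \<Longrightarrow> i < N \<Longrightarrow> (B *\<^sub>v y) $ i = (\<Sum>j<N. B $$ (i,j) * y $ j)"
  for B :: "complex mat"
  by (simp add: scalar_prod_def lessThan_atLeast0)

lemma mult_vec_M: "B \<in> M \<Longrightarrow> y \<in> carrier_vec N \<Longrightarrow> B *\<^sub>v y \<in> carrier_vec N"
  by simp

lemma cprod_adj:
  assumes "B \<in> M" "y \<in> carrier_vec N" "w \<in> carrier_vec N"
  shows "(B *\<^sub>v y) \<bullet>c w = y \<bullet>c (adj B *\<^sub>v w)"
proof -
  have "(B *\<^sub>v y) \<bullet>c w = (\<Sum>i<N. \<Sum>j<N. B $$ (i,j) * y $ j * cnj (w $ i))"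
    by (simp only: cprod_sum mult_vec_M assms) (simp add: mult_vec_entry assms sum_distrib_right del: index_mult_mat_vec)
  also have "\<dots> = (\<Sum>j<N. \<Sum>i<N. B $$ (i,j) * y $ j * cnj (w $ i))" by (rule sum.swap)
  also have "\<dots> = y \<bullet>c (adj B *\<^sub>v w)"
    by (simp only: cprod_sum mult_vec_M assms conj_M transpose_M)
      (simp add: mult_vec_entry adj_entry assms sum_distrib_left mult_ac del: index_mult_mat_vec index_transpose_mat)
  finally show ?thesis .
qed

lemma normalise:
  assumes y: "y \<in> carrier_vec N" "y \<noteq> 0\<^sub>v N"
  shows "\<exists>c. (c \<cdot>\<^sub>v y) \<bullet>c (c \<cdot>\<^sub>v y) = (1::complex)"
proof -
  define r where "r = (\<Sum>i<N. (cmod (y $ i))\<^sup>2)"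
  have e: "(\<Sum>i<N. y $ i * cnj (y $ i)) = complex_of_real r"
    unfolding r_def of_real_sum complex_norm_square ..
  obtain i where i: "i < N" "y $ i \<noteq> 0" using y by (auto simp: vec_eq_iff)
  have r: "r > 0" unfolding r_def by (rule sum_pos2[of _ i]) (use i in auto)
  let ?c = "complex_of_real (1 / sqrt r)"
  have "(?c \<cdot>\<^sub>v y) \<bullet>c (?c \<cdot>\<^sub>v y) = (\<Sum>i<N. ?c * ?c * (y $ i * cnj (y $ i)))"
    using y by (simp add: scalar_prod_def lessThan_atLeast0 mult_ac)
  also have "\<dots> = ?c * ?c * complex_of_real r" unfolding sum_distrib_left[symmetric] e ..
  also have "\<dots> = 1" using r unfolding of_real_mult[symmetric] by (simp add: field_simps)
  finally show ?thesis by blast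
qed

text \<open>The vectors orthogonal to the eigenvectors found so far form a subspace that is invariant under the
Hermitian matrix, so it contains a further eigenvector.\<close>

lemma orthonormal_eigenvectors:
  assumes B: "B \<in> M" "adj B = B" and k: "k \<le> N"
  shows "\<exists>v l. (\<forall>i<k. v i \<in> carrier_vec N \<and> B *\<^sub>v v i = complex_of_real (l i) \<cdot>\<^sub>v v i)
    \<and> (\<forall>i<k. \<forall>j<k. v i \<bullet>c v j = (if i = j then 1 else 0))"
  using k
proof (induction k)
  case (Suc k)
  have "k \<le> N" using Suc.prems by simp
  from Suc.IH[OF this] obtain v l where "(\<forall>i<k. v i \<in> carrier_vec N \<and> B *\<^sub>v v i = complex_of_real (l i) \<cdot>\<^sub>v v i)
    \<and> (\<forall>i<k. \<forall>j<k. v i \<bullet>c v j = (if i = j then 1 else 0))" by (elim exE)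
  then have v: "\<And>i. i < k \<Longrightarrow> v i \<in> carrier_vec N"
    "\<And>i. i < k \<Longrightarrow> B *\<^sub>v v i = complex_of_real (l i) \<cdot>\<^sub>v v i"
    "\<And>i j. i < k \<Longrightarrow> j < k \<Longrightarrow> v i \<bullet>c v j = (if i = j then 1 else 0)" by blast+
  define V where "V = {y \<in> carrier_vec N. \<forall>i<k. y \<bullet>c v i = 0}"
  define K where "K = mat k N (\<lambda>(i,j). cnj (v i $ j))"
  have "K \<in> carrier_mat k N" by (simp add: K_def)
  then obtain y0 where y0: "y0 \<in> carrier_vec N" "y0 \<noteq> 0\<^sub>v N" "K *\<^sub>v y0 = 0\<^sub>v k"
    using underdetermined_system_solution[of K k N] Suc.prems by auto
  have "y0 \<bullet>c v i = 0" if i: "i < k" for i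
  proof -
    have "(K *\<^sub>v y0) $ i = y0 \<bullet>c v i"
      using i y0(1) v(1)[OF i] by (simp add: K_def scalar_prod_def mult.commute)
    then show ?thesis using y0 i by simp
  qed
  then have y0V: "y0 \<in> V" using y0 by (simp add: V_def)
  have "\<exists>y a. y \<in> V \<and> y \<noteq> 0\<^sub>v N \<and> B *\<^sub>v y = a \<cdot>\<^sub>v y"
  proof (rule eigenvector_in_invariant_subspace[OF B(1) _ _ _ _ y0V y0(2)])
    show "V \<subseteq> carrier_vec N" by (auto simp: V_def)
  next
    fix x y assume xy: "x \<in> V" "y \<in> V"
    have "(x + y) \<bullet>c v i = 0" if i: "i < k" for i
    proof -
      have "(x + y) \<bullet>c v i = x \<bullet>c v i + y \<bullet>c v i"
        using xy v(1)[OF i] by (intro add_scalar_prod_distrib[of _ N]) (auto simp: V_def)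
      then show ?thesis using xy i by (simp add: V_def)
    qed
    then show "x + y \<in> V" using xy by (auto simp: V_def)
  next
    fix c y assume y: "y \<in> V"
    then show "c \<cdot>\<^sub>v y \<in> V" using v(1) by (auto simp: V_def)
  next
    fix y assume y: "y \<in> V"
    have "(B *\<^sub>v y) \<bullet>c v i = 0" if i: "i < k" for i
    proof -
      have "(B *\<^sub>v y) \<bullet>c v i = y \<bullet>c (complex_of_real (l i) \<cdot>\<^sub>v v i)"
        using cprod_adj[OF B(1), of y "v i"] y v(1,2)[OF i] by (simp add: B(2) V_def)
      also have "\<dots> = complex_of_real (l i) * (y \<bullet>c v i)"
        using y v(1)[OF i] by (simp add: conjugate_smult_vec V_def)
      finally show ?thesis using y i by (simp add: V_def)
    qed
    then show "B *\<^sub>v y \<in> V" using y B by (auto simp: V_def mult_mat_vec_carrier[of _ N N])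
  qed
  then obtain y a where y: "y \<in> V" "y \<noteq> 0\<^sub>v N" "B *\<^sub>v y = a \<cdot>\<^sub>v y" by blast
  have yC: "y \<in> carrier_vec N" using y by (simp add: V_def)
  obtain c where c: "(c \<cdot>\<^sub>v y) \<bullet>c (c \<cdot>\<^sub>v y) = 1" using normalise[OF yC y(2)] by auto
  define u where "u = c \<cdot>\<^sub>v y"
  have u: "u \<in> carrier_vec N" "u \<bullet>c u = 1" using c yC by (auto simp: u_def)
  have Bu: "B *\<^sub>v u = a \<cdot>\<^sub>v u" unfolding u_def using B yC y(3) by (auto simp: mult_mat_vec[of _ N N] smult_smult_assoc mult.commute)
  have uv: "u \<bullet>c v i = 0" if i: "i < k" for i
    using y(1) v(1)[OF i] i yC unfolding u_def V_def by auto
  have vu: "v i \<bullet>c u = 0" if i: "i < k" for i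
  proof -
    have "v i \<bullet>c u = cnj (u \<bullet>c v i)" using u v(1)[OF i]
      by (simp add: scalar_prod_def mult.commute)
    then show ?thesis using uv[OF i] by simp
  qed
  have "a = (B *\<^sub>v u) \<bullet>c u" using u Bu by simp
  also have "\<dots> = u \<bullet>c (a \<cdot>\<^sub>v u)" using cprod_adj[OF B(1) u(1) u(1)] Bu B(2) by simp
  also have "\<dots> = cnj a" using u by (simp add: conjugate_smult_vec)
  finally have "a = complex_of_real (Re a)" by (simp add: complex_eq_iff)
  then have Bu': "B *\<^sub>v u = complex_of_real (Re a) \<cdot>\<^sub>v u" using Bu by simp
  show ?case
    by (rule exI[of _ "v(k := u)"], rule exI[of _ "l(k := Re a)"])
      (use u v Bu' uv vu in \<open>auto simp: less_Suc_eq\<close>)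
qed auto


theorem spectral_theorem:
  assumes B: "B \<in> M" "adj B = B"
  shows "\<exists>U\<in>M. \<exists>l. adj U * U = 1\<^sub>m N \<and> U * adj U = 1\<^sub>m N \<and>
    B = U * mat_diag N (\<lambda>i. complex_of_real (l i)) * adj U"
proof -
  obtain v l where "(\<forall>i<N. v i \<in> carrier_vec N \<and> B *\<^sub>v v i = complex_of_real (l i) \<cdot>\<^sub>v v i)
    \<and> (\<forall>i<N. \<forall>j<N. v i \<bullet>c v j = (if i = j then 1 else 0))"
    using orthonormal_eigenvectors[OF B order_refl] by (elim exE)
  then have v: "\<And>i. i < N \<Longrightarrow> v i \<in> carrier_vec N"
    "\<And>i. i < N \<Longrightarrow> B *\<^sub>v v i = complex_of_real (l i) \<cdot>\<^sub>v v i"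
    "\<And>i j. i < N \<Longrightarrow> j < N \<Longrightarrow> v i \<bullet>c v j = (if i = j then 1 else 0)" by blast+
  define U where "U = mat N N (\<lambda>(i,j). v j $ i)"
  let ?D = "mat_diag N (\<lambda>i. complex_of_real (l i))"
  have U: "U \<in> M" by (simp add: U_def)
  have col: "col U j = v j" if "j < N" for j using v(1)[OF that] that by (intro eq_vecI) (auto simp: U_def)
  have UU: "adj U * U = 1\<^sub>m N"
  proof (rule eq_matI)
    fix i j assume "i < dim_row (1\<^sub>m N)" "j < dim_col (1\<^sub>m N)"
    then have ij: "i < N" "j < N" by auto
    have "(adj U * U) $$ (i,j) = v j \<bullet>c v i"
      using ij v(1)[OF ij(1)] v(1)[OF ij(2)] by (simp add: U_def scalar_prod_def mult.commute)
    then show "(adj U * U) $$ (i,j) = 1\<^sub>m N $$ (i,j)" using v(3)[OF ij(2) ij(1)] ij by auto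
  qed (use U in auto)
  have UU': "U * adj U = 1\<^sub>m N" by (rule right_inverse_imp_left[OF _ U UU]) (use U in auto)
  have "B * U = U * ?D"
  proof (rule eq_matI)
    fix i j assume "i < dim_row (U * ?D)" "j < dim_col (U * ?D)"
    then have ij: "i < N" "j < N" using U by auto
    have "(B * U) $$ (i,j) = (B *\<^sub>v v j) $ i" using ij B U by (simp add: col)
    also have "\<dots> = complex_of_real (l j) * v j $ i" unfolding v(2)[OF ij(2)] using v(1)[OF ij(2)] ij by simp
    also have "\<dots> = (U * ?D) $$ (i,j)" using ij U by (subst mat_diag_mult_right[OF U]) (simp add: U_def mult.commute)
    finally show "(B * U) $$ (i,j) = (U * ?D) $$ (i,j)" .
  qed (use B U in auto)
  then have "B * U * adj U = U * ?D * adj U" by simp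
  moreover have "B * U * adj U = B" using B U UU' by (simp add: mat_simps)
  ultimately show ?thesis using U UU UU' by metis
qed

text \<open>In eigenbases, a matrix \<open>Y\<close> that intertwines two diagonal matrices has a zero entry wherever the two
eigenvalues differ, so it also intertwines the images of the diagonal matrices under \<open>f\<close>.\<close>

lemma functional_calculus_natural:
  assumes U: "U \<in> M" "U * adj U = 1\<^sub>m N" "adj U * U = 1\<^sub>m N"
    and V: "V \<in> M" "V * adj V = 1\<^sub>m N" "adj V * V = 1\<^sub>m N" and C: "C \<in> M"
    and eq: "C * (U * mat_diag N (\<lambda>i. complex_of_real (d i)) * adj U)
      = (V * mat_diag N (\<lambda>i. complex_of_real (e i)) * adj V) * C"
  shows "C * (U * mat_diag N (\<lambda>i. complex_of_real (f (d i))) * adj U)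
      = (V * mat_diag N (\<lambda>i. complex_of_real (f (e i))) * adj V) * C"
proof -
  let ?D = "\<lambda>d. mat_diag N (\<lambda>i. complex_of_real (d i))"
  have D: "?D d \<in> M" for d by simp
  note ms = mat_simps D U(1) V(1) C
  define Y where "Y = adj V * C * U"
  have Y: "Y \<in> M" by (simp add: Y_def ms)
  have r: "adj V * (C * (U * ?D d * adj U)) * U = Y * ?D d" for d
    by (simp add: Y_def ms U)
  have l: "adj V * ((V * ?D d * adj V) * C) * U = ?D d * Y" for d
    using cancel[OF V(3)] by (simp add: Y_def ms)
  have YD: "Y * ?D d = ?D e * Y" using arg_cong[OF eq, of "\<lambda>X. adj V * X * U"] unfolding r l .
  have "Y * ?D (\<lambda>i. f (d i)) = ?D (\<lambda>i. f (e i)) * Y"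
  proof (rule eq_matI)
    fix i j assume "i < dim_row (?D (\<lambda>i. f (e i)) * Y)" "j < dim_col (?D (\<lambda>i. f (e i)) * Y)"
    then have ij: "i < N" "j < N" using Y by (auto simp: mat_diag_def)
    have "(Y * ?D d) $$ (i,j) = (?D e * Y) $$ (i,j)" by (simp only: YD)
    then have "Y $$ (i,j) * complex_of_real (d j) = complex_of_real (e i) * Y $$ (i,j)"
      using ij Y by (simp add: mat_diag_mult_right[OF Y] mat_diag_mult_left[OF Y])
    then have "Y $$ (i,j) = 0 \<or> d j = e i" by auto
    then have "Y $$ (i,j) * complex_of_real (f (d j)) = complex_of_real (f (e i)) * Y $$ (i,j)" by auto
    then show "(Y * ?D (\<lambda>i. f (d i))) $$ (i,j) = (?D (\<lambda>i. f (e i)) * Y) $$ (i,j)"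
      using ij Y by (simp add: mat_diag_mult_right[OF Y] mat_diag_mult_left[OF Y])
  qed (use Y in auto)
  then have "V * (Y * ?D (\<lambda>i. f (d i))) * adj U = V * (?D (\<lambda>i. f (e i)) * Y) * adj U" by simp
  moreover have "V * (Y * ?D (\<lambda>i. f (d i))) * adj U = C * (U * ?D (\<lambda>i. f (d i)) * adj U)"
    using cancel[OF V(2)] by (simp add: Y_def ms)
  moreover have "V * (?D (\<lambda>i. f (e i)) * Y) * adj U = (V * ?D (\<lambda>i. f (e i)) * adj V) * C"
    using U by (simp add: Y_def ms)
  ultimately show ?thesis by simp
qed

lemma det_mat_diag: "det (mat_diag N f) = (\<Prod>i<N. f i)" for f :: "nat \<Rightarrow> complex"
proof -
  have "det (mat_diag N f) = prod_list (diag_mat (mat_diag N f))"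
    by (rule det_upper_triangular[of _ N]) (auto simp: mat_diag_def)
  then show ?thesis by (simp add: prod_list_diag_prod lessThan_atLeast0 mat_diag_def)
qed

lemma mat_diag_real: "conj_mat (mat_diag N (\<lambda>i. complex_of_real (d i))) = mat_diag N (\<lambda>i. complex_of_real (d i))"
  "(mat_diag N f)\<^sup>T = mat_diag N f"
  by (intro eq_matI; auto simp: mat_diag_def)+

text \<open>The fourth root of the positive eigenvalues of \<open>adj Y * Y\<close>. The three clauses are instances of
\<open>functional_calculus_natural\<close>, for \<open>B\<close> paired with itself, with its conjugate, and with its
transposed inverse.\<close>

theorem positive_fourth_root:
  assumes Y: "Y \<in> M" "det Y \<noteq> 0"
  defines "B \<equiv> adj Y * Y"
  shows "\<exists>T\<in>M. adj T = T \<and> det T \<noteq> 0 \<and> (T * T) * (T * T) = B \<and>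
    (\<forall>C\<in>M. C * B = B * C \<longrightarrow> C * T = T * C) \<and>
    (\<forall>C\<in>M. C * B = conj_mat B * C \<longrightarrow> C * T = conj_mat T * C) \<and>
    (\<forall>C\<in>M. isometry C B \<longrightarrow> T\<^sup>T * C * T = C)"
proof -
  let ?D = "\<lambda>d. mat_diag N (\<lambda>i. complex_of_real (d i))"
  have D: "?D d \<in> M" for d by simp
  have B: "B \<in> M" "adj B = B" using Y by (simp_all add: B_def mat_simps)
  obtain U l where U: "U \<in> M" "adj U * U = 1\<^sub>m N" "U * adj U = 1\<^sub>m N" "B = U * ?D l * adj U"
    using spectral_theorem[OF B] by blast
  note ms = mat_simps D U(1) Y(1) B(1) mat_diag_real
  have DD: "?D d * ?D e = ?D (\<lambda>i. d i * e i)" for d e by simp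
  have Dl: "?D l = adj (Y * U) * (Y * U)"
  proof -
    have "adj U * B * U = ?D l" using cancel[OF U(2)] U(2) unfolding U(4) by (simp add: ms)
    then show ?thesis unfolding B_def by (simp add: ms)
  qed
  have detU: "det U \<noteq> 0" using det_M_mult[of "adj U" U] U by (auto simp: mat_simps)
  have dl: "det (?D l) \<noteq> 0" using Y detU by (simp only: Dl det_M_mult det_adj mat_simps U(1)) simp
  have pos: "l i > 0" if i: "i < N" for i
  proof -
    let ?Z = "Y * U"
    have Z: "?Z \<in> M" using Y U by simp
    have "complex_of_real (l i) = ?D l $$ (i,i)" using i by (simp add: mat_diag_def)
    also have "\<dots> = (\<Sum>k<N. cnj (?Z $$ (k,i)) * ?Z $$ (k,i))"
      unfolding Dl using Z i by (simp add: mult_entry adj_entry conj_M transpose_M del: index_mult_mat)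
    also have "\<dots> = complex_of_real (\<Sum>k<N. (cmod (?Z $$ (k,i)))\<^sup>2)"
      unfolding of_real_sum complex_norm_square by (simp only: mult.commute)
    finally have "l i = (\<Sum>k<N. (cmod (?Z $$ (k,i)))\<^sup>2)" by (simp only: of_real_eq_iff)
    then have "l i \<ge> 0" by (simp add: sum_nonneg)
    moreover have "l i \<noteq> 0" using dl i by (auto simp: det_mat_diag)
    ultimately show ?thesis by simp
  qed
  define f where "f = root 4"
  have f: "f (l i) > 0" "f (1 / l i) = 1 / f (l i)" "f (l i) * f (l i) * (f (l i) * f (l i)) = l i" if "i < N" for i
  proof -
    show "f (l i) > 0" using pos[OF that] by (simp add: f_def)
    show "f (1 / l i) = 1 / f (l i)" by (simp add: f_def real_root_divide)
    have "f (l i) ^ 4 = l i" using pos[OF that] by (simp add: f_def)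
    then show "f (l i) * f (l i) * (f (l i) * f (l i)) = l i" by (simp add: power4_eq_xxxx mult.assoc)
  qed
  have Deq: "?D d = ?D e" if "\<And>i. i < N \<Longrightarrow> d i = e i" for d e
    using that by (intro eq_matI) (auto simp: mat_diag_def)
  define T where "T = U * ?D (\<lambda>i. f (l i)) * adj U"
  have T: "T \<in> M" by (simp add: T_def ms)
  have TT: "T * T = U * ?D (\<lambda>i. f (l i) * f (l i)) * adj U"
    unfolding T_def using cancel[OF U(2)] rewrite_prefix[OF DD] by (simp add: ms del: of_real_mult mat_diag_diag)
  have T4: "(T * T) * (T * T) = B"
  proof -
    have "(T * T) * (T * T) = U * ?D (\<lambda>i. f (l i) * f (l i) * (f (l i) * f (l i))) * adj U"
      unfolding TT using cancel[OF U(2)] rewrite_prefix[OF DD] by (simp add: ms del: of_real_mult mat_diag_diag)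
    also have "?D (\<lambda>i. f (l i) * f (l i) * (f (l i) * f (l i))) = ?D l" by (rule Deq) (rule f(3))
    finally show ?thesis by (simp only: U(4))
  qed
  have adjT: "adj T = T" by (simp add: T_def ms)
  have detT: "det T \<noteq> 0"
  proof
    assume "det T = 0"
    then have "det B = 0" unfolding T4[symmetric] using T by (simp only: det_M_mult mult_M) simp
    then show False using Y by (simp only: B_def det_M_mult det_adj conj_M transpose_M) simp
  qed
  have adjcU: "adj (conj_mat U) = U\<^sup>T" by (simp add: mat_simps)
  have cU: "conj_mat U \<in> M" "conj_mat U * adj (conj_mat U) = 1\<^sub>m N" "adj (conj_mat U) * conj_mat U = 1\<^sub>m N"
    using arg_cong[OF U(3), of conj_mat] arg_cong[OF U(2), of conj_mat] by (simp_all add: ms)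
  note cU' = cU(2,3)[unfolded adjcU]
  have comm: "C * T = T * C" if "C \<in> M" "C * B = B * C" for C
    unfolding T_def using that U functional_calculus_natural[of U U C l l f] by simp
  have ccomm: "C * T = conj_mat T * C" if "C \<in> M" "C * B = conj_mat B * C" for C
  proof -
    have "conj_mat (U * ?D d * adj U) = conj_mat U * ?D d * adj (conj_mat U)" for d by (simp add: ms)
    then show ?thesis
      unfolding T_def using that U cU functional_calculus_natural[of U "conj_mat U" C l l f] by simp
  qed
  have form: "isometry C T" if C: "C \<in> M" "isometry C B" for C
  proof -
    let ?E = "\<lambda>d. conj_mat U * ?D d * adj (conj_mat U)"
    have tr: "(U * ?D d * adj U)\<^sup>T = ?E d" for d by (simp add: ms)
    have EE: "?E d * ?E e = 1\<^sub>m N" if "\<And>i. i < N \<Longrightarrow> d i * e i = 1" for d e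
    proof -
      have "?D (\<lambda>i. d i * e i) = 1\<^sub>m N" using that
        by (intro eq_matI) (auto simp: mat_diag_def simp flip: of_real_mult)
      then have "?D d * ?D e = 1\<^sub>m N" by (simp only: DD)
      from cancel[OF this D D] have "?D d * (?D e * X) = X" if "X \<in> M" for X using that .
      then show ?thesis using cancel[OF cU'(2)] cU' by (simp add: ms)
    qed
    have EM: "?E d \<in> M" for d by (simp add: ms)
    have inv1: "?E (\<lambda>i. 1 / l i) * ?E l = 1\<^sub>m N" by (rule EE) (use pos in force)
    have "C * B = ?E (\<lambda>i. 1 / l i) * (?E l * (C * B))"
      by (rule cancel[OF inv1 EM EM mult_M[OF C(1) B(1)], symmetric])
    also have "?E l * (C * B) = C" using C(2) unfolding U(4) tr by (simp add: ms C(1))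
    finally have eq: "C * (U * ?D l * adj U) = ?E (\<lambda>i. 1 / l i) * C" unfolding U(4) .
    have "C * T = ?E (\<lambda>i. f (1 / l i)) * C"
      unfolding T_def by (rule functional_calculus_natural[OF U(1,3,2) cU C(1) eq])
    then have "T\<^sup>T * (C * T) = ?E (\<lambda>i. f (l i)) * (?E (\<lambda>i. f (1 / l i)) * C)" unfolding T_def tr by simp
    also have "\<dots> = C"
    proof (rule cancel[OF EE EM EM C(1)])
      fix i assume "i < N"
      then show "f (l i) * f (1 / l i) = 1" using f(1,2)[of i] by simp
    qed
    finally show ?thesis using C T by (simp add: mat_simps)
  qed
  show ?thesis using T adjT detT T4 comm ccomm form by blast
qed

subsection \<open>Hermitian involutions with the same trace\<close>

lemma hermitian_involution_diagonal:
  assumes W: "W \<in> M" "adj W = W" "W * W = 1\<^sub>m N"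
  shows "\<exists>U\<in>M. \<exists>A\<subseteq>{..<N}. adj U * U = 1\<^sub>m N \<and> U * adj U = 1\<^sub>m N \<and>
    W = U * mat_diag N (\<lambda>i. if i \<in> A then 1 else -1) * adj U"
proof -
  let ?D = "\<lambda>d. mat_diag N (\<lambda>i. complex_of_real (d i))"
  have D: "?D d \<in> M" for d by simp
  obtain U l where U: "U \<in> M" "adj U * U = 1\<^sub>m N" "U * adj U = 1\<^sub>m N" "W = U * ?D l * adj U"
    using spectral_theorem[OF W(1,2)] by blast
  note ms = mat_simps D U(1)
  have 1: "adj U * (W * W) * U = ?D l * ?D l"
    unfolding U(4) using cancel[OF U(2)] U(2) by (simp add: ms del: mat_diag_diag)
  have DD: "?D l * ?D l = 1\<^sub>m N" unfolding 1[symmetric] W(3) using U(2) by (simp add: ms)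
  have sq: "l i * l i = 1" if "i < N" for i
  proof -
    have "mat_diag N (\<lambda>i. complex_of_real (l i) * complex_of_real (l i)) $$ (i,i) = 1"
      using that by (simp only: DD[unfolded mat_diag_diag]) simp
    then have "complex_of_real (l i * l i) = 1" using that by (simp add: mat_diag_def del: of_real_eq_1_iff)
    then show ?thesis by (simp only: of_real_eq_1_iff)
  qed
  have "?D l = mat_diag N (\<lambda>i. if i \<in> {i. i < N \<and> l i = 1} then 1 else -1)"
  proof (rule eq_matI)
    fix i j assume "i < dim_row (mat_diag N (\<lambda>i. if i \<in> {i. i < N \<and> l i = 1} then 1 else - 1 :: complex))"
      "j < dim_col (mat_diag N (\<lambda>i. if i \<in> {i. i < N \<and> l i = 1} then 1 else - 1 :: complex))"
    then have ij: "i < N" "j < N" by auto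
    then have "l i = 1 \<or> l i = -1" using sq[OF ij(1)] by (simp add: square_eq_1_iff)
    then show "?D l $$ (i,j) = mat_diag N (\<lambda>i. if i \<in> {i. i < N \<and> l i = 1} then 1 else -1) $$ (i,j)"
      using ij by (auto simp: mat_diag_def)
  qed auto
  then show ?thesis using U by (intro bexI[of _ U] exI[of _ "{i. i < N \<and> l i = 1}"]) auto
qed

lemma mat_trace_unitary_conj:
  assumes "U \<in> M" "D \<in> M" "adj U * U = 1\<^sub>m N"
  shows "mat_trace (U * D * adj U) = mat_trace D"
proof -
  have "mat_trace (U * D * adj U) = mat_trace (adj U * (U * D))"
    by (rule mat_trace_mult_comm[of _ N]) (use assms in auto)
  then show ?thesis using assms cancel[OF assms(3)] by (simp add: mat_simps)
qed

lemma mat_trace_signs: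
  assumes "A \<subseteq> {..<N}"
  shows "mat_trace (mat_diag N (\<lambda>i. if i \<in> A then 1 else -1)) = 2 * of_nat (card A) - of_nat N"
proof -
  have "mat_trace (mat_diag N (\<lambda>i. if i \<in> A then 1 else -1)) = (\<Sum>i<N. if i \<in> A then 1 else -1)"
    by (simp add: mat_trace_def mat_diag_def)
  also have "\<dots> = (\<Sum>i<N. 2 * (if i \<in> A then 1 else 0) - 1)" by (rule sum.cong) auto
  also have "\<dots> = 2 * (\<Sum>i<N. if i \<in> A then 1 else 0) - of_nat N"
    by (simp add: sum_subtractf sum_distrib_left)
  also have "(\<Sum>i<N. if i \<in> A then 1 else 0) = (of_nat (card A) :: complex)"
    using assms by (simp add: sum.If_cases Int_absorb1)
  finally show ?thesis .
qed

text \<open>Both are diagonal with entries \<open>\<plusminus> 1\<close> in an orthonormal basis, and the trace counts the entries \<open>1\<close>. A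
permutation matches the two diagonals.\<close>

theorem hermitian_involutions_similar:
  assumes W: "W \<in> M" "adj W = W" "W * W = 1\<^sub>m N" and W': "W' \<in> M" "adj W' = W'" "W' * W' = 1\<^sub>m N"
    and tr: "mat_trace W = mat_trace W'"
  shows "\<exists>S\<in>M. det S \<noteq> 0 \<and> S * W = W' * S"
proof -
  let ?s = "\<lambda>A i. if i \<in> A then 1 else -1 :: complex"
  have D: "mat_diag N f \<in> M" for f by simp
  obtain U A where U: "U \<in> M" "A \<subseteq> {..<N}" "adj U * U = 1\<^sub>m N" "U * adj U = 1\<^sub>m N" "W = U * mat_diag N (?s A) * adj U"
    using hermitian_involution_diagonal[OF W] by blast
  obtain U' A' where U': "U' \<in> M" "A' \<subseteq> {..<N}" "adj U' * U' = 1\<^sub>m N" "U' * adj U' = 1\<^sub>m N" "W' = U' * mat_diag N (?s A') * adj U'"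
    using hermitian_involution_diagonal[OF W'] by blast
  have "2 * of_nat (card A) - of_nat N = (2 * of_nat (card A') - of_nat N :: complex)"
    using tr unfolding U(5) U'(5)
    by (simp only: mat_trace_unitary_conj[OF U(1) D U(3)] mat_trace_unitary_conj[OF U'(1) D U'(3)]
        mat_trace_signs[OF U(2)] mat_trace_signs[OF U'(2)])
  then have cA: "card A = card A'" by simp
  have fin: "finite A" "finite A'" using U(2) U'(2) finite_subset by blast+
  \<comment> \<open>The permutation \<open>h\<close> matches the positions of \<open>1\<close> on the two diagonals, and those of \<open>- 1\<close>.\<close>
  obtain f where f: "bij_betw f A' A" using finite_same_card_bij[OF fin(2,1)] cA by auto
  obtain g where g: "bij_betw g ({..<N} - A') ({..<N} - A)"
    using finite_same_card_bij[of "{..<N} - A'" "{..<N} - A"] cA U(2) U'(2) fin by (auto simp: card_Diff_subset)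
  define h where "h i = (if i \<in> A' then f i else g i)" for i
  have h1: "h i \<in> A" if "i \<in> A'" for i using that f by (auto simp: h_def bij_betw_def)
  have h2: "h i \<in> {..<N} - A" if "i \<in> {..<N} - A'" for i using that g by (auto simp: h_def bij_betw_def)
  have hN: "h i < N" if "i < N" for i using h1[of i] h2[of i] U(2) that by auto
  have hA: "h i \<in> A \<longleftrightarrow> i \<in> A'" if "i < N" for i using h1[of i] h2[of i] that by auto
  have inj: "i = j" if "i < N" "j < N" "h i = h j" for i j
  proof (cases "i \<in> A'")
    case True
    then have "j \<in> A'" using hA that by metis
    then show ?thesis using True that f by (auto simp: h_def bij_betw_def inj_on_def)
  next
    case False
    then have "j \<notin> A'" using hA that by metis
    then show ?thesis using False that g by (auto simp: h_def bij_betw_def inj_on_def)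
  qed
  define Q where "Q = mat N N (\<lambda>(i,j). if j = h i then 1 else 0 :: complex)"
  have Q: "Q \<in> M" by (simp add: Q_def)
  have "Q * Q\<^sup>T = 1\<^sub>m N"
  proof (rule eq_matI)
    fix i j assume "i < dim_row (1\<^sub>m N :: complex mat)" "j < dim_col (1\<^sub>m N :: complex mat)"
    then have ij: "i < N" "j < N" by auto
    have "(Q * Q\<^sup>T) $$ (i,j) = (\<Sum>k<N. (if k = h i then 1 else 0) * (if k = h j then 1 else 0))"
      using ij by (simp add: Q_def scalar_prod_def lessThan_atLeast0)
    also have "\<dots> = (\<Sum>k<N. if k = h i then (if h i = h j then 1 else 0) else 0)" by (rule sum.cong) auto
    also have "\<dots> = (if h i = h j then 1 else 0)" using hN[OF ij(1)] by simp
    also have "\<dots> = 1\<^sub>m N $$ (i,j)" using inj[OF ij] ij by auto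
    finally show "(Q * Q\<^sup>T) $$ (i,j) = 1\<^sub>m N $$ (i,j)" .
  qed (use Q in auto)
  then have dQ: "det Q \<noteq> 0" using det_M_mult[of Q "Q\<^sup>T"] Q by (auto simp: mat_simps)
  have QD: "Q * mat_diag N (?s A) = mat_diag N (?s A') * Q"
  proof (rule eq_matI)
    fix i j assume "i < dim_row (mat_diag N (?s A') * Q)" "j < dim_col (mat_diag N (?s A') * Q)"
    then have ij: "i < N" "j < N" using Q by (auto simp: mat_diag_def)
    then show "(Q * mat_diag N (?s A)) $$ (i,j) = (mat_diag N (?s A') * Q) $$ (i,j)"
      using hA[OF ij(1)] by (simp add: mat_diag_mult_right[OF Q] mat_diag_mult_left[OF Q]) (simp add: Q_def)
  qed (use Q in auto)
  have "det U \<noteq> 0" "det U' \<noteq> 0"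
    using det_M_mult[of "adj U" U] det_M_mult[of "adj U'" U'] U U' by (auto simp: mat_simps)
  then have "det (U' * Q * adj U) \<noteq> 0" using U U' Q dQ by (simp add: det_M_mult det_adj mat_simps)
  moreover have "(U' * Q * adj U) * W = W' * (U' * Q * adj U)"
    unfolding U(5) U'(5) using cancel[OF U(3)] cancel[OF U'(3)] rewrite_prefix[OF QD Q D] U(1) U'(1) Q
    by (simp add: mat_simps)
  ultimately show ?thesis using U U' Q by (intro bexI[of _ "U' * Q * adj U"]) (auto simp: mat_simps)
qed

subsection \<open>A generic real combination is invertible\<close>

lemma infinite_unit_circle: "infinite {w :: complex. cmod w = 1}"
proof
  assume fin: "finite {w :: complex. cmod w = 1}"
  have "(\<lambda>t. Complex t (sqrt (1 - t\<^sup>2))) ` {0<..<1} \<subseteq> {w. cmod w = 1}"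
  proof clarify
    fix t :: real assume "t \<in> {0<..<1}"
    then have "t\<^sup>2 \<le> 1" by (simp add: power_le_one)
    then show "cmod (Complex t (sqrt (1 - t\<^sup>2))) = 1" by (simp add: cmod_def)
  qed
  moreover have "inj_on (\<lambda>t. Complex t (sqrt (1 - t\<^sup>2))) {0<..<1}" by (auto intro!: inj_onI)
  ultimately have "finite {0<..<1::real}" using fin finite_subset finite_imageD by blast
  then show False by (simp add: infinite_Ioo)
qed

lemma finitely_many_eigenvalues:
  assumes "E \<in> M" shows "finite {a. eigenvalue E a}"
proof -
  have "char_poly E \<noteq> 0" using degree_monic_char_poly[OF assms] by auto
  then show ?thesis unfolding eigenvalue_root_char_poly[OF assms] by (rule poly_roots_finite)
qed

text \<open>On the unit circle the determinant vanishes only when \<open>- z\<^sup>2\<close> is one of the finitely many eigenvalues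
of \<open>A\<^sup>-\<^sup>1 C\<close>.\<close>

lemma invertible_combination:
  assumes A: "A \<in> M" "det A \<noteq> 0" and C: "C \<in> M"
  shows "\<exists>z. det (z \<cdot>\<^sub>m A + cnj z \<cdot>\<^sub>m C) \<noteq> 0"
proof -
  obtain A' where A': "A' \<in> M" "A' * A = 1\<^sub>m N" "A * A' = 1\<^sub>m N" using inverse_exists[OF A] by metis
  have E: "A' * C \<in> M" using A' C by simp
  let ?E = "{a. eigenvalue (A' * C) a}"
  have "infinite ({w :: complex. cmod w = 1} - uminus ` ?E)"
    by (intro Diff_infinite_finite finite_imageI finitely_many_eigenvalues[OF E] infinite_unit_circle)
  then have "{w :: complex. cmod w = 1} - uminus ` ?E \<noteq> {}" by (rule infinite_imp_nonempty)
  then obtain w where w: "cmod w = 1" "w \<notin> uminus ` ?E" by blast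
  have we: "\<not> eigenvalue (A' * C) (- w)"
  proof
    assume "eigenvalue (A' * C) (- w)"
    then have "- (- w) \<in> uminus ` ?E" by (intro imageI) simp
    then show False using w(2) by simp
  qed
  define z where "z = csqrt w"
  have zw: "z * z = w" unfolding z_def using power2_csqrt[of w] by (simp only: power2_eq_square)
  have "cmod z * cmod z = 1" using w(1) by (simp only: norm_mult[symmetric] zw)
  then have "z * cnj z = 1" by (simp only: complex_norm_square[symmetric] power2_eq_square) simp
  have "det (z \<cdot>\<^sub>m A + cnj z \<cdot>\<^sub>m C) \<noteq> 0"
  proof
    assume d: "det (z \<cdot>\<^sub>m A + cnj z \<cdot>\<^sub>m C) = 0"
    have "z \<cdot>\<^sub>m A + cnj z \<cdot>\<^sub>m C \<in> M" using A C by simp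
    then obtain v where v: "v \<in> carrier_vec N" "v \<noteq> 0\<^sub>v N" "(z \<cdot>\<^sub>m A + cnj z \<cdot>\<^sub>m C) *\<^sub>v v = 0\<^sub>v N"
      using det_0_iff_vec_prod_zero d by blast
    have AE: "A * (A' * C) = C" using A A' C by (simp add: cancel)
    have "z \<cdot>\<^sub>m (z \<cdot>\<^sub>m A + cnj z \<cdot>\<^sub>m C) = A * (w \<cdot>\<^sub>m 1\<^sub>m N + A' * C)"
      using A C E \<open>z * cnj z = 1\<close> zw by (simp add: mult_add smult_add AE mat_simps)
    then have "z \<cdot>\<^sub>m (z \<cdot>\<^sub>m A + cnj z \<cdot>\<^sub>m C) *\<^sub>v v = A *\<^sub>v ((w \<cdot>\<^sub>m 1\<^sub>m N + A' * C) *\<^sub>v v)"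
      using A E v by (simp add: assoc_mult_mat_vec[of _ N N _ N] del: assoc_mult_mat)
    moreover have "z \<cdot>\<^sub>m (z \<cdot>\<^sub>m A + cnj z \<cdot>\<^sub>m C) *\<^sub>v v = z \<cdot>\<^sub>v ((z \<cdot>\<^sub>m A + cnj z \<cdot>\<^sub>m C) *\<^sub>v v)"
      using A C v(1) by (intro eq_vecI) auto
    moreover have "z \<cdot>\<^sub>v 0\<^sub>v N = 0\<^sub>v N" by (intro eq_vecI) auto
    ultimately have "A *\<^sub>v ((w \<cdot>\<^sub>m 1\<^sub>m N + A' * C) *\<^sub>v v) = 0\<^sub>v N" unfolding v(3) by simp
    then have "(w \<cdot>\<^sub>m 1\<^sub>m N + A' * C) *\<^sub>v v = 0\<^sub>v N"
      using A E v det_0_iff_vec_prod_zero[OF A(1)] mult_mat_vec_carrier[of "w \<cdot>\<^sub>m 1\<^sub>m N + A' * C" N N v] by auto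
    then have z: "((w \<cdot>\<^sub>m 1\<^sub>m N + A' * C) *\<^sub>v v) $ i = 0" if "i < N" for i using that by simp
    have sp: "((w \<cdot>\<^sub>m 1\<^sub>m N + A' * C) *\<^sub>v v) = w \<cdot>\<^sub>v v + (A' * C) *\<^sub>v v"
    proof -
      have "(w \<cdot>\<^sub>m 1\<^sub>m N) *\<^sub>v v = w \<cdot>\<^sub>v v" using v(1) by (intro eq_vecI) auto
      then show ?thesis using E v(1) by (subst add_mult_distrib_mat_vec[of _ N N]) auto
    qed
    have "w * v $ i + ((A' * C) *\<^sub>v v) $ i = 0" if "i < N" for i
    proof -
      define b where "b = (A' * C) *\<^sub>v v"
      have "b \<in> carrier_vec N" using E v(1) by (simp add: b_def del: assoc_mult_mat_vec)
      then show ?thesis using z[OF that] v(1) that unfolding sp b_def[symmetric] by simp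
    qed
    then have "((A' * C) *\<^sub>v v) $ i = - w * v $ i" if "i < N" for i
      using that by (simp add: eq_neg_iff_add_eq_0 add.commute del: index_mult_mat_vec assoc_mult_mat_vec)
    then have "(A' * C) *\<^sub>v v = (- w) \<cdot>\<^sub>v v"
      using E v(1) by (intro eq_vecI) (auto simp del: index_mult_mat_vec assoc_mult_mat_vec)
    then have "eigenvalue (A' * C) (- w)" using A'(1) v unfolding eigenvalue_def eigenvector_def by auto
    then show False using we by simp
  qed
  then show ?thesis by blast
qed

end

section \<open>Normal forms of invariant structures\<close>

context square_mats
begin

lemma det_nonzero_if_inverse:
  assumes "A \<in> M" "B \<in> M" "A * B = 1\<^sub>m N" shows "det A \<noteq> 0"
  using det_M_mult[OF assms(1,2)] assms(3) by auto

subsection \<open>Real and quaternionic structures\<close>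

text \<open>For every \<open>X\<close> the sum of \<open>X\<close> and \<open>e K (conj_mat X) P\<close> satisfies the required equation. With a scalar \<open>X = z\<close>
it is invertible for a suitable \<open>z\<close>.\<close>

lemma twisted_intertwiner:
  assumes P: "P \<in> M" and K: "K \<in> M" "conj_mat K = K" "K * K = e \<cdot>\<^sub>m 1\<^sub>m N"
    and PP: "conj_mat P * P = e \<cdot>\<^sub>m 1\<^sub>m N" and e: "e = 1 \<or> e = -1"
  shows "\<exists>Q\<in>M. det Q \<noteq> 0 \<and> conj_mat Q * P = K * Q"
proof -
  \<comment> \<open>The inverse of \<open>K\<close> is \<open>e K\<close>, since \<open>K\<^sup>2 = e\<close>.\<close>
  have C: "e \<cdot>\<^sub>m (K * P) \<in> M" using K P by simp
  obtain z where z: "det (z \<cdot>\<^sub>m 1\<^sub>m N + cnj z \<cdot>\<^sub>m (e \<cdot>\<^sub>m (K * P))) \<noteq> 0"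
    using invertible_combination[OF one_M _ C] by auto
  define Q where "Q = z \<cdot>\<^sub>m 1\<^sub>m N + cnj z \<cdot>\<^sub>m (e \<cdot>\<^sub>m (K * P))"
  have Q: "Q \<in> M" using K P by (simp add: Q_def)
  have ee: "e * e = 1" "cnj e = e" using e by auto
  have ee': "a * e * e = a" for a using ee by (simp add: mult.assoc)
  have "conj_mat Q = cnj z \<cdot>\<^sub>m 1\<^sub>m N + (z * e) \<cdot>\<^sub>m (K * conj_mat P)"
    using K(1,2) P ee by (simp add: Q_def mat_simps)
  then have "conj_mat Q * P = cnj z \<cdot>\<^sub>m P + z \<cdot>\<^sub>m K"
    using K(1) P by (simp add: add_mult mat_simps PP ee')
  moreover have "K * Q = z \<cdot>\<^sub>m K + cnj z \<cdot>\<^sub>m P"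
    using K(1) P rewrite_prefix[OF K(3) K(1) K(1) P] by (simp add: Q_def mult_add mat_simps ee' ee)
  moreover have "z \<cdot>\<^sub>m K + cnj z \<cdot>\<^sub>m P = cnj z \<cdot>\<^sub>m P + z \<cdot>\<^sub>m K"
    using K(1) P by (intro comm_add_mat) auto
  ultimately show ?thesis using z Q by (intro bexI[of _ Q]) (auto simp: Q_def)
qed

lemma twisted_transfer:
  assumes c: "A \<in> M" "P \<in> M" "K \<in> M" "Q \<in> M" "R \<in> M" and QR: "Q * R = 1\<^sub>m N" "R * Q = 1\<^sub>m N"
    and AP: "conj_mat A * P = P * A" and QP: "conj_mat Q * P = K * Q"
  shows "conj_mat (Q * A * R) * K = K * (Q * A * R)"
proof (rule mult_right_cancel[of Q])
  have cRQ: "conj_mat R * conj_mat Q = 1\<^sub>m N"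
    using arg_cong[OF QR(2), of conj_mat] c by (simp add: mat_simps)
  have "conj_mat (Q * A * R) * K * Q = conj_mat Q * (conj_mat A * (conj_mat R * (K * Q)))"
    using c by (simp add: mat_simps)
  also have "K * Q = conj_mat Q * P" using QP ..
  also have "conj_mat R * (conj_mat Q * P) = P" using c by (simp add: cancel[OF cRQ])
  also have "conj_mat Q * (conj_mat A * P) = K * Q * A"
    unfolding AP using c by (simp add: assoc_M[symmetric] QP del: assoc_mult_mat)
  also have "\<dots> = K * (Q * A * R) * Q" using c QR(2) by (simp add: mat_simps)
  finally show "conj_mat (Q * A * R) * K * Q = K * (Q * A * R) * Q" .
qed (use c det_nonzero_if_inverse[OF c(4,5) QR(1)] in auto)

subsection \<open>Hermitian and skew-Hermitian forms\<close>

lemma sesquilinear_transfer: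
  assumes c: "A \<in> M" "S \<in> M" "W \<in> M" "Q \<in> M" "R \<in> M" and QR: "Q * R = 1\<^sub>m N"
    and A: "unitary_for S A" and Q: "adj Q * W * Q = S"
  shows "unitary_for W (Q * A * R)"
proof -
  have aQR: "adj R * adj Q = 1\<^sub>m N"
    using arg_cong[OF QR, of adj] c by (simp add: mat_simps)
  have "adj (Q * A * R) * W * (Q * A * R) = adj R * (adj A * (adj Q * W * Q) * A) * R"
    using c by (simp add: mat_simps)
  also have "\<dots> = adj R * (adj Q * W * Q) * R" unfolding Q A ..
  also have "\<dots> = W" using c QR by (simp add: mat_simps cancel[OF aQR])
  finally show ?thesis .
qed

text \<open>The positive matrix \<open>adj S * S = e S\<^sup>2\<close> commutes with \<open>S\<close>, so its fourth root \<open>T\<close> does too, and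
\<open>W = T\<^sup>-\<^sup>1 S T\<^sup>-\<^sup>1\<close> has square \<open>T\<^sup>-\<^sup>4 S\<^sup>2 = e\<close>. The fourth root of an isometry of \<open>F\<close> is again one.\<close>

lemma polar_normalisation:
  assumes S: "S \<in> M" "det S \<noteq> 0" "adj S = e \<cdot>\<^sub>m S" and e: "e = 1 \<or> e = -1"
  shows "\<exists>T\<in>M. \<exists>W\<in>M. adj T = T \<and> det T \<noteq> 0 \<and> S = T * W * T \<and> adj W = e \<cdot>\<^sub>m W \<and> W * W = e \<cdot>\<^sub>m 1\<^sub>m N \<and>
    (\<forall>F\<in>M. isometry F S \<longrightarrow> T\<^sup>T * F * T = F \<and> W\<^sup>T * F * W = F)"
proof -
  have ee: "e * e = 1" using e by auto
  define B where "B = adj S * S"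
  have B: "B \<in> M" unfolding B_def by (intro mult_M transpose_M conj_M S(1))
  have BS: "B = e \<cdot>\<^sub>m (S * S)" unfolding B_def S(3) using S(1) by (simp add: mat_simps)
  obtain T where T0: "T \<in> M" and T': "adj T = T \<and> det T \<noteq> 0 \<and> (T * T) * (T * T) = B \<and>
    (\<forall>C\<in>M. C * B = B * C \<longrightarrow> C * T = T * C) \<and> (\<forall>C\<in>M. C * B = conj_mat B * C \<longrightarrow> C * T = conj_mat T * C) \<and>
    (\<forall>C\<in>M. isometry C B \<longrightarrow> T\<^sup>T * C * T = C)"
    using positive_fourth_root[OF S(1,2), folded B_def] by (elim bexE)
  have T: "T \<in> M" "adj T = T" "det T \<noteq> 0" "(T * T) * (T * T) = B" using T0 T' by simp_all
  have comm: "C * T = T * C" if "C \<in> M" "C * B = B * C" for C using T' that by simp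
  have form: "isometry C T" if "C \<in> M" "isometry C B" for C using T' that by simp
  have ST: "S * T = T * S" by (rule comm) (use S in \<open>simp_all add: BS mat_simps\<close>)
  obtain R where R: "R \<in> M" "T * R = 1\<^sub>m N" "R * T = 1\<^sub>m N" using inverse_exists[OF T(1,3)] by metis
  have RS: "R * S = S * R"
  proof (rule mult_left_cancel[OF T(1) _ _ T(3)])
    show "T * (R * S) = T * (S * R)"
      using T(1) R S(1) cancel[OF R(2) T(1) R(1)] rewrite_prefix[OF ST[symmetric] T(1) S(1) R(1)] by (simp add: mat_simps)
  qed (use R S in auto)
  have adjR: "adj R = R"
  proof (rule mult_left_cancel[OF T(1) _ _ T(3)])
    have "T * adj R = adj T * adj R" by (simp only: T(2))
    also have "\<dots> = adj (R * T)" using T(1) R(1) by (simp add: mat_simps)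
    also have "\<dots> = T * R" using R by (simp add: mat_simps)
    finally show "T * adj R = T * R" .
  qed (use R in auto)
  define W where "W = R * S * R"
  have W: "W \<in> M" using R S by (simp add: W_def)
  have TWT: "S = T * W * T" unfolding W_def using T(1) R S(1) by (simp add: mat_simps cancel[OF R(2)])
  have "adj W = R * adj S * R" unfolding W_def using R(1) S(1) adjR by (simp add: mat_simps)
  also have "\<dots> = e \<cdot>\<^sub>m W" unfolding S(3) W_def using R(1) S(1) by (simp add: mat_simps)
  finally have adjW: "adj W = e \<cdot>\<^sub>m W" .
  have "W * W = R * (R * (R * (R * (S * S))))"
    unfolding W_def using R(1) S(1) RS rewrite_prefix[OF RS R(1) S(1)] by (simp add: mat_simps)
  also have "S * S = e \<cdot>\<^sub>m B" using S(1) ee by (simp add: BS mat_simps)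
  also have "R * (R * (R * (R * (e \<cdot>\<^sub>m B)))) = e \<cdot>\<^sub>m 1\<^sub>m N"
    unfolding T(4)[symmetric] using R(1,3) T(1) cancel[OF R(3)] by (simp add: mat_simps)
  finally have WW: "W * W = e \<cdot>\<^sub>m 1\<^sub>m N" .
  have "isometry F T \<and> W\<^sup>T * F * W = F" if F: "F \<in> M" "isometry F S" for F
  proof -
    have SF: "S\<^sup>T * (F * S) = F" using F S(1) by (simp add: mat_simps)
    have "B\<^sup>T * F * B = (e * e) \<cdot>\<^sub>m (S\<^sup>T * (S\<^sup>T * (F * S) * S))"
      unfolding BS using S(1) F(1) by (simp add: mat_simps)
    also have "\<dots> = F" unfolding SF using S(1) F(1) ee by (simp add: mat_simps SF)
    finally have t: "isometry F T" by (rule form[OF F(1)])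
    have r: "isometry F R" by (rule form_inv[OF T(1) R(1) F(1) t R(2)])
    have "isometry F W" unfolding W_def
      by (intro form_mult[of _ N]) (use R S F r in auto)
    then show ?thesis using t by simp
  qed
  then show ?thesis using T W TWT adjW WW by blast
qed

text \<open>This is the unitary part \<open>X (adj X * X)\<^bsup>-1/2\<^esup>\<close> of \<open>X\<close>. The positive part commutes with \<open>W\<close> because \<open>X\<close> and
its adjoint both intertwine.\<close>

lemma unitary_intertwiner:
  assumes W: "W \<in> M" "adj W = e \<cdot>\<^sub>m W" and W': "W' \<in> M" "adj W' = e \<cdot>\<^sub>m W'" and e: "e = 1 \<or> e = -1"
    and X: "X \<in> M" "det X \<noteq> 0" "X * W = W' * X"
  shows "\<exists>V\<in>M. adj V * V = 1\<^sub>m N \<and> V * W = W' * V \<and>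
    (\<forall>F\<in>M. F * adj F = 1\<^sub>m N \<longrightarrow> F * X = conj_mat X * F \<longrightarrow> F * V = conj_mat V * F)"
proof -
  define B where "B = adj X * X"
  have B: "B \<in> M" using X by (simp add: B_def)
  have ee: "e * e = 1" using e by auto
  obtain T where T0: "T \<in> M" and T': "adj T = T \<and> det T \<noteq> 0 \<and> (T * T) * (T * T) = B \<and>
    (\<forall>C\<in>M. C * B = B * C \<longrightarrow> C * T = T * C) \<and> (\<forall>C\<in>M. C * B = conj_mat B * C \<longrightarrow> C * T = conj_mat T * C) \<and>
    (\<forall>C\<in>M. isometry C B \<longrightarrow> T\<^sup>T * C * T = C)"
    using positive_fourth_root[OF X(1,2), folded B_def] by (elim bexE)
  have T: "T \<in> M" "adj T = T" "det T \<noteq> 0" "(T * T) * (T * T) = B" using T0 T' by simp_all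
  have comm: "C * T = T * C" if "C \<in> M" "C * B = B * C" for C using T' that by simp
  have real: "C * T = conj_mat T * C" if "C \<in> M" "C * B = conj_mat B * C" for C using T' that by simp
  define R where "R = T * T"
  have R: "R \<in> M" "adj R = R" "det R \<noteq> 0" "R * R = B"
    unfolding R_def using T by (simp_all add: mat_simps det_M_mult)
  obtain I where I: "I \<in> M" "R * I = 1\<^sub>m N" "I * R = 1\<^sub>m N" using inverse_exists[OF R(1,3)] by metis
  have adjI: "adj I = I"
  proof (rule mult_left_cancel[OF R(1) _ _ R(3)])
    have "R * adj I = adj R * adj I" by (simp only: R(2))
    also have "\<dots> = adj (I * R)" using R(1) I(1) by (simp add: mat_simps)
    also have "\<dots> = R * I" using I by (simp add: mat_simps)
    finally show "R * adj I = R * I" .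
  qed (use I in auto)
  have WX: "W * adj X = adj X * W'"
  proof -
    have "adj (X * W) = adj (W' * X)" by (simp only: X(3))
    then have "adj W * adj X = adj X * adj W'" using X(1) W(1) W'(1) by (simp add: mat_simps)
    then have "e \<cdot>\<^sub>m (W * adj X) = e \<cdot>\<^sub>m (adj X * W')"
      unfolding W(2) W'(2) using X(1) W(1) W'(1) by (simp add: mat_simps)
    then have "e \<cdot>\<^sub>m (e \<cdot>\<^sub>m (W * adj X)) = e \<cdot>\<^sub>m (e \<cdot>\<^sub>m (adj X * W'))" by simp
    then show ?thesis by (simp add: mat_simps ee)
  qed
  have "W * B = B * W"
    unfolding B_def using X(1) W(1) W'(1) rewrite_prefix[OF WX W(1)] X(3) by (simp add: mat_simps)
  then have WT: "W * T = T * W" by (rule comm[OF W(1)])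
  have WR: "W * R = R * W" unfolding R_def using T(1) W(1) rewrite_prefix[OF WT W(1) T(1) T(1)] WT by (simp add: mat_simps)
  have IW: "I * W = W * I"
  proof (rule mult_left_cancel[OF R(1) _ _ R(3)])
    show "R * (I * W) = R * (W * I)"
      using R(1) I W(1) cancel[OF I(2) R(1) I(1)] rewrite_prefix[OF WR[symmetric] R(1) W(1) I(1)] by (simp add: mat_simps)
  qed (use I W in auto)
  define V where "V = X * I"
  have V: "V \<in> M" using X I by (simp add: V_def)
  have "adj V * V = I * ((adj X * X) * I)" unfolding V_def using X(1) I(1) adjI by (simp add: mat_simps)
  also have "\<dots> = 1\<^sub>m N" unfolding B_def[symmetric] R(4)[symmetric] using R(1) I cancel[OF I(3) I(1) R(1)] by (simp add: mat_simps)
  finally have VV: "adj V * V = 1\<^sub>m N" .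
  have VW: "V * W = W' * V"
    unfolding V_def using X(1) I(1) W(1) W'(1) IW rewrite_prefix[OF X(3) X(1) W(1) I(1)] by (simp add: mat_simps)
  have "F * V = conj_mat V * F" if F: "F \<in> M" "F * adj F = 1\<^sub>m N" "F * X = conj_mat X * F" for F
  proof -
    have F': "adj F * F = 1\<^sub>m N" by (rule right_inverse_imp_left[OF F(1) transpose_M[OF conj_M[OF F(1)]] F(2)])
    have "adj (F * X) = adj (conj_mat X * F)" by (simp only: F(3))
    then have "adj X * adj F = adj F * X\<^sup>T" using F(1) X(1) by (simp add: mat_simps)
    then have "F * (adj X * adj F) * F = F * (adj F * X\<^sup>T) * F" by simp
    then have FX: "F * adj X = X\<^sup>T * F" using F(1) X(1) F' cancel[OF F(2)] by (simp add: mat_simps)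
    have "F * B = conj_mat B * F"
      unfolding B_def using F(1,3) X(1) rewrite_prefix[OF FX F(1)] by (simp add: mat_simps)
    then have FT: "F * T = conj_mat T * F" by (rule real[OF F(1)])
    have FR: "F * R = conj_mat R * F" unfolding R_def
      using T(1) F(1) rewrite_prefix[OF FT F(1) T(1) T(1)] FT by (simp add: mat_simps)
    have "F * I = conj_mat I * F"
    proof (rule mult_left_cancel[of "conj_mat R"])
      have cI: "conj_mat R * conj_mat I = 1\<^sub>m N" using arg_cong[OF I(2), of conj_mat] R(1) I(1) by (simp add: mat_simps)
      show "conj_mat R * (F * I) = conj_mat R * (conj_mat I * F)"
        using R(1) I(1,2) F(1) cancel[OF cI] rewrite_prefix[OF FR[symmetric]] by (simp add: mat_simps)
    qed (use R I F in \<open>auto simp: det_conj\<close>)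
    then show ?thesis unfolding V_def
      using X(1) I(1) F(1) rewrite_prefix[OF F(3) F(1) X(1) I(1)] by (simp add: mat_simps)
  qed
  then show ?thesis using V VV VW by blast
qed

text \<open>The map that sends \<open>X\<close> to \<open>F\<^sup>-\<^sup>1 (conj_mat X) F\<close> is a conjugate-linear involution on the space of
intertwiners. Adding to \<open>z S\<close> its image makes it a fixed point, and a suitable \<open>z\<close> keeps it
invertible.\<close>

lemma twisted_averaging:
  assumes F: "F \<in> M" "conj_mat F = F" "F * F = h \<cdot>\<^sub>m 1\<^sub>m N" and h: "h = 1 \<or> h = -1"
    and S: "S \<in> M" "det S \<noteq> 0" "S * W = W' * S" and W: "W \<in> M" "F * W = conj_mat W * F"
    and W': "W' \<in> M" "F * W' = conj_mat W' * F"
  shows "\<exists>X\<in>M. det X \<noteq> 0 \<and> X * W = W' * X \<and> F * X = conj_mat X * F"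
proof -
  have hh: "h * h = 1" "cnj h = h" "\<And>a. a * h * h = a" using h by (auto simp: mult.assoc)
  \<comment> \<open>This is \<open>F\<^sup>-\<^sup>1 (conj_mat S) F\<close>, since \<open>F\<^sup>2 = h\<close>.\<close>
  define C where "C = h \<cdot>\<^sub>m (F * conj_mat S * F)"
  have C: "C \<in> M" using F S by (simp add: C_def)
  obtain z where z: "det (z \<cdot>\<^sub>m S + cnj z \<cdot>\<^sub>m C) \<noteq> 0" using invertible_combination[OF S(1,2) C] by auto
  define X where "X = z \<cdot>\<^sub>m S + cnj z \<cdot>\<^sub>m C"
  have X: "X \<in> M" using S C by (simp add: X_def)
  have FF: "F * (F * Y) = h \<cdot>\<^sub>m Y" if "Y \<in> M" for Y
    using rewrite_prefix[OF F(3) F(1) F(1) that] that by (simp add: mat_simps)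
  have cS: "conj_mat S * conj_mat W = conj_mat W' * conj_mat S"
    using arg_cong[OF S(3), of conj_mat] S(1) W(1) W'(1) by (simp add: mat_simps)
  have FcW: "F * conj_mat W' = W' * F"
    using arg_cong[OF W'(2), of conj_mat] F(1,2) W'(1) by (simp add: mat_simps)
  have "C * W = W' * C"
    unfolding C_def using F(1) S(1) W(1) W'(1) W(2) rewrite_prefix[OF cS] rewrite_prefix[OF FcW]
    by (simp add: mat_simps)
  then have XW: "X * W = W' * X"
    unfolding X_def using S W(1) W'(1) C by (simp add: add_mult mult_add mat_simps)
  have FC: "F * C = conj_mat S * F" unfolding C_def using F(1) S(1) by (simp add: mat_simps FF hh)
  have CF: "conj_mat C * F = F * S" unfolding C_def using F S(1) by (simp add: mat_simps FF hh)
  have "F * X = z \<cdot>\<^sub>m (F * S) + cnj z \<cdot>\<^sub>m (conj_mat S * F)"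
    unfolding X_def using F(1) S(1) C FC by (simp add: mult_add mat_simps)
  also have "\<dots> = cnj z \<cdot>\<^sub>m (conj_mat S * F) + z \<cdot>\<^sub>m (F * S)"
    using F(1) S(1) by (intro comm_add_mat[of _ N N]) auto
  also have "\<dots> = conj_mat X * F"
    unfolding X_def using F(1) S(1) C CF by (simp add: add_mult mat_simps)
  finally show ?thesis using X z XW by (intro bexI[of _ X]) (auto simp: X_def)
qed

text \<open>A skew-Hermitian matrix of square \<open>- 1\<close> becomes a Hermitian involution when it is multiplied by \<open>\<i>\<close>.\<close>

lemma involutions_similar:
  assumes W: "W \<in> M" "adj W = e \<cdot>\<^sub>m W" "W * W = e \<cdot>\<^sub>m 1\<^sub>m N"
    and W': "W' \<in> M" "adj W' = e \<cdot>\<^sub>m W'" "W' * W' = e \<cdot>\<^sub>m 1\<^sub>m N"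
    and e: "e = 1 \<or> e = -1" and tr: "mat_trace W = mat_trace W'"
  shows "\<exists>S\<in>M. det S \<noteq> 0 \<and> S * W = W' * S"
proof -
  \<comment> \<open>\<open>c\<close> is \<open>1\<close> in the Hermitian and \<open>\<i>\<close> in the skew-Hermitian case.\<close>
  obtain c where c: "c \<noteq> 0" "cnj c * e = c" "c * c * e = 1"
  proof (cases "e = 1")
    case True then show ?thesis using that[of 1] by simp
  next
    case False then show ?thesis using that[of \<i>] e by simp
  qed
  have c': "c * (c * e) = 1" using c(3) by (simp add: mult.assoc)
  have 1: "c \<cdot>\<^sub>m Y \<in> M \<and> adj (c \<cdot>\<^sub>m Y) = c \<cdot>\<^sub>m Y \<and> (c \<cdot>\<^sub>m Y) * (c \<cdot>\<^sub>m Y) = 1\<^sub>m N"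
    if Y: "Y \<in> M" "adj Y = e \<cdot>\<^sub>m Y" "Y * Y = e \<cdot>\<^sub>m 1\<^sub>m N" for Y
    using Y c c' by (simp add: mat_simps)
  have "mat_trace (c \<cdot>\<^sub>m W) = mat_trace (c \<cdot>\<^sub>m W')" using tr W(1) W'(1) by (simp add: mat_trace_smult[of _ N])
  then obtain S where S: "S \<in> M" "det S \<noteq> 0" "S * (c \<cdot>\<^sub>m W) = (c \<cdot>\<^sub>m W') * S"
    using hermitian_involutions_similar[of "c \<cdot>\<^sub>m W" "c \<cdot>\<^sub>m W'"] 1[OF W] 1[OF W'] by blast
  then have "c \<cdot>\<^sub>m (S * W) = c \<cdot>\<^sub>m (W' * S)" using W(1) W'(1) by (simp add: mat_simps)
  then have "(1 / c) \<cdot>\<^sub>m (c \<cdot>\<^sub>m (S * W)) = (1 / c) \<cdot>\<^sub>m (c \<cdot>\<^sub>m (W' * S))" by simp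
  then have "S * W = W' * S" using c(1) by (simp add: smult_smult smult_one)
  then show ?thesis using S by blast
qed

lemma congruence_from_unitary:
  assumes T: "T \<in> M" "adj T = T" "det T \<noteq> 0" and V: "V \<in> M" "adj V * V = 1\<^sub>m N" "V * W = W' * V"
    and W: "W \<in> M" "W' \<in> M" and S: "S = T * W * T"
  shows "V * T \<in> M" "det (V * T) \<noteq> 0" "adj (V * T) * W' * (V * T) = S"
proof -
  show "V * T \<in> M" using V T by simp
  have "det V \<noteq> 0" using det_M_mult[of "adj V" V] V by auto
  then show "det (V * T) \<noteq> 0" using V T by (simp add: det_M_mult)
  have "adj (V * T) * W' * (V * T) = T * (adj V * ((W' * V) * T))" using V(1) T(1,2) W by (simp add: mat_simps)
  also have "\<dots> = S" unfolding V(3)[symmetric] S using V(1) T(1) W cancel[OF V(2)] by (simp add: mat_simps)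
  finally show "adj (V * T) * W' * (V * T) = S" .
qed

theorem sesquilinear_normal_form:
  assumes T: "T \<in> M" "adj T = T" "det T \<noteq> 0" and S: "S = T * W * T"
    and W: "W \<in> M" "adj W = e \<cdot>\<^sub>m W" "W * W = e \<cdot>\<^sub>m 1\<^sub>m N"
    and W': "W' \<in> M" "adj W' = e \<cdot>\<^sub>m W'" "W' * W' = e \<cdot>\<^sub>m 1\<^sub>m N"
    and e: "e = 1 \<or> e = -1" and tr: "mat_trace W = mat_trace W'"
  shows "\<exists>Q\<in>M. det Q \<noteq> 0 \<and> adj Q * W' * Q = S"
proof -
  obtain X where X: "X \<in> M" "det X \<noteq> 0" "X * W = W' * X" using involutions_similar[OF W W' e tr] by blast
  obtain V where V: "V \<in> M" "adj V * V = 1\<^sub>m N" "V * W = W' * V"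
    using unitary_intertwiner[OF W(1,2) W'(1,2) e X] by blast
  show ?thesis using congruence_from_unitary[OF T V W(1) W'(1) S] by blast
qed

text \<open>Here \<open>W\<close> is unitary, so the inverse of its transpose is its conjugate.\<close>

lemma preserves_form_imp_twisted:
  assumes W: "W \<in> M" "adj W = e \<cdot>\<^sub>m W" "W * W = e \<cdot>\<^sub>m 1\<^sub>m N" and e: "e = 1 \<or> e = -1"
    and F: "F \<in> M" "isometry F W"
  shows "F * W = conj_mat W * F"
proof -
  have ee: "e * e = 1" "cnj e = e" using e by auto
  have "W * adj W = 1\<^sub>m N" unfolding W(2) using W(1,3) ee by (simp add: mat_simps)
  then have "conj_mat (W * adj W) = 1\<^sub>m N" by (simp add: mat_simps)
  then have c: "conj_mat W * W\<^sup>T = 1\<^sub>m N" using W(1) by (simp add: mat_simps)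
  have "conj_mat W * (W\<^sup>T * F * W) = F * W" using W(1) F(1) cancel[OF c] by (simp add: mat_simps)
  then show ?thesis unfolding F(2) by simp
qed

theorem sesquilinear_normal_form_isometry:
  assumes F: "F \<in> M" "conj_mat F = F" "F * F = h \<cdot>\<^sub>m 1\<^sub>m N" "F\<^sup>T = h \<cdot>\<^sub>m F" and h: "h = 1 \<or> h = -1"
    and T: "T \<in> M" "adj T = T" "det T \<noteq> 0" "isometry F T" and S: "S = T * W * T"
    and W: "W \<in> M" "adj W = e \<cdot>\<^sub>m W" "W * W = e \<cdot>\<^sub>m 1\<^sub>m N" and WF: "isometry F W"
    and W': "W' \<in> M" "adj W' = e \<cdot>\<^sub>m W'" "W' * W' = e \<cdot>\<^sub>m 1\<^sub>m N" and WF': "isometry F W'"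
    and e: "e = 1 \<or> e = -1" and tr: "mat_trace W = mat_trace W'"
  shows "\<exists>Q\<in>M. det Q \<noteq> 0 \<and> Q\<^sup>T * F * Q = F \<and> adj Q * W' * Q = S"
proof -
  have hh: "h * h = 1" using h by auto
  obtain Y where Y: "Y \<in> M" "det Y \<noteq> 0" "Y * W = W' * Y" using involutions_similar[OF W W' e tr] by blast
  obtain X where X: "X \<in> M" "det X \<noteq> 0" "X * W = W' * X" "F * X = conj_mat X * F"
    using twisted_averaging[OF F(1,2,3) h Y W(1) preserves_form_imp_twisted[OF W e F(1) WF]
        W'(1) preserves_form_imp_twisted[OF W' e F(1) WF']] by blast
  have FF: "F * adj F = 1\<^sub>m N" unfolding F(2) F(4) using F(1,3) hh by (simp add: mat_simps)
  obtain V where V: "V \<in> M" "adj V * V = 1\<^sub>m N" "V * W = W' * V" and FV: "F * V = conj_mat V * F"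
    using unitary_intertwiner[OF W(1,2) W'(1,2) e X(1-3)] F(1) FF X(4) by blast
  have "conj_mat (adj V * V) = 1\<^sub>m N" using V by (simp add: mat_simps)
  then have VcV: "V\<^sup>T * conj_mat V = 1\<^sub>m N" using V(1) by (simp add: mat_simps)
  have "V\<^sup>T * F * V = V\<^sup>T * (conj_mat V * F)" using V(1) F(1) FV by (simp add: mat_simps)
  also have "\<dots> = F" using V(1) F(1) cancel[OF VcV] by (simp add: mat_simps)
  finally have "isometry F V" .
  then have "(V * T)\<^sup>T * F * (V * T) = F" using V T F by (intro form_mult[of _ N]) auto
  then show ?thesis using congruence_from_unitary[OF T(1-3) V W(1) W'(1) S] by blast
qed

text \<open>The form makes \<open>W\<close> similar to its conjugate, which has the same trace as \<open>adj W = - W\<close>.\<close>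

lemma skew_trace_zero:
  assumes W: "W \<in> M" "adj W = - 1 \<cdot>\<^sub>m W" "W * W = - 1 \<cdot>\<^sub>m 1\<^sub>m N"
    and F: "F \<in> M" "det F \<noteq> 0" "isometry F W"
  shows "mat_trace W = 0"
proof -
  have FW: "F * W = conj_mat W * F" by (rule preserves_form_imp_twisted[OF W _ F(1,3)]) simp
  obtain I where I: "I \<in> M" "F * I = 1\<^sub>m N" "I * F = 1\<^sub>m N" using inverse_exists[OF F(1,2)] by metis
  have "mat_trace W = mat_trace (I * (F * W))" using W F I by (simp add: cancel)
  also have "\<dots> = mat_trace ((F * W) * I)" by (rule mat_trace_mult_comm[of _ N]) (use W F I in auto)
  also have "(F * W) * I = conj_mat W" unfolding FW using W(1) F(1) I by (simp add: mat_simps)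
  also have "mat_trace (conj_mat W) = mat_trace (adj W)" using W(1) by (simp add: mat_trace_def)
  also have "\<dots> = - mat_trace W" unfolding W(2) using W(1) by (simp add: mat_trace_smult[of _ N])
  finally show ?thesis by simp
qed

subsection \<open>Isometries of alternating forms have determinant one\<close>

text \<open>The identity \<open>A\<^sup>T F (A + 1) = (A + 1)\<^sup>T F\<close> has the determinant of \<open>A\<close> as the only factor in which the two
sides differ.\<close>

lemma det_isometry_if_no_eigenvalue_minus_one:
  assumes A: "A \<in> M" "isometry F A" and F: "F \<in> M" "det F \<noteq> 0" and d: "det (A + 1\<^sub>m N) \<noteq> 0"
  shows "det A = 1"
proof -
  have "A\<^sup>T * (F * (A + 1\<^sub>m N)) = (A + 1\<^sub>m N)\<^sup>T * F"
  proof -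
    have "A\<^sup>T * (F * (A + 1\<^sub>m N)) = A\<^sup>T * F * A + A\<^sup>T * F" using A(1) F(1) by (simp add: mult_add mat_simps)
    also have "\<dots> = F + A\<^sup>T * F" unfolding A(2) ..
    also have "\<dots> = A\<^sup>T * F + F" by (rule comm_add_mat[of _ N N]) (use A F in auto)
    also have "\<dots> = (A + 1\<^sub>m N)\<^sup>T * F" using A(1) F(1) by (simp add: add_mult mat_simps)
    finally show ?thesis .
  qed
  then have "det (A\<^sup>T * (F * (A + 1\<^sub>m N))) = det ((A + 1\<^sub>m N)\<^sup>T * F)" by simp
  then have "det A * (det F * det (A + 1\<^sub>m N)) = det (A + 1\<^sub>m N) * det F"
    by (simp only: det_M_mult mult_M transpose_M add_M one_M A(1) F(1) det_transpose[OF A(1)] det_transpose[OF add_M[OF A(1) one_M]])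
  then show ?thesis using F(2) d by simp
qed

lemma common_nonvanishing_vector:
  fixes x y :: "complex vec"
  assumes x: "x \<in> carrier_vec N" "x \<noteq> 0\<^sub>v N" and y: "y \<in> carrier_vec N" "y \<noteq> 0\<^sub>v N"
  shows "\<exists>v\<in>carrier_vec N. x \<bullet> v \<noteq> 0 \<and> y \<bullet> v \<noteq> 0"
proof -
  obtain i where i: "i < N" "x $ i \<noteq> 0" using x by (auto simp: vec_eq_iff)
  obtain j where j: "j < N" "y $ j \<noteq> 0" using y by (auto simp: vec_eq_iff)
  have e: "x \<bullet> unit_vec N k = x $ k" "y \<bullet> unit_vec N k = y $ k" if "k < N" for k using that x y by auto
  have s: "x \<bullet> (unit_vec N i + unit_vec N j) = x $ i + x $ j" "y \<bullet> (unit_vec N i + unit_vec N j) = y $ i + y $ j"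
    using x y i j by (simp_all add: scalar_prod_add_distrib[of _ N] e)
  consider "y $ i \<noteq> 0" | "x $ j \<noteq> 0" | "y $ i = 0" "x $ j = 0" by blast
  then show ?thesis
  proof cases
    case 1 then show ?thesis using i e by (intro bexI[of _ "unit_vec N i"]) auto
  next
    case 2 then show ?thesis using j e by (intro bexI[of _ "unit_vec N j"]) auto
  next
    case 3 then show ?thesis using i j s by (intro bexI[of _ "unit_vec N i + unit_vec N j"]) auto
  qed
qed

lemma scalar_prod_mult_vec:
  assumes "B \<in> M" "x \<in> carrier_vec N" "y \<in> carrier_vec N"
  shows "x \<bullet> (B *\<^sub>v y) = (B\<^sup>T *\<^sub>v x) \<bullet> y"
  using transpose_vec_mult_scalar[OF assms(1,3,2)] by simp

context
  fixes F assumes F: "F \<in> M" "F\<^sup>T = - F" "det F \<noteq> 0"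
begin

text \<open>The map \<open>w \<mapsto> w + (v\<^sup>T F w) v\<close>.\<close>

definition transvection :: "complex vec \<Rightarrow> complex mat" where
  "transvection v = 1\<^sub>m N + mat N N (\<lambda>(i,j). v $ i * (F\<^sup>T *\<^sub>v v) $ j)"

lemma transvection_M: "transvection v \<in> M" by (simp add: transvection_def)

lemma transvection_act:
  assumes "v \<in> carrier_vec N" "w \<in> carrier_vec N"
  shows "transvection v *\<^sub>v w = w + ((F\<^sup>T *\<^sub>v v) \<bullet> w) \<cdot>\<^sub>v v"
proof -
  have "mat N N (\<lambda>(i,j). v $ i * (F\<^sup>T *\<^sub>v v) $ j) *\<^sub>v w = ((F\<^sup>T *\<^sub>v v) \<bullet> w) \<cdot>\<^sub>v v"
  proof (rule eq_vecI)
    fix i assume "i < dim_vec (((F\<^sup>T *\<^sub>v v) \<bullet> w) \<cdot>\<^sub>v v)"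
    then have i: "i < N" using assms by simp
    have "(mat N N (\<lambda>(i,j). v $ i * (F\<^sup>T *\<^sub>v v) $ j) *\<^sub>v w) $ i = (\<Sum>j<N. v $ i * (F\<^sup>T *\<^sub>v v) $ j * w $ j)"
      using i assms by (subst mult_vec_entry) (auto simp del: index_mult_mat_vec)
    also have "\<dots> = v $ i * ((F\<^sup>T *\<^sub>v v) \<bullet> w)"
      using assms by (simp add: scalar_prod_def lessThan_atLeast0 sum_distrib_left mult.assoc del: index_mult_mat_vec)
    finally show "(mat N N (\<lambda>(i,j). v $ i * (F\<^sup>T *\<^sub>v v) $ j) *\<^sub>v w) $ i = (((F\<^sup>T *\<^sub>v v) \<bullet> w) \<cdot>\<^sub>v v) $ i"
      using i assms by (simp del: index_mult_mat_vec)
  qed (use assms in auto)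
  then show ?thesis unfolding transvection_def using assms by (simp add: add_mult_distrib_mat_vec[of _ N N])
qed

lemma alternating: assumes v: "v \<in> carrier_vec N" shows "(F\<^sup>T *\<^sub>v v) \<bullet> v = 0"
proof -
  have "(F\<^sup>T *\<^sub>v v) \<bullet> v = v \<bullet> (F *\<^sub>v v)" using scalar_prod_mult_vec[OF F(1) v v] by simp
  also have "\<dots> = (F *\<^sub>v v) \<bullet> v" using F v by (intro comm_scalar_prod[of _ N]) auto
  also have "\<dots> = - ((F\<^sup>T *\<^sub>v v) \<bullet> v)"
  proof -
    have "F\<^sup>T *\<^sub>v v = - (F *\<^sub>v v)" unfolding F(2) using F v by simp
    then show ?thesis using F v by simp
  qed
  finally show ?thesis by simp
qed

text \<open>The correction terms cancel because the form is alternating.\<close>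

lemma transvection_isometry:
  assumes v: "v \<in> carrier_vec N" shows "(transvection v)\<^sup>T * F * transvection v = F"
proof (rule mat_eq_by_action[of _ N])
  let ?T = "transvection v" and ?g = "F\<^sup>T *\<^sub>v v"
  have T: "?T \<in> M" by (rule transvection_M)
  show "?T\<^sup>T * F * ?T \<in> M" "F \<in> M" using T F by auto
  fix w :: "complex vec" assume w: "w \<in> carrier_vec N"
  have g: "?g \<in> carrier_vec N" using F v by simp
  have Fv: "F *\<^sub>v v = - ?g" unfolding F(2) using F v by (intro eq_vecI) auto
  have key: "x \<bullet> (?T\<^sup>T *\<^sub>v (F *\<^sub>v (?T *\<^sub>v w))) = x \<bullet> (F *\<^sub>v w)" if x: "x \<in> carrier_vec N" for x
  proof -
    have Tw: "?T *\<^sub>v w \<in> carrier_vec N" using T w by simp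
    have "x \<bullet> (?T\<^sup>T *\<^sub>v (F *\<^sub>v (?T *\<^sub>v w))) = (?T *\<^sub>v x) \<bullet> (F *\<^sub>v (?T *\<^sub>v w))"
      using scalar_prod_mult_vec[of "?T\<^sup>T" x "F *\<^sub>v (?T *\<^sub>v w)"] T F Tw x by simp
    also have "(?T *\<^sub>v x) \<bullet> (F *\<^sub>v (?T *\<^sub>v w)) = (x + (?g \<bullet> x) \<cdot>\<^sub>v v) \<bullet> (F *\<^sub>v w + (?g \<bullet> w) \<cdot>\<^sub>v (F *\<^sub>v v))"
    proof -
      have "F *\<^sub>v (?T *\<^sub>v w) = F *\<^sub>v w + (?g \<bullet> w) \<cdot>\<^sub>v (F *\<^sub>v v)"
      unfolding transvection_act[OF v w] using F v w by (simp add: mult_add_distrib_mat_vec[of _ N N] mult_mat_vec[of _ N N])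
      moreover have "?T *\<^sub>v x = x + (?g \<bullet> x) \<cdot>\<^sub>v v" by (rule transvection_act[OF v x])
      ultimately show ?thesis by (simp only:)
    qed
    also have "(x + (?g \<bullet> x) \<cdot>\<^sub>v v) \<bullet> (F *\<^sub>v w + (?g \<bullet> w) \<cdot>\<^sub>v (F *\<^sub>v v))
      = x \<bullet> (F *\<^sub>v w) + (?g \<bullet> w) * (x \<bullet> (F *\<^sub>v v)) + (?g \<bullet> x) * (v \<bullet> (F *\<^sub>v w)) + (?g \<bullet> x) * ((?g \<bullet> w) * (v \<bullet> (F *\<^sub>v v)))"
    proof -
      define a where "a = F *\<^sub>v w"
      define b where "b = F *\<^sub>v v"
      have "a \<in> carrier_vec N" "b \<in> carrier_vec N" using F v w by (auto simp: a_def b_def)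
      then show ?thesis unfolding a_def[symmetric] b_def[symmetric] using v x
        by (simp add: add_scalar_prod_distrib[of _ N] scalar_prod_add_distrib[of _ N] algebra_simps)
    qed
    also have "\<dots> = x \<bullet> (F *\<^sub>v w)"
    proof -
      have "v \<bullet> (F *\<^sub>v w) = ?g \<bullet> w" by (rule scalar_prod_mult_vec[OF F(1) v w])
      moreover have "v \<bullet> (F *\<^sub>v v) = 0" using scalar_prod_mult_vec[OF F(1) v v] alternating[OF v] by simp
      moreover have "x \<bullet> (F *\<^sub>v v) = - (?g \<bullet> x)" unfolding Fv using F(1) v x comm_scalar_prod[OF g x] by simp
      ultimately show ?thesis by (simp only:) (simp add: algebra_simps)
    qed
    finally show ?thesis .
  qed
  have "(?T\<^sup>T * F * ?T) *\<^sub>v w = ?T\<^sup>T *\<^sub>v (F *\<^sub>v (?T *\<^sub>v w))"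
    using T F w by (simp add: assoc_mult_mat_vec[of _ N N _ N] mult_M)
  also have "\<dots> = F *\<^sub>v w"
  proof (rule eq_vecI)
    fix i assume "i < dim_vec (F *\<^sub>v w)"
    then have i: "i < N" using F by simp
    show "(?T\<^sup>T *\<^sub>v (F *\<^sub>v (?T *\<^sub>v w))) $ i = (F *\<^sub>v w) $ i"
      using key[of "unit_vec N i"] i T F w by (simp add: scalar_prod_left_unit[of _ N] mult_vec_M del: index_mult_mat_vec)
  qed (use T F in auto)
  finally show "(?T\<^sup>T * F * ?T) *\<^sub>v w = F *\<^sub>v w" .
qed

lemma det_transvection:
  assumes v: "v \<in> carrier_vec N" shows "det (transvection v) = 1"
proof (rule det_isometry_if_no_eigenvalue_minus_one[OF transvection_M transvection_isometry[OF v] F(1,3)])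
  let ?T = "transvection v" and ?g = "F\<^sup>T *\<^sub>v v"
  have T: "?T \<in> M" by (rule transvection_M)
  have g: "?g \<in> carrier_vec N" using F v by simp
  show "det (?T + 1\<^sub>m N) \<noteq> 0"
  proof
    assume "det (?T + 1\<^sub>m N) = 0"
    then obtain w where w: "w \<in> carrier_vec N" "w \<noteq> 0\<^sub>v N" "(?T + 1\<^sub>m N) *\<^sub>v w = 0\<^sub>v N"
      using det_0_iff_vec_prod_zero[of "?T + 1\<^sub>m N" N] T by auto
    have e: "(w + (?g \<bullet> w) \<cdot>\<^sub>v v) + w = 0\<^sub>v N"
      using w T transvection_act[OF v w(1)] by (simp add: add_mult_distrib_mat_vec[of _ N N])
    have "?g \<bullet> ((w + (?g \<bullet> w) \<cdot>\<^sub>v v) + w) = (?g \<bullet> w + (?g \<bullet> w) * (?g \<bullet> v)) + ?g \<bullet> w"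
      using g v w by (simp add: scalar_prod_add_distrib[of _ N])
    then have "?g \<bullet> w = 0" unfolding e using g alternating[OF v] by simp
    then have "w $ i = 0" if "i < N" for i
      using arg_cong[OF e, of "\<lambda>x. x $ i"] v w(1) that by simp
    then have "w = 0\<^sub>v N" using w(1) by (intro eq_vecI) auto
    then show False using w by simp
  qed
qed

text \<open>If \<open>A + 1\<close> is invertible, the determinant is one. Otherwise multiply \<open>A\<close> by the transvection of a vector
\<open>v\<close>: this changes \<open>A + 1\<close> by a matrix of rank one with image spanned by \<open>A v\<close>. If \<open>v\<close> pairs nontrivially
with a vector \<open>u\<close> of the kernel of \<open>A + 1\<close> and with a vector \<open>x\<close> of its left kernel, the image is not in
the range of \<open>A + 1\<close>, the new kernel is contained in the old one, and it misses \<open>u\<close>. So the dimension of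
the kernel drops, while transvections have determinant one.\<close>

theorem det_isometry_alternating:
  assumes A: "A \<in> M" "isometry F A"
  shows "det A = 1"
  using A
proof (induction "subspace_dim N (kernel N (A + 1\<^sub>m N))" arbitrary: A rule: less_induct)
  case less
  show ?case
  proof (cases "det (A + 1\<^sub>m N) = 0")
    case False
    then show ?thesis using det_isometry_if_no_eigenvalue_minus_one[OF less.prems F(1,3)] by simp
  next
    case True
    have A1: "A + 1\<^sub>m N \<in> M" using less.prems by simp
    obtain u where u: "u \<in> carrier_vec N" "u \<noteq> 0\<^sub>v N" "(A + 1\<^sub>m N) *\<^sub>v u = 0\<^sub>v N"
      using det_0_iff_vec_prod_zero[OF A1] True by auto
    have "det ((A + 1\<^sub>m N)\<^sup>T) = 0" using det_transpose[OF A1] True by simp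
    then obtain x where x: "x \<in> carrier_vec N" "x \<noteq> 0\<^sub>v N" "(A + 1\<^sub>m N)\<^sup>T *\<^sub>v x = 0\<^sub>v N"
      using det_0_iff_vec_prod_zero[of "(A + 1\<^sub>m N)\<^sup>T" N] A1 by auto
    have Fu: "F *\<^sub>v u \<in> carrier_vec N" "F *\<^sub>v u \<noteq> 0\<^sub>v N"
      using F u det_0_iff_vec_prod_zero[OF F(1)] by auto
    obtain v where v: "v \<in> carrier_vec N" "x \<bullet> v \<noteq> 0" "(F *\<^sub>v u) \<bullet> v \<noteq> 0"
      using common_nonvanishing_vector[OF x(1,2) Fu] by auto
    let ?T = "transvection v" and ?g = "F\<^sup>T *\<^sub>v v"
    have T: "?T \<in> M" by (rule transvection_M)
    have g: "?g \<in> carrier_vec N" using F v by simp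
    have gu: "?g \<bullet> u \<noteq> 0"
    proof -
      have "?g \<bullet> u = v \<bullet> (F *\<^sub>v u)" using scalar_prod_mult_vec[OF F(1) v(1) u(1)] by simp
      also have "\<dots> = (F *\<^sub>v u) \<bullet> v" using Fu v(1) by (intro comm_scalar_prod[of _ N]) auto
      finally show ?thesis using v(3) by simp
    qed
    let ?y = "A *\<^sub>v v"
    have y: "?y \<in> carrier_vec N" using less.prems v by simp
    have xA: "x \<bullet> ((A + 1\<^sub>m N) *\<^sub>v w) = 0" if "w \<in> carrier_vec N" for w
      using scalar_prod_mult_vec[OF A1 x(1) that] x(3) that by simp
    have xy: "x \<bullet> ?y \<noteq> 0"
    proof -
      have "(A + 1\<^sub>m N) *\<^sub>v v = ?y + v" using less.prems v by (simp add: add_mult_distrib_mat_vec[of _ N N])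
      then have "x \<bullet> ?y + x \<bullet> v = 0" using xA[OF v(1)] x(1) y v(1) by (simp add: scalar_prod_add_distrib[of _ N])
      then show ?thesis using v(2) by auto
    qed
    define A' where "A' = A * ?T"
    have A': "A' \<in> M" using less.prems T by (simp add: A'_def)
    have iso: "isometry F A'" unfolding A'_def
      using less.prems T F transvection_isometry[OF v(1)] by (intro form_mult[of _ N]) auto
    have act: "(A' + 1\<^sub>m N) *\<^sub>v w = (A + 1\<^sub>m N) *\<^sub>v w + (?g \<bullet> w) \<cdot>\<^sub>v ?y" if w: "w \<in> carrier_vec N" for w
    proof -
      have "A' *\<^sub>v w = A *\<^sub>v w + (?g \<bullet> w) \<cdot>\<^sub>v ?y"
        unfolding A'_def using less.prems T w v(1)
        by (simp add: assoc_mult_mat_vec[of _ N N _ N] transvection_act mult_add_distrib_mat_vec[of _ N N] mult_mat_vec[of _ N N])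
      then show ?thesis using A' less.prems w y
        by (simp add: add_mult_distrib_mat_vec[of _ N N]) (intro eq_vecI, auto simp del: index_mult_mat_vec)
    qed
    have "kernel N (A' + 1\<^sub>m N) \<subseteq> kernel N (A + 1\<^sub>m N)"
    proof
      fix w assume "w \<in> kernel N (A' + 1\<^sub>m N)"
      then have w: "w \<in> carrier_vec N" "(A + 1\<^sub>m N) *\<^sub>v w + (?g \<bullet> w) \<cdot>\<^sub>v ?y = 0\<^sub>v N"
        using act by (auto simp: kernel_def)
      have Aw: "(A + 1\<^sub>m N) *\<^sub>v w \<in> carrier_vec N" by (rule mult_vec_M[OF A1 w(1)])
      have "x \<bullet> ((A + 1\<^sub>m N) *\<^sub>v w + (?g \<bullet> w) \<cdot>\<^sub>v ?y) = (?g \<bullet> w) * (x \<bullet> ?y)"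
        using xA[OF w(1)] x(1) y Aw by (simp add: scalar_prod_add_distrib[of _ N])
      then have "?g \<bullet> w = 0" unfolding w(2) using x(1) xy by simp
      moreover have "0 \<cdot>\<^sub>v ?y = 0\<^sub>v N" using less.prems(1) v(1) by (intro eq_vecI) auto
      ultimately have "(A + 1\<^sub>m N) *\<^sub>v w = 0\<^sub>v N" using w(2) Aw by simp
      then show "w \<in> kernel N (A + 1\<^sub>m N)" using w(1) by (simp add: kernel_def)
    qed
    moreover have "u \<in> kernel N (A + 1\<^sub>m N)" using u by (simp add: kernel_def)
    moreover have "u \<notin> kernel N (A' + 1\<^sub>m N)"
    proof
      assume "u \<in> kernel N (A' + 1\<^sub>m N)"
      then have "0\<^sub>v N + (?g \<bullet> u) \<cdot>\<^sub>v ?y = 0\<^sub>v N" using act[OF u(1)] u(3) by (simp add: kernel_def)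
      then have "(?g \<bullet> u) \<cdot>\<^sub>v ?y = 0\<^sub>v N" using y by simp
      then have "x \<bullet> ((?g \<bullet> u) \<cdot>\<^sub>v ?y) = 0" using x(1) by simp
      then show False using gu xy x(1) y by simp
    qed
    ultimately have "kernel N (A' + 1\<^sub>m N) \<subset> kernel N (A + 1\<^sub>m N)" by blast
    then have "subspace_dim N (kernel N (A' + 1\<^sub>m N)) < subspace_dim N (kernel N (A + 1\<^sub>m N))"
      using A' A1 by (intro subspace_dim_strict_mono linear_subspace_kernel) auto
    then have "det A' = 1" using less.hyps[of A'] A' iso by blast
    then show ?thesis using det_M_mult[OF less.prems(1) T] det_transvection[OF v(1)] by (simp add: A'_def)
  qed
qed

end

end

section \<open>Trace functions on the character variety\<close>

lemma irreducible_rep_imp_mats: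
  assumes "irreducible_rep \<Gamma> N \<rho>"
  shows "irreducible_mats N (\<rho> ` carrier \<Gamma>)"
  unfolding irreducible_mats_def
proof (intro allI impI)
  fix W assume W: "linear_subspace N W" and inv: "\<forall>A\<in>\<rho> ` carrier \<Gamma>. \<forall>w\<in>W. A *\<^sub>v w \<in> W"
  have "submodule class_ring W (module_vec TYPE(complex) N)"
    using W vec_module by (auto simp: submodule_def linear_subspace_def module_vec_simps)
  then have "VectorSpace.subspace class_ring W (module_vec TYPE(complex) N)"
    using vec_vs by (auto simp: VectorSpace.subspace_def)
  then show "W = {0\<^sub>v N} \<or> W = carrier_vec N"
    using assms inv unfolding irreducible_rep_def by auto
qed

lemma mat_trace_conj: "mat_trace (conj_mat A) = cnj (mat_trace A)" if "A \<in> carrier_mat N N"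
  using that by (simp add: mat_trace_def)

lemma mat_trace_transpose: "mat_trace (A\<^sup>T) = mat_trace A" if "A \<in> carrier_mat N N"
  using that by (simp add: mat_trace_def)

lemma cgroup_carrier_GL: "A \<in> carrier (cgroup F n) \<Longrightarrow> A \<in> carrier (GL (mat_size F n))"
  using subgroup.subset[OF subgroup_cgroup] by (auto simp: cgroup_def)

lemma cgroup_ops: "monoid.mult (cgroup F n) = (*)" "monoid.one (cgroup F n) = 1\<^sub>m (mat_size F n)"
  by (simp_all add: cgroup_def GL_ops)

lemma cgroup_inv: "A \<in> carrier (cgroup F n) \<Longrightarrow> inv\<^bsub>cgroup F n\<^esub> A = inv\<^bsub>GL (mat_size F n)\<^esub> A"
  using group.m_inv_consistent[OF group_GL subgroup_cgroup] by (auto simp: cgroup_def)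

lemma hom_cgroup:
  assumes \<Gamma>: "group \<Gamma>" and h: "\<rho> \<in> hom \<Gamma> (cgroup F n)"
  shows "\<rho> \<one>\<^bsub>\<Gamma>\<^esub> = 1\<^sub>m (mat_size F n)"
    "\<gamma> \<in> carrier \<Gamma> \<Longrightarrow> \<rho> (inv\<^bsub>\<Gamma>\<^esub> \<gamma>) = inv\<^bsub>GL (mat_size F n)\<^esub> (\<rho> \<gamma>)"
    "\<gamma> \<in> carrier \<Gamma> \<Longrightarrow> \<rho> \<gamma> \<in> carrier (GL (mat_size F n))"
    "\<gamma> \<in> carrier \<Gamma> \<Longrightarrow> \<delta> \<in> carrier \<Gamma> \<Longrightarrow> \<rho> (\<gamma> \<otimes>\<^bsub>\<Gamma>\<^esub> \<delta>) = \<rho> \<gamma> * \<rho> \<delta>"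
proof -
  interpret group_hom \<Gamma> "cgroup F n" \<rho>
    using \<Gamma> h group_cgroup by (auto simp: group_hom_def group_hom_axioms_def)
  show "\<rho> \<one>\<^bsub>\<Gamma>\<^esub> = 1\<^sub>m (mat_size F n)" using hom_one by (simp add: cgroup_ops)
  show "\<gamma> \<in> carrier \<Gamma> \<Longrightarrow> \<rho> (inv\<^bsub>\<Gamma>\<^esub> \<gamma>) = inv\<^bsub>GL (mat_size F n)\<^esub> (\<rho> \<gamma>)"
    using hom_inv cgroup_inv[OF hom_closed] by simp
  show "\<gamma> \<in> carrier \<Gamma> \<Longrightarrow> \<rho> \<gamma> \<in> carrier (GL (mat_size F n))"
    using cgroup_carrier_GL[OF hom_closed] .
  show "\<gamma> \<in> carrier \<Gamma> \<Longrightarrow> \<delta> \<in> carrier \<Gamma> \<Longrightarrow> \<rho> (\<gamma> \<otimes>\<^bsub>\<Gamma>\<^esub> \<delta>) = \<rho> \<gamma> * \<rho> \<delta>"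
    using hom_mult by (simp add: cgroup_ops)
qed

lemma rf_sum_products:
  assumes "finite A" "\<And>a. a \<in> A \<Longrightarrow> (\<lambda>\<rho>\<in>hom \<Gamma> G. f a \<rho>) \<in> regular_functions \<Gamma> S N G"
    "\<And>a. a \<in> A \<Longrightarrow> (\<lambda>\<rho>\<in>hom \<Gamma> G. g a \<rho>) \<in> regular_functions \<Gamma> S N G"
  shows "(\<lambda>\<rho>\<in>hom \<Gamma> G. \<Sum>a\<in>A. f a \<rho> * g a \<rho>) \<in> regular_functions \<Gamma> S N G"
  using assms by (intro rf_sum rf_times) auto

text \<open>Regular functions are generated by the entries at the generators. The entries of \<open>\<rho> s\<^sup>-\<^sup>1\<close> are obtained by
pulling back those of \<open>\<rho> s\<close> along the inverse adjoint.\<close>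

lemma entry_regular:
  assumes \<Gamma>: "group \<Gamma>" and S: "S \<subseteq> carrier \<Gamma>"
    and \<gamma>: "\<gamma> \<in> generate \<Gamma> S" and ij: "i < mat_size F n" "j < mat_size F n"
  shows "(\<lambda>\<rho>\<in>hom \<Gamma> (cgroup F n). \<rho> \<gamma> $$ (i,j)) \<in> regular_functions \<Gamma> S (mat_size F n) (cgroup F n)"
  using \<gamma> ij
proof (induction arbitrary: i j rule: generate.induct)
  case one
  have "(\<lambda>\<rho>\<in>hom \<Gamma> (cgroup F n). \<rho> \<one>\<^bsub>\<Gamma>\<^esub> $$ (i,j)) = (\<lambda>\<rho>\<in>hom \<Gamma> (cgroup F n). 1\<^sub>m (mat_size F n) $$ (i,j))"
    by (intro restrict_ext) (simp only: hom_cgroup(1)[OF \<Gamma>])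
  then show ?case using rf_const by (simp only:)
next
  case (incl s) then show ?case by (intro rf_entry)
next
  case (inv s)
  let ?\<theta> = "\<lambda>A. inv\<^bsub>GL (mat_size F n)\<^esub> ((conj_mat A)\<^sup>T)"
  have th: "?\<theta> \<in> involutions (mat_size F n)" by (simp add: involutions_def)
  have s: "s \<in> carrier \<Gamma>" using inv S by auto
  let ?f = "\<lambda>\<rho>\<in>hom \<Gamma> (cgroup F n). \<rho> s $$ (j,i)"
  have "?f \<in> regular_functions \<Gamma> S (mat_size F n) (cgroup F n)" using inv by (intro rf_entry)
  then have "theta_pullback \<Gamma> (cgroup F n) ?\<theta> ?f \<in> regular_functions \<Gamma> S (mat_size F n) (cgroup F n)"
    by (rule rf_theta_pullback[OF S th])
  moreover have "theta_pullback \<Gamma> (cgroup F n) ?\<theta> ?f = (\<lambda>\<rho>\<in>hom \<Gamma> (cgroup F n). \<rho> (inv\<^bsub>\<Gamma>\<^esub> s) $$ (i,j))"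
    unfolding theta_pullback_def
  proof (rule restrict_ext)
    fix \<rho> assume r: "\<rho> \<in> hom \<Gamma> (cgroup F n)"
    have "?\<theta> \<circ> \<rho> \<in> hom \<Gamma> (cgroup F n)" by (rule hom_comp_rep[OF r theta_hom[OF th]])
    then show "cnj (?f (?\<theta> \<circ> \<rho>)) = \<rho> (inv\<^bsub>\<Gamma>\<^esub> s) $$ (i,j)"
      using GL_inv(1)[OF hom_cgroup(3)[OF \<Gamma> r s]] inv.prems
      by (simp add: theta_eq[OF hom_cgroup(3)[OF \<Gamma> r s]] hom_cgroup(2)[OF \<Gamma> r s])
  qed
  ultimately show ?case by (simp only:)
next
  case (eng h1 h2)
  have c: "h1 \<in> carrier \<Gamma>" "h2 \<in> carrier \<Gamma>"
    using eng.hyps group.generate_incl[OF \<Gamma> S] by auto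
  have "(\<lambda>\<rho>\<in>hom \<Gamma> (cgroup F n). \<rho> (h1 \<otimes>\<^bsub>\<Gamma>\<^esub> h2) $$ (i,j))
    = (\<lambda>\<rho>\<in>hom \<Gamma> (cgroup F n). \<Sum>k<mat_size F n. \<rho> h1 $$ (i,k) * \<rho> h2 $$ (k,j))"
  proof (rule restrict_ext)
    fix \<rho> assume r: "\<rho> \<in> hom \<Gamma> (cgroup F n)"
    have "\<rho> h1 \<in> carrier_mat (mat_size F n) (mat_size F n)" "\<rho> h2 \<in> carrier_mat (mat_size F n) (mat_size F n)"
      using hom_cgroup(3)[OF \<Gamma> r c(1)] hom_cgroup(3)[OF \<Gamma> r c(2)] by (auto simp: GL_carrier)
    then show "\<rho> (h1 \<otimes>\<^bsub>\<Gamma>\<^esub> h2) $$ (i,j) = (\<Sum>k<mat_size F n. \<rho> h1 $$ (i,k) * \<rho> h2 $$ (k,j))"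
      using eng.prems by (simp add: hom_cgroup(4)[OF \<Gamma> r c] square_mats.mult_entry[of _ "mat_size F n"] del: index_mult_mat)
  qed
  also have "\<dots> \<in> regular_functions \<Gamma> S (mat_size F n) (cgroup F n)"
    by (intro rf_sum_products eng.IH finite_lessThan) (use eng.prems in auto)
  finally show ?case .
qed

lemma trace_invariant:
  assumes \<Gamma>: "group \<Gamma>" and S: "S \<subseteq> carrier \<Gamma>" "generate \<Gamma> S = carrier \<Gamma>" and \<gamma>: "\<gamma> \<in> carrier \<Gamma>"
  shows "(\<lambda>\<rho>\<in>hom \<Gamma> (cgroup F n). mat_trace (\<rho> \<gamma>)) \<in> invariant_functions \<Gamma> S (mat_size F n) (cgroup F n)"
proof -
  let ?N = "mat_size F n"
  let ?t = "\<lambda>\<rho>\<in>hom \<Gamma> (cgroup F n). mat_trace (\<rho> \<gamma>)"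
  have c: "\<rho> \<gamma> \<in> carrier_mat ?N ?N" if "\<rho> \<in> hom \<Gamma> (cgroup F n)" for \<rho>
    using hom_cgroup(3)[OF \<Gamma> that \<gamma>] by (simp add: GL_carrier)
  have "?t = (\<lambda>\<rho>\<in>hom \<Gamma> (cgroup F n). \<Sum>i<?N. \<rho> \<gamma> $$ (i,i))"
  proof (rule restrict_ext)
    fix \<rho> assume r: "\<rho> \<in> hom \<Gamma> (cgroup F n)"
    show "mat_trace (\<rho> \<gamma>) = (\<Sum>i<?N. \<rho> \<gamma> $$ (i,i))" using c[OF r] by (simp add: mat_trace_def)
  qed
  also have "\<dots> \<in> regular_functions \<Gamma> S ?N (cgroup F n)"
    using \<gamma> S by (intro rf_sum entry_regular[OF \<Gamma> S(1)]) auto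
  finally have reg: "?t \<in> regular_functions \<Gamma> S ?N (cgroup F n)" .
  have "?t (conj_rep (cgroup F n) g \<rho>) = ?t \<rho>"
    if r: "\<rho> \<in> hom \<Gamma> (cgroup F n)" and g: "g \<in> carrier (cgroup F n)" for \<rho> g
  proof -
    have h: "conj_rep (cgroup F n) g \<rho> \<in> hom \<Gamma> (cgroup F n)" by (rule conj_rep_hom[OF group_cgroup r g])
    have gG: "g \<in> carrier (GL ?N)" by (rule cgroup_carrier_GL[OF g])
    note i = GL_inv[OF gG]
    have gc: "g \<in> carrier_mat ?N ?N" using gG by (simp add: GL_carrier)
    let ?h = "inv\<^bsub>GL ?N\<^esub> g"
    have "mat_trace (g * \<rho> \<gamma> * ?h) = mat_trace (?h * (g * \<rho> \<gamma>))"
      by (rule mat_trace_mult_comm[of _ ?N]) (use gc c[OF r] i in auto)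
    also have "?h * (g * \<rho> \<gamma>) = \<rho> \<gamma>"
      by (rule square_mats.cancel[OF i(4) i(1) gc c[OF r]])
    finally show ?thesis using r h by (simp add: conj_rep_def cgroup_ops cgroup_inv[OF g])
  qed
  then show ?thesis using reg unfolding invariant_functions_def by blast
qed

lemma traces_agree:
  assumes \<Gamma>: "group \<Gamma>" and S: "S \<subseteq> carrier \<Gamma>" "generate \<Gamma> S = carrier \<Gamma>"
    and th: "\<theta> \<in> involutions (mat_size F n)" and h: "\<rho> \<in> hom \<Gamma> (cgroup F n)"
    and Phi: "Phi \<Gamma> S (mat_size F n) (cgroup F n) \<theta> (chi \<Gamma> S (mat_size F n) (cgroup F n) \<rho>)
         = chi \<Gamma> S (mat_size F n) (cgroup F n) \<rho>"
    and \<gamma>: "\<gamma> \<in> carrier \<Gamma>"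
  shows "mat_trace (\<rho> \<gamma>) = mat_trace (\<theta> (\<rho> \<gamma>))"
proof -
  let ?I = "invariant_functions \<Gamma> S (mat_size F n) (cgroup F n)"
  let ?t = "\<lambda>\<rho>\<in>hom \<Gamma> (cgroup F n). mat_trace (\<rho> \<gamma>)"
  have t: "?t \<in> ?I" by (rule trace_invariant[OF \<Gamma> S \<gamma>])
  have th\<rho>: "\<theta> \<circ> \<rho> \<in> hom \<Gamma> (cgroup F n)" by (rule hom_comp_rep[OF h theta_hom[OF th]])
  have "chi \<Gamma> S (mat_size F n) (cgroup F n) (\<theta> \<circ> \<rho>) = chi \<Gamma> S (mat_size F n) (cgroup F n) \<rho>"
    using Phi Phi_chi[OF S(1) th h] by simp
  then have "chi \<Gamma> S (mat_size F n) (cgroup F n) (\<theta> \<circ> \<rho>) ?t = chi \<Gamma> S (mat_size F n) (cgroup F n) \<rho> ?t"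
    by simp
  then have "?t (\<theta> \<circ> \<rho>) = ?t \<rho>" unfolding chi_def restrict_apply'[OF t] .
  then show ?thesis unfolding restrict_apply'[OF th\<rho>] restrict_apply'[OF h] by simp
qed

text \<open>Here \<open>\<sigma>\<close> is the conjugation or the adjoint. The images \<open>\<sigma> X\<close> of the first components of the span occur
among the second components, which inherit the nondegenerate trace form in this way.\<close>

lemma nondegenerate_by_symmetry:
  assumes P: "matrix_pairs N P" and N: "N > 0" and irr: "irreducible_mats N (fst ` P)"
    and \<sigma>0: "\<sigma> (0\<^sub>m N N) = 0\<^sub>m N N"
    and \<sigma>add: "\<And>X A c. X \<in> carrier_mat N N \<Longrightarrow> A \<in> carrier_mat N N \<Longrightarrow> \<sigma> (X + c \<cdot>\<^sub>m A) = \<sigma> X + cnj c \<cdot>\<^sub>m \<sigma> A"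
    and \<sigma>c: "\<And>X. X \<in> carrier_mat N N \<Longrightarrow> \<sigma> X \<in> carrier_mat N N"
    and \<sigma>\<sigma>: "\<And>X. X \<in> carrier_mat N N \<Longrightarrow> \<sigma> (\<sigma> X) = X"
    and \<sigma>tr: "\<And>X Y. X \<in> carrier_mat N N \<Longrightarrow> Y \<in> carrier_mat N N \<Longrightarrow> mat_trace (X * \<sigma> Y) = cnj (mat_trace (\<sigma> X * Y))"
    and \<sigma>P: "\<And>A A'. (A, A') \<in> P \<Longrightarrow> \<exists>B. (B, \<sigma> A) \<in> P"
    and B: "B \<in> carrier_mat N N" and z: "\<And>X. X \<in> snd ` pair_span N P \<Longrightarrow> mat_trace (B * X) = 0"
  shows "B = 0\<^sub>m N N"
proof -
  interpret matrix_pairs N P by (rule P)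
  interpret irreducible_algebra N "fst ` pair_span N P" by (rule fst_irreducible_algebra[OF irr])
  have "\<exists>Z. (Z, \<sigma> X) \<in> pair_span N P" if "(X, X') \<in> pair_span N P" for X X'
    using that
  proof (induction rule: pair_span.induct)
    case zero then show ?case using pair_span.zero[of N P] by (auto simp: \<sigma>0)
  next
    case (step X X' A A' c)
    then obtain Z where Z: "(Z, \<sigma> X) \<in> pair_span N P" by auto
    obtain B where B: "(B, \<sigma> A) \<in> P" using \<sigma>P step by blast
    have "(Z + cnj c \<cdot>\<^sub>m B, \<sigma> X + cnj c \<cdot>\<^sub>m \<sigma> A) \<in> pair_span N P" by (rule pair_span.step[OF Z B])
    then show ?case using R_carrier[OF step(1)] P_carrier[OF step(2)] by (auto simp: \<sigma>add)
  qed
  then have sX: "\<sigma> X \<in> snd ` pair_span N P" if "X \<in> fst ` pair_span N P" for X using that by force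
  have "\<sigma> B = 0\<^sub>m N N"
  proof (rule trace_form_nondegenerate[OF N \<sigma>c[OF B]])
    fix X assume X: "X \<in> fst ` pair_span N P"
    then have XC: "X \<in> carrier_mat N N" using carrier by auto
    have "mat_trace (B * \<sigma> X) = 0" by (rule z[OF sX[OF X]])
    then show "mat_trace (\<sigma> B * X) = 0" using \<sigma>tr[OF B XC] by simp
  qed
  then show ?thesis using \<sigma>\<sigma>[OF B] \<sigma>0 by simp
qed

theorem intertwiner_exists:
  assumes \<Gamma>: "group \<Gamma>" and S: "S \<subseteq> carrier \<Gamma>" "generate \<Gamma> S = carrier \<Gamma>"
    and th: "\<theta> \<in> involutions (mat_size F n)" and h: "\<rho> \<in> hom \<Gamma> (cgroup F n)"
    and Phi: "Phi \<Gamma> S (mat_size F n) (cgroup F n) \<theta> (chi \<Gamma> S (mat_size F n) (cgroup F n) \<rho>)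
         = chi \<Gamma> S (mat_size F n) (cgroup F n) \<rho>"
    and irr: "irreducible_rep \<Gamma> (mat_size F n) \<rho>" and N: "mat_size F n > 0"
  shows "\<exists>P\<in>carrier_mat (mat_size F n) (mat_size F n). det P \<noteq> 0 \<and>
    (\<forall>\<gamma>\<in>carrier \<Gamma>. \<theta> (\<rho> \<gamma>) * P = P * \<rho> \<gamma>)"
proof -
  define N where "N = mat_size F n"
  define P where "P = (\<lambda>\<gamma>. (\<rho> \<gamma>, \<theta> (\<rho> \<gamma>))) ` carrier \<Gamma>"
  have N0: "N > 0" using N by (simp add: N_def)
  have th\<rho>: "\<theta> \<circ> \<rho> \<in> hom \<Gamma> (cgroup F n)" by (rule hom_comp_rep[OF h theta_hom[OF th]])
  have G: "\<rho> \<gamma> \<in> carrier (GL N)" "\<theta> (\<rho> \<gamma>) \<in> carrier (GL N)" if "\<gamma> \<in> carrier \<Gamma>" for \<gamma>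
    using hom_cgroup(3)[OF \<Gamma> h that] hom_cgroup(3)[OF \<Gamma> th\<rho> that] by (simp_all add: N_def)
  have C: "\<rho> \<gamma> \<in> carrier_mat N N" "\<theta> (\<rho> \<gamma>) \<in> carrier_mat N N" if "\<gamma> \<in> carrier \<Gamma>" for \<gamma>
    using G[OF that] by (simp_all add: GL_carrier)
  interpret \<Gamma>: group \<Gamma> by (rule \<Gamma>)
  have mp: "matrix_pairs N P"
  proof
    show "A \<in> carrier_mat N N \<and> A' \<in> carrier_mat N N" if "(A, A') \<in> P" for A A'
      using that C by (auto simp: P_def)
    show "(1\<^sub>m N, 1\<^sub>m N) \<in> P"
      unfolding P_def by (rule image_eqI[of _ _ "\<one>\<^bsub>\<Gamma>\<^esub>"])
        (use hom_cgroup(1)[OF \<Gamma> h] hom_cgroup(1)[OF \<Gamma> th\<rho>] in \<open>simp_all add: N_def\<close>)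
    fix A A' B B' assume "(A, A') \<in> P" "(B, B') \<in> P"
    then obtain a b where ab: "a \<in> carrier \<Gamma>" "b \<in> carrier \<Gamma>" "A = \<rho> a" "A' = \<theta> (\<rho> a)" "B = \<rho> b" "B' = \<theta> (\<rho> b)"
      by (auto simp: P_def)
    show "(A * B, A' * B') \<in> P"
      unfolding P_def by (rule image_eqI[of _ _ "a \<otimes>\<^bsub>\<Gamma>\<^esub> b"])
        (use ab hom_cgroup(4)[OF \<Gamma> h ab(1,2)] hom_cgroup(4)[OF \<Gamma> th\<rho> ab(1,2)] in simp_all)
  qed
  interpret matrix_pairs N P by (rule mp)
  have fstP: "fst ` P = \<rho> ` carrier \<Gamma>" by (auto simp: P_def image_image)
  have irrP: "irreducible_mats N (fst ` P)"
    unfolding fstP N_def by (rule irreducible_rep_imp_mats[OF irr])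
  have tr: "mat_trace A = mat_trace A'" if "(A, A') \<in> P" for A A'
    using that traces_agree[OF \<Gamma> S th h Phi] by (auto simp: P_def)
  have nondeg: "B = 0\<^sub>m N N"
    if B: "B \<in> carrier_mat N N" and z: "\<And>X. X \<in> snd ` R \<Longrightarrow> mat_trace (B * X) = 0" for B
  proof -
    consider "\<theta> = conj_mat" | "\<theta> = (\<lambda>A. inv\<^bsub>GL N\<^esub> ((conj_mat A)\<^sup>T))"
      using th by (auto simp: involutions_def N_def)
    then show ?thesis
    proof cases
      case 1
      show ?thesis
      proof (rule nondegenerate_by_symmetry[OF mp N0 irrP _ _ _ _ _ _ B z, where \<sigma> = conj_mat])
        show "conj_mat (0\<^sub>m N N) = 0\<^sub>m N N" by (intro eq_matI) auto
      next
        fix X A :: "complex mat" and c assume "X \<in> carrier_mat N N" "A \<in> carrier_mat N N"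
        then show "conj_mat (X + c \<cdot>\<^sub>m A) = conj_mat X + cnj c \<cdot>\<^sub>m conj_mat A" by (intro eq_matI) auto
      next
        fix X Y :: "complex mat" assume XY: "X \<in> carrier_mat N N" "Y \<in> carrier_mat N N"
        have "X * conj_mat Y = conj_mat (conj_mat X * Y)"
          using XY by (simp add: conj_mult[of _ N N _ N] square_mats.conj_conj)
        then show "mat_trace (X * conj_mat Y) = cnj (mat_trace (conj_mat X * Y))"
          using XY by (simp add: mat_trace_conj[of _ N])
      next
        fix A A' assume "(A, A') \<in> P"
        then show "\<exists>B. (B, conj_mat A) \<in> P" by (auto simp: P_def 1)
      qed (auto simp: square_mats.conj_conj)
    next
      case 2
      show ?thesis
      proof (rule nondegenerate_by_symmetry[OF mp N0 irrP _ _ _ _ _ _ B z, where \<sigma> = adj])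
        show "adj (0\<^sub>m N N) = 0\<^sub>m N N" by (intro eq_matI) auto
      next
        fix X A :: "complex mat" and c assume "X \<in> carrier_mat N N" "A \<in> carrier_mat N N"
        then show "adj (X + c \<cdot>\<^sub>m A) = adj X + cnj c \<cdot>\<^sub>m adj A" by (intro eq_matI) auto
      next
        fix X :: "complex mat" assume "X \<in> carrier_mat N N"
        then show "adj (adj X) = X" by (intro eq_matI) auto
      next
        fix X Y :: "complex mat" assume XY: "X \<in> carrier_mat N N" "Y \<in> carrier_mat N N"
        have e: "X * adj Y = adj (Y * adj X)"
          using XY by (simp add: square_mats.mat_simps)
        have "mat_trace (X * adj Y) = cnj (mat_trace (Y * adj X))"
          unfolding e using XY by (simp add: mat_trace_conj[of _ N] mat_trace_transpose[of _ N])
        also have "mat_trace (Y * adj X) = mat_trace (adj X * Y)"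
          by (rule mat_trace_mult_comm[of _ N]) (use XY in auto)
        finally show "mat_trace (X * adj Y) = cnj (mat_trace (adj X * Y))" .
      next
        fix A A' assume "(A, A') \<in> P"
        then obtain a where a: "a \<in> carrier \<Gamma>" "A = \<rho> a" by (auto simp: P_def)
        interpret GL: group "GL N" by (rule group_GL)
        have "\<theta> (\<rho> (inv\<^bsub>\<Gamma>\<^esub> a)) = adj (\<rho> a)"
        proof -
          have "\<rho> (inv\<^bsub>\<Gamma>\<^esub> a) = inv\<^bsub>GL N\<^esub> (\<rho> a)" using hom_cgroup(2)[OF \<Gamma> h a(1)] by (simp add: N_def)
          moreover have "inv\<^bsub>GL N\<^esub> (\<rho> a) \<in> carrier (GL N)" using G(1)[OF a(1)] by simp
          ultimately show ?thesis using G(1)[OF a(1)] by (simp add: 2 theta_eq)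
        qed
        then have "(\<rho> (inv\<^bsub>\<Gamma>\<^esub> a), adj A) \<in> P"
          unfolding P_def by (intro image_eqI[of _ _ "inv\<^bsub>\<Gamma>\<^esub> a"]) (use a in auto)
        then show "\<exists>B. (B, adj A) \<in> P" by blast
      qed auto
    qed
  qed
  obtain Q where "Q \<in> carrier_mat N N" "det Q \<noteq> 0" "\<forall>(A, A')\<in>P. A' * Q = Q * A"
    using conjugate_if_traces_agree[OF N0 irrP tr nondeg] by blast
  then show ?thesis unfolding N_def[symmetric] by (intro bexI[of _ Q]) (auto simp: P_def)
qed

section \<open>Invariant structures of an irreducible set of matrices\<close>

lemma even_if_sign_eq_norm:
  assumes "(- 1) ^ N = z * cnj z" shows "even N"
proof -
  have "complex_of_real ((- 1) ^ N) = complex_of_real ((cmod z)\<^sup>2)"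
    unfolding complex_norm_square assms[symmetric] by simp
  then have "(- 1) ^ N = (cmod z)\<^sup>2" by (simp only: of_real_eq_iff)
  then have "(- 1 :: real) ^ N \<ge> 0" by simp
  then show ?thesis by (metis neg_one_odd_power not_one_le_zero neg_0_le_iff_le)
qed

lemma complex_root_exists:
  assumes "n > 0" shows "\<exists>c :: complex. c ^ n = z"
proof -
  have "rcis (root n (cmod z)) (Arg z / n) ^ n = z"
    using assms by (simp add: DeMoivre2 rcis_cmod_Arg)
  then show ?thesis by blast
qed

context square_mats
begin

abbreviation ginv :: "complex mat \<Rightarrow> complex mat" where "ginv Q \<equiv> inv\<^bsub>GL N\<^esub> Q"

lemma ginv:
  assumes "Q \<in> M" "det Q \<noteq> 0"
  shows "ginv Q \<in> M" "Q * ginv Q = 1\<^sub>m N" "ginv Q * Q = 1\<^sub>m N" "det (ginv Q) \<noteq> 0"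
  using GL_inv[of Q N] assms by (auto simp: GL_carrier)

lemma ginv_eq: "Q \<in> M \<Longrightarrow> R \<in> M \<Longrightarrow> R * Q = 1\<^sub>m N \<Longrightarrow> ginv Q = R"
  by (rule GL_inv_unique(2))

lemma ginv_mult:
  assumes "P \<in> M" "det P \<noteq> 0" "Q \<in> M" "det Q \<noteq> 0"
  shows "ginv (P * Q) = ginv Q * ginv P"
  using ginv[OF assms(1,2)] ginv[OF assms(3,4)] assms
  by (intro ginv_eq) (auto simp: mat_simps cancel)

lemma scaled_conjugation:
  assumes Q: "Q \<in> M" "det Q \<noteq> 0" and c: "c \<noteq> 0" and A: "A \<in> M"
  shows "(c \<cdot>\<^sub>m Q) * A * ginv (c \<cdot>\<^sub>m Q) = Q * A * ginv Q"
proof -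
  have "ginv (c \<cdot>\<^sub>m Q) = (1 / c) \<cdot>\<^sub>m ginv Q"
    using ginv[OF Q] Q c by (intro ginv_eq) (auto simp: mat_simps)
  then show ?thesis using ginv[OF Q] Q c A by (simp add: mat_simps)
qed

lemma scale_to_det_one:
  assumes Q: "Q \<in> M" "det Q \<noteq> 0" and N: "N > 0"
  shows "\<exists>c. c \<noteq> 0 \<and> det (c \<cdot>\<^sub>m Q) = 1"
proof -
  obtain c where c: "c ^ N = 1 / det Q" using complex_root_exists[OF N] by blast
  have "c \<noteq> 0"
  proof
    assume "c = 0"
    then show False using c Q N by (simp add: power_0_left)
  qed
  moreover have "det (c \<cdot>\<^sub>m Q) = c ^ N * det Q" using Q by (simp add: det_smult)
  ultimately show ?thesis using c Q by auto
qed

lemma hermitian_involution_signature: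
  assumes W: "W \<in> M" "adj W = W" "W * W = 1\<^sub>m N"
  shows "\<exists>a\<le>N. mat_trace W = 2 * of_nat a - of_nat N \<and> det W = (- 1) ^ (N - a)"
proof -
  obtain U A where U: "U \<in> M" "A \<subseteq> {..<N}" "adj U * U = 1\<^sub>m N" "U * adj U = 1\<^sub>m N"
    "W = U * mat_diag N (\<lambda>i. if i \<in> A then 1 else -1) * adj U"
    using hermitian_involution_diagonal[OF W] by blast
  let ?D = "mat_diag N (\<lambda>i. if i \<in> A then 1 else -1 :: complex)"
  have D: "?D \<in> M" by simp
  have fin: "finite A" using U(2) finite_subset by blast
  have "card A \<le> N" using card_mono[OF _ U(2)] by simp
  moreover have "mat_trace W = 2 * of_nat (card A) - of_nat N"
    unfolding U(5) mat_trace_unitary_conj[OF U(1) D U(3)] by (rule mat_trace_signs[OF U(2)])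
  moreover have "det W = (- 1) ^ (N - card A)"
  proof -
    have "det W = (det (adj U) * det U) * det ?D"
      unfolding U(5) by (simp only: det_M_mult mult_M transpose_M conj_M U(1) D) (simp add: mult_ac)
    also have "det (adj U) * det U = det (adj U * U)" by (simp only: det_M_mult transpose_M conj_M U(1))
    also have "\<dots> = 1" unfolding U(3) by simp
    also have "det ?D = (\<Prod>i<N. if i \<in> A then 1 else -1)" by (rule det_mat_diag)
    also have "\<dots> = (- 1) ^ card ({..<N} - A)"
      using U(2) by (simp add: prod.If_cases Diff_eq)
    also have "card ({..<N} - A) = N - card A" using U(2) fin by (simp add: card_Diff_subset)
    finally show ?thesis by simp
  qed
  ultimately show ?thesis by blast
qed

lemma hermitian_involution_sign: "W \<in> M \<Longrightarrow> adj W = W \<Longrightarrow> W * W = 1\<^sub>m N \<Longrightarrow> s = 1 \<or> s = -1 \<Longrightarrow>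
    s \<cdot>\<^sub>m W \<in> M \<and> adj (s \<cdot>\<^sub>m W) = 1 \<cdot>\<^sub>m (s \<cdot>\<^sub>m W) \<and> (s \<cdot>\<^sub>m W) * (s \<cdot>\<^sub>m W) = 1 \<cdot>\<^sub>m 1\<^sub>m N"
  by (auto simp: mat_simps)

text \<open>The real forms are listed with \<open>q \<le> p\<close>; a Hermitian form of the opposite kind is multiplied by \<open>- 1\<close>.\<close>

lemma balance_signature:
  assumes "a \<le> N"
  shows "\<exists>s p q. (s = 1 \<or> s = (-1 :: complex)) \<and> q \<le> p \<and> p + q = N \<and>
    s * (2 * of_nat a - of_nat N) = of_nat p - of_nat q \<and> (p = a \<or> p = N - a)"
proof (cases "N \<le> 2 * a")
  case True
  then show ?thesis using assms
    by (intro exI[of _ 1] exI[of _ a] exI[of _ "N - a"]) (auto simp: of_nat_diff algebra_simps)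
next
  case False
  then show ?thesis using assms
    by (intro exI[of _ "-1"] exI[of _ "N - a"] exI[of _ a]) (auto simp: of_nat_diff algebra_simps)
qed

lemma scaled_congruence:
  assumes "T \<in> M" "W \<in> M" "S = T * W * T" shows "s \<cdot>\<^sub>m S = T * (s \<cdot>\<^sub>m W) * T"
  using assms by (simp add: mat_simps)

lemma isometry_transpose:
  assumes A: "A \<in> M" "isometry F A" and F: "F \<in> M" "F * F = h \<cdot>\<^sub>m 1\<^sub>m N" "h \<noteq> 0"
  shows "A * F * A\<^sup>T = F"
  by (rule form_transpose[OF A(1) F(1) A(2) F(2,3)])

end

locale irreducible_matrix_set = square_mats N for N +
  fixes \<A> :: "complex mat set"
  assumes N0: "N > 0" and \<A>M: "A \<in> \<A> \<Longrightarrow> A \<in> M" and \<A>det: "A \<in> \<A> \<Longrightarrow> det A \<noteq> 0"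
    and irr: "irreducible_mats N \<A>"
begin

lemma schur:
  assumes "B \<in> M" "\<And>A. A \<in> \<A> \<Longrightarrow> A * B = B * A" shows "\<exists>c. B = c \<cdot>\<^sub>m 1\<^sub>m N"
  by (rule commutant_scalar[OF N0 irr _ assms]) (use \<A>M in auto)

lemma nonzero_scalar:
  assumes "c \<cdot>\<^sub>m 1\<^sub>m N = d \<cdot>\<^sub>m (1\<^sub>m N :: complex mat)" shows "c = d"
proof -
  have "(c \<cdot>\<^sub>m 1\<^sub>m N) $$ (0,0) = (d \<cdot>\<^sub>m (1\<^sub>m N :: complex mat)) $$ (0,0)" by (simp only: assms)
  then show ?thesis using N0 by simp
qed

lemma smult_cancel: "det S \<noteq> 0 \<Longrightarrow> S \<in> M \<Longrightarrow> c \<cdot>\<^sub>m S = d \<cdot>\<^sub>m S \<Longrightarrow> c = d"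
proof -
  assume S: "S \<in> M" "det S \<noteq> 0" and e: "c \<cdot>\<^sub>m S = d \<cdot>\<^sub>m S"
  have "(c \<cdot>\<^sub>m S) * ginv S = (d \<cdot>\<^sub>m S) * ginv S" unfolding e ..
  then show "c = d" using ginv[OF S] S by (intro nonzero_scalar) (simp add: mat_simps)
qed

text \<open>Two invariant sesquilinear forms differ by a matrix in the commutant.\<close>

lemma invariant_form_unique:
  assumes S: "S \<in> M" "det S \<noteq> 0" "\<And>A. A \<in> \<A> \<Longrightarrow> unitary_for S A"
    and S': "S' \<in> M" "\<And>A. A \<in> \<A> \<Longrightarrow> unitary_for S' A"
  shows "\<exists>c. S' = c \<cdot>\<^sub>m S"
proof -
  note I = ginv[OF S(1,2)]
  have "A * (ginv S * S') = (ginv S * S') * A" if A: "A \<in> \<A>" for A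
  proof -
    have c: "A \<in> M" using \<A>M[OF A] .
    note R = ginv[OF c \<A>det[OF A]]
    have L: "adj (ginv A) * adj A = 1\<^sub>m N" using arg_cong[OF R(2), of adj] c R(1) by (simp add: mat_simps)
    have LX: "adj (ginv A) * X = X * A" if X: "X \<in> M" "unitary_for X A" for X
    proof -
      have "adj (ginv A) * X = adj (ginv A) * (adj A * X * A)" by (simp only: X(2))
      also have "\<dots> = X * A" using c R(1) X(1) cancel[OF L] by (simp add: mat_simps)
      finally show ?thesis .
    qed
    note 1 = LX[OF S(1) S(3)[OF A]] and 2 = LX[OF S'(1) S'(2)[OF A]]
    have "ginv S * (adj (ginv A) * S) * ginv S = ginv S * (S * A) * ginv S" unfolding 1 ..
    then have 3: "ginv S * adj (ginv A) = A * ginv S"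
      using S(1) I c R(1) cancel[OF I(3)] by (simp add: mat_simps)
    have "(ginv S * S') * A = ginv S * (adj (ginv A) * S')" unfolding 2 using I S'(1) c by (simp add: mat_simps)
    also have "\<dots> = A * (ginv S * S')"
      using rewrite_prefix[OF 3] I(1) S'(1) c R(1) by (simp add: mat_simps)
    finally show ?thesis ..
  qed
  then obtain c where "ginv S * S' = c \<cdot>\<^sub>m 1\<^sub>m N" using schur[of "ginv S * S'"] I S' by auto
  then have "S * (ginv S * S') = S * (c \<cdot>\<^sub>m 1\<^sub>m N)" by simp
  then have "S' = c \<cdot>\<^sub>m S" using cancel[OF I(2) S(1) I(1) S'(1)] S(1) by (simp add: mat_simps)
  then show ?thesis by blast
qed

lemma adj_invariant:
  assumes "A \<in> M" "S \<in> M" "unitary_for S A" shows "adj A * adj S * A = adj S"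
  using arg_cong[OF assms(3), of adj] assms(1,2) by (simp add: mat_simps)

text \<open>The product of the conjugate of \<open>P\<close> with \<open>P\<close> is a scalar by Schur's lemma, and it is real because it
commutes with \<open>P\<close> up to conjugation. After rescaling it is \<open>1\<close> or \<open>- 1\<close>, and the standard structure with the
same square is \<open>1\<close> or \<open>J_mat m\<close>. In the second case the determinant shows that the size is even.\<close>

lemma real_or_quaternionic:
  assumes P: "P \<in> M" "det P \<noteq> 0" "\<And>A. A \<in> \<A> \<Longrightarrow> conj_mat A * P = P * A"
  shows "\<exists>Q\<in>M. det Q \<noteq> 0 \<and> ((\<forall>A\<in>\<A>. conj_mat (Q * A * ginv Q) = Q * A * ginv Q) \<or>
    (\<exists>m. N = 2 * m \<and> (\<forall>A\<in>\<A>. conj_mat (Q * A * ginv Q) * J_mat m = J_mat m * (Q * A * ginv Q))))"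
proof -
  have "A * (conj_mat P * P) = (conj_mat P * P) * A" if A: "A \<in> \<A>" for A
  proof -
    have c: "A \<in> M" using \<A>M[OF A] .
    note e = P(3)[OF A]
    have e': "A * conj_mat P = conj_mat P * conj_mat A"
      using arg_cong[OF e, of conj_mat] c P(1) by (simp add: mat_simps)
    show ?thesis using c P(1) e rewrite_prefix[OF e'] by (simp add: mat_simps)
  qed
  then obtain l where l: "conj_mat P * P = l \<cdot>\<^sub>m 1\<^sub>m N" using schur[of "conj_mat P * P"] P by auto
  have l0: "l \<noteq> 0"
  proof
    assume "l = 0"
    then have "det (conj_mat P * P) = 0" using N0 by (simp add: l det_smult power_0_left)
    then show False using P(1,2) by (simp add: det_M_mult det_conj)
  qed
  have "cnj l = l"
  proof (rule smult_cancel[OF P(2,1)])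
    have "P * conj_mat P = cnj l \<cdot>\<^sub>m 1\<^sub>m N" using arg_cong[OF l, of conj_mat] P(1) by (simp add: mat_simps)
    from rewrite_prefix[OF this P(1) conj_M[OF P(1)] P(1)]
    show "cnj l \<cdot>\<^sub>m P = l \<cdot>\<^sub>m P" unfolding l using P(1) by (simp add: mat_simps)
  qed
  then have lr: "l = complex_of_real (Re l)" by (simp add: complex_eq_iff)
  define e where "e = complex_of_real (sgn (Re l))"
  have Rl: "Re l \<noteq> 0" using l0 lr by (metis of_real_0)
  have e: "e = 1 \<or> e = -1" using Rl by (auto simp: e_def sgn_if)
  \<comment> \<open>This factor normalises \<open>l\<close> to its sign.\<close>
  define k where "k = complex_of_real (1 / sqrt \<bar>Re l\<bar>)"
  have k: "k \<noteq> 0" "cnj k = k" using Rl by (simp_all add: k_def)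
  have "k * k * l = e"
  proof -
    have "k * k * l = complex_of_real (1 / sqrt \<bar>Re l\<bar> * (1 / sqrt \<bar>Re l\<bar>) * Re l)"
      unfolding k_def by (subst lr) (simp only: of_real_mult)
    also have "1 / sqrt \<bar>Re l\<bar> * (1 / sqrt \<bar>Re l\<bar>) * Re l = sgn (Re l)"
      using Rl by (auto simp: sgn_if abs_if)
    finally show ?thesis by (simp add: e_def)
  qed
  define P1 where "P1 = k \<cdot>\<^sub>m P"
  have P1: "P1 \<in> M" using P by (simp add: P1_def)
  have PP: "conj_mat P1 * P1 = e \<cdot>\<^sub>m 1\<^sub>m N"
    unfolding P1_def using P(1) k l \<open>k * k * l = e\<close> by (simp add: mat_simps mult.assoc)
  have AP: "conj_mat A * P1 = P1 * A" if "A \<in> \<A>" for A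
    unfolding P1_def using P(1) P(3)[OF that] \<A>M[OF that] by (simp add: mat_simps)
  have main: "\<exists>Q\<in>M. det Q \<noteq> 0 \<and> (\<forall>A\<in>\<A>. conj_mat (Q * A * ginv Q) * K = K * (Q * A * ginv Q))"
    if K: "K \<in> M" "conj_mat K = K" "K * K = e \<cdot>\<^sub>m 1\<^sub>m N" for K
  proof -
    obtain Q where Q: "Q \<in> M" "det Q \<noteq> 0" "conj_mat Q * P1 = K * Q"
      using twisted_intertwiner[OF P1 K PP e] by blast
    have "conj_mat (Q * A * ginv Q) * K = K * (Q * A * ginv Q)" if A: "A \<in> \<A>" for A
      by (rule twisted_transfer[OF \<A>M[OF A] P1 K(1) Q(1) ginv(1)[OF Q(1,2)] ginv(2,3)[OF Q(1,2)] AP[OF A] Q(3)])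
    then show ?thesis using Q by blast
  qed
  from e show ?thesis
  proof
    assume "e = 1"
    then obtain Q where Q: "Q \<in> M" "det Q \<noteq> 0" "\<And>A. A \<in> \<A> \<Longrightarrow> conj_mat (Q * A * ginv Q) * 1\<^sub>m N = 1\<^sub>m N * (Q * A * ginv Q)"
      using main[OF one_M] by (auto simp: mat_simps)
    have "conj_mat (Q * A * ginv Q) = Q * A * ginv Q" if A: "A \<in> \<A>" for A
      using Q(3)[OF A] \<A>M[OF A] Q(1) ginv(1)[OF Q(1,2)] by (simp add: mat_simps)
    then show ?thesis using Q by blast
  next
    assume e1: "e = -1"
    have "det (conj_mat P1 * P1) = cnj (det P1) * det P1" using P1 by (simp add: det_M_mult det_conj)
    also have "det (conj_mat P1 * P1) = (- 1) ^ N" unfolding PP by (simp add: e1 det_smult)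
    finally have "(- 1) ^ N = det P1 * cnj (det P1)" by (simp add: mult.commute)
    then have "even N" by (rule even_if_sign_eq_norm)
    then obtain m where m: "N = 2 * m" by blast
    have "J_mat m \<in> M" "J_mat m * J_mat m = e \<cdot>\<^sub>m 1\<^sub>m N"
      using J_carrier[of m] J_square[of m] by (simp_all add: m e1)
    from main[OF this(1) conj_J this(2)] show ?thesis using m by blast
  qed
qed

text \<open>The adjoint of \<open>P\<close> is another invariant form, hence \<open>c P\<close> with \<open>c\<close> of modulus one; multiplying \<open>P\<close> by a square
root of \<open>c\<close> makes it Hermitian.\<close>

lemma hermitian_invariant_form:
  assumes P: "P \<in> M" "det P \<noteq> 0" "\<And>A. A \<in> \<A> \<Longrightarrow> unitary_for P A"
  shows "\<exists>S\<in>M. det S \<noteq> 0 \<and> adj S = S \<and> (\<forall>A\<in>\<A>. unitary_for S A)"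
proof -
  obtain c where c: "adj P = c \<cdot>\<^sub>m P"
    using invariant_form_unique[OF P, of "adj P"] adj_invariant[OF \<A>M P(1) P(3)] P(1) by auto
  have "P = adj (adj P)" using P(1) by (simp add: mat_simps)
  also have "\<dots> = (cnj c * c) \<cdot>\<^sub>m P" unfolding c by (simp add: mat_simps c[unfolded conj_transpose[symmetric]] flip: conj_transpose)
  finally have "1 \<cdot>\<^sub>m P = (cnj c * c) \<cdot>\<^sub>m P" by (simp add: smult_one)
  then have cc: "cnj c * c = 1" using smult_cancel[OF P(2,1)] by metis
  define d where "d = csqrt c"
  have dd: "d * d = c" unfolding d_def using power2_csqrt[of c] by (simp only: power2_eq_square)
  have d0: "d \<noteq> 0" using dd cc by auto
  have cd: "cnj d * c = d"
  proof -
    have "(cnj d * d) * (cnj d * d) = 1" using cc unfolding dd[symmetric] by (simp add: mult_ac)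
    moreover have "cnj d * d = complex_of_real ((cmod d)\<^sup>2)" by (simp only: complex_norm_square mult.commute)
    ultimately have "complex_of_real ((cmod d)\<^sup>2 * (cmod d)\<^sup>2) = 1" by simp
    then have "(cmod d)\<^sup>2 * (cmod d)\<^sup>2 = 1" by (simp only: of_real_eq_1_iff)
    then have "(cmod d)\<^sup>2 = 1" using square_eq_1_iff[of "(cmod d)\<^sup>2"] zero_le_power2[of "cmod d"] by linarith
    then have "cnj d * d = 1" using \<open>cnj d * d = _\<close> by simp
    then show ?thesis unfolding dd[symmetric] by (simp add: mult.assoc[symmetric])
  qed
  have "adj (d \<cdot>\<^sub>m P) = cnj d \<cdot>\<^sub>m adj P" by (intro eq_matI) auto
  also have "\<dots> = d \<cdot>\<^sub>m P" unfolding c by (simp add: smult_smult cd)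
  finally have "adj (d \<cdot>\<^sub>m P) = d \<cdot>\<^sub>m P" .
  moreover have "adj A * (d \<cdot>\<^sub>m P) * A = d \<cdot>\<^sub>m P" if "A \<in> \<A>" for A
    using P(1) P(3)[OF that] \<A>M[OF that] by (simp add: mat_simps)
  moreover have "det (d \<cdot>\<^sub>m P) \<noteq> 0" using P(1,2) d0 by (simp add: det_smult)
  ultimately show ?thesis using P(1) by (intro bexI[of _ "d \<cdot>\<^sub>m P"]) auto
qed

text \<open>The form \<open>P\<^sup>T F P\<close> is invariant under \<open>\<A>\<close> in the bilinear sense, hence a multiple of \<open>F\<close>, and \<open>P\<close> can be
rescaled to an isometry \<open>S\<close>. Its adjoint is \<open>e S\<close> and is an isometry as well; comparing the two forms
gives \<open>e\<^sup>2 = 1\<close>.\<close>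

lemma isometric_invariant_form:
  assumes F: "F \<in> M" "conj_mat F = F" "F * F = h \<cdot>\<^sub>m 1\<^sub>m N" "F\<^sup>T = h \<cdot>\<^sub>m F" and h: "h = 1 \<or> h = -1"
    and AF: "\<And>A. A \<in> \<A> \<Longrightarrow> A\<^sup>T * F * A = F"
    and P: "P \<in> M" "det P \<noteq> 0" "\<And>A. A \<in> \<A> \<Longrightarrow> unitary_for P A"
  shows "\<exists>S\<in>M. \<exists>e. (e = 1 \<or> e = -1) \<and> det S \<noteq> 0 \<and> adj S = e \<cdot>\<^sub>m S \<and> S\<^sup>T * F * S = F \<and> (\<forall>A\<in>\<A>. unitary_for S A)"
proof -
  have h0: "h \<noteq> 0" and hh: "h * h = 1" using h by auto
  define B where "B = P\<^sup>T * F * P"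
  have B: "B \<in> M" using P F by (simp add: B_def)
  have "A * (F * B) = (F * B) * A" if A: "A \<in> \<A>" for A
  proof -
    have c: "A \<in> M" using \<A>M[OF A] .
    note R = ginv[OF c \<A>det[OF A]]
    let ?R = "ginv A"
    have RF: "?R\<^sup>T * F * ?R = F" by (rule form_inv[OF c R(1) F(1) AF[OF A] R(2)])
    have RF': "?R * F * ?R\<^sup>T = F" by (rule isometry_transpose[OF R(1) RF F(1,3) h0])
    have cRF: "conj_mat ?R * (F * adj ?R) = F"
      using arg_cong[OF RF', of conj_mat] R(1) F(1,2) by (simp add: mat_simps)
    have L: "adj ?R * adj A = 1\<^sub>m N" using arg_cong[OF R(2), of adj] c R(1) by (simp add: mat_simps)
    have "adj ?R * (adj A * P * A) = P * A" using c R(1) P(1) cancel[OF L] by (simp add: mat_simps)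
    then have PA: "P * A = adj ?R * P" unfolding P(3)[OF A] ..
    have PAt: "A\<^sup>T * P\<^sup>T = P\<^sup>T * conj_mat ?R"
      using arg_cong[OF PA, of transpose_mat] c R(1) P(1) by (simp add: mat_simps)
    have ABA: "isometry B A"
    proof -
      have "A\<^sup>T * B * A = (A\<^sup>T * P\<^sup>T) * F * (P * A)" unfolding B_def using c P(1) F(1) by (simp add: mat_simps)
      also have "\<dots> = P\<^sup>T * (conj_mat ?R * (F * adj ?R)) * P"
        unfolding PA PAt using c P(1) F(1) R(1) by (simp add: mat_simps)
      finally show ?thesis unfolding cRF B_def by simp
    qed
    have Rt: "?R\<^sup>T * A\<^sup>T = 1\<^sub>m N" using arg_cong[OF R(2), of transpose_mat] c R(1) by (simp add: mat_simps)
    have "?R\<^sup>T * (A\<^sup>T * B * A) = B * A" using c R(1) B cancel[OF Rt] by (simp add: mat_simps)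
    then have BA: "B * A = ?R\<^sup>T * B" unfolding ABA ..
    have "A * (?R * F * ?R\<^sup>T) = F * ?R\<^sup>T" using c R(1) F(1) cancel[OF R(2)] by (simp add: mat_simps)
    then have FR: "F * ?R\<^sup>T = A * F" unfolding RF' ..
    have "(F * B) * A = F * (?R\<^sup>T * B)" using F(1) B c by (simp add: mat_simps BA)
    also have "\<dots> = A * (F * B)" using rewrite_prefix[OF FR] F(1) R(1) B c by (simp add: mat_simps)
    finally show ?thesis ..
  qed
  then obtain l where l: "F * B = l \<cdot>\<^sub>m 1\<^sub>m N" using schur[of "F * B"] F(1) B by auto
  have Bl: "B = (h * l) \<cdot>\<^sub>m F"
  proof -
    have "F * (F * B) = h \<cdot>\<^sub>m B" using rewrite_prefix[OF F(3) F(1) F(1) B] B by (simp add: mat_simps)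
    moreover have "F * (F * B) = l \<cdot>\<^sub>m F" unfolding l using F(1) by (simp add: mat_simps)
    ultimately have "h \<cdot>\<^sub>m (h \<cdot>\<^sub>m B) = h \<cdot>\<^sub>m (l \<cdot>\<^sub>m F)" by simp
    then show ?thesis by (simp add: mat_simps hh)
  qed
  have dF: "det F \<noteq> 0"
    by (rule det_nonzero_if_inverse[of _ "h \<cdot>\<^sub>m F"]) (use F(1,3) hh in \<open>auto simp: mat_simps\<close>)
  have "h * l \<noteq> 0"
  proof
    assume "h * l = 0"
    then have "det B = 0" unfolding Bl using F(1) N0 by (simp add: det_smult power_0_left)
    then show False unfolding B_def using P(1,2) F(1) dF by (simp add: det_M_mult mult_M det_transpose[of _ N] del: assoc_mult_mat)
  qed
  obtain k where k: "k ^ 2 = 1 / (h * l)" using complex_root_exists[of 2] by auto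
  have kk: "k * k * (h * l) = 1" using k \<open>h * l \<noteq> 0\<close> by (simp add: power2_eq_square)
  define S where "S = k \<cdot>\<^sub>m P"
  have S: "S \<in> M" using P by (simp add: S_def)
  have k0: "k \<noteq> 0" using kk by auto
  have dS: "det S \<noteq> 0" using P(1,2) k0 by (simp add: S_def det_smult)
  have SF: "isometry F S"
  proof -
    have "S\<^sup>T * F * S = (k * k) \<cdot>\<^sub>m B" unfolding S_def B_def using P(1) F(1) by (simp add: mat_simps)
    then show ?thesis unfolding Bl by (simp add: mat_simps kk)
  qed
  have SA: "unitary_for S A" if "A \<in> \<A>" for A
    unfolding S_def using P(1) P(3)[OF that] \<A>M[OF that] by (simp add: mat_simps)
  obtain e where e: "adj S = e \<cdot>\<^sub>m S"
    using invariant_form_unique[OF S dS SA, of "adj S"] adj_invariant[OF \<A>M S SA] S by auto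
  have "(adj S)\<^sup>T * F * adj S = conj_mat (S * F * S\<^sup>T)" using S F(1,2) by (simp add: mat_simps)
  also have "\<dots> = F" unfolding isometry_transpose[OF S SF F(1,3) h0] by (rule F(2))
  finally have "(e * e) \<cdot>\<^sub>m (S\<^sup>T * F * S) = F" unfolding e using S F(1) by (simp add: mat_simps)
  then have "(e * e) \<cdot>\<^sub>m F = 1 \<cdot>\<^sub>m F" unfolding SF by (simp add: smult_one)
  then have "e * e = 1" by (rule smult_cancel[OF dF F(1)])
  then have "e = 1 \<or> e = -1" by (simp add: square_eq_1_iff)
  then show ?thesis using S dS e SF SA by blast
qed

end

section \<open>Standard forms and their signatures\<close>

abbreviation signs :: "nat \<Rightarrow> nat set \<Rightarrow> complex mat" where
  "signs N A \<equiv> mat_diag N (\<lambda>i. if i \<in> A then 1 else -1)"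

lemma signs_facts:
  "signs N A \<in> carrier_mat N N" "(signs N A)\<^sup>T = signs N A" "conj_mat (signs N A) = signs N A"
  "signs N A * signs N A = 1\<^sub>m N"
proof -
  show "signs N A * signs N A = 1\<^sub>m N" unfolding mat_diag_diag
    by (intro eq_matI) (auto simp: mat_diag_def)
qed (auto intro!: eq_matI simp: mat_diag_def)

lemma signs_adj: "adj (signs N A) = signs N A"
  by (simp only: signs_facts)

lemma signs_commute: "signs N A * signs N B = signs N B * signs N A"
  by (simp add: mult.commute)

lemma I_mat_signs: "I_mat p q = signs (p + q) {..<p}"
  unfolding I_mat_def by (rule eq_matI) (auto simp: mat_diag_def)

lemma K_mat_signs: "K_mat p q = signs (2 * (p + q)) ({..<p} \<union> {p + q..<p + q + p})"
  unfolding K_mat_def I_mat_def by (rule eq_matI) (auto simp: mat_diag_def)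

lemma J_entry: "i < 2 * n \<Longrightarrow> j < 2 * n \<Longrightarrow>
    J_mat n $$ (i,j) = (if j = i + n then 1 else if i = j + n then - 1 else 0)"
  unfolding J_mat_def by auto

lemma J_transpose: "(J_mat n)\<^sup>T = - J_mat n"
proof (rule eq_matI)
  fix i j assume "i < dim_row (- J_mat n)" "j < dim_col (- J_mat n)"
  then have ij: "i < 2 * n" "j < 2 * n" using J_carrier[of n] by auto
  then show "(J_mat n)\<^sup>T $$ (i,j) = (- J_mat n) $$ (i,j)"
    using J_carrier[of n] J_entry[OF ij] J_entry[OF ij(2,1)] by auto
qed (use J_carrier[of n] in auto)

lemma uminus_smult: "- A = (- 1) \<cdot>\<^sub>m (A :: complex mat)"
  by (intro eq_matI) auto

lemma J_adj: "adj (J_mat n) = (- 1) \<cdot>\<^sub>m J_mat n"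
  by (simp add: conj_J J_transpose uminus_smult)

lemma det_J: "det (J_mat n) \<noteq> 0"
  by (rule square_mats.det_nonzero_if_inverse[of _ "2 * n" "(- 1) \<cdot>\<^sub>m J_mat n"])
    (use J_carrier[of n] J_square[of n] in \<open>auto simp: square_mats.smult_right[of _ "2 * n"] square_mats.smult_smult square_mats.smult_one\<close>)

lemma signs_J:
  assumes "\<And>i. i < n \<Longrightarrow> i \<in> A \<longleftrightarrow> i + n \<in> B"  "\<And>i. i < n \<Longrightarrow> i \<in> B \<longleftrightarrow> i + n \<in> A"
  shows "signs (2 * n) A * J_mat n = J_mat n * signs (2 * n) B"
proof (rule eq_matI)
  fix i j assume "i < dim_row (J_mat n * signs (2 * n) B)" "j < dim_col (J_mat n * signs (2 * n) B)"
  then have ij: "i < 2 * n" "j < 2 * n" using J_carrier[of n] by auto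
  show "(signs (2 * n) A * J_mat n) $$ (i,j) = (J_mat n * signs (2 * n) B) $$ (i,j)"
    using ij assms[of i] assms[of j]
    by (simp add: mat_diag_mult_left[OF J_carrier] mat_diag_mult_right[OF J_carrier] J_entry)
qed (use J_carrier[of n] in auto)

lemma K_isometry_J: "(K_mat p q)\<^sup>T * J_mat (p + q) * K_mat p q = J_mat (p + q)"
proof -
  interpret square_mats "2 * (p + q)" .
  let ?A = "{..<p} \<union> {p + q..<p + q + p}"
  have e: "signs (2 * (p + q)) ?A * J_mat (p + q) = J_mat (p + q) * signs (2 * (p + q)) ?A"
    by (rule signs_J) auto
  show ?thesis unfolding K_mat_signs signs_facts e
    using J_carrier[of "p + q"] signs_facts(1,4)[of "2 * (p + q)" ?A] by (simp add: mat_simps del: mat_diag_diag)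
qed

context square_mats
begin

lemma isometry_transpose_one: "A \<in> M \<Longrightarrow> A\<^sup>T * A = 1\<^sub>m N \<Longrightarrow> A * A\<^sup>T = 1\<^sub>m N" for A :: "complex mat"
  by (rule right_inverse_imp_left) auto

lemma skew_hermitian_target:
  assumes F: "F \<in> M" "conj_mat F = F" "F * F = h \<cdot>\<^sub>m 1\<^sub>m N" "F\<^sup>T = h \<cdot>\<^sub>m F" "det F \<noteq> 0" and h: "h = 1 \<or> h = -1"
    and S: "S \<in> M" "det S \<noteq> 0" "adj S = (- 1) \<cdot>\<^sub>m S" "isometry F S"
    and W': "W' \<in> M" "adj W' = (- 1) \<cdot>\<^sub>m W'" "W' * W' = (- 1) \<cdot>\<^sub>m 1\<^sub>m N" "isometry F W'"
  shows "\<exists>Q\<in>M. det Q \<noteq> 0 \<and> Q\<^sup>T * F * Q = F \<and> adj Q * W' * Q = S"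
proof -
  obtain T W where T: "T \<in> M" "adj T = T" "det T \<noteq> 0" and STW: "S = T * W * T"
    and W: "W \<in> M" "adj W = (- 1) \<cdot>\<^sub>m W" "W * W = (- 1) \<cdot>\<^sub>m 1\<^sub>m N"
    and fm: "\<forall>F\<in>M. isometry F S \<longrightarrow> T\<^sup>T * F * T = F \<and> W\<^sup>T * F * W = F"
    using polar_normalisation[OF S(1-3)] by blast
  have TF: "isometry F T" and WF: "isometry F W" using fm F(1) S(4) by auto
  have "mat_trace W = mat_trace W'"
    using skew_trace_zero[OF W F(1,5) WF] skew_trace_zero[OF W'(1-3) F(1,5) W'(4)] by simp
  from sesquilinear_normal_form_isometry[OF F(1-4) h T TF STW W WF W' _ this]
  show ?thesis by simp
qed

lemma hermitian_target:
  assumes S: "S \<in> M" "det S \<noteq> 0" "adj S = S"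
  shows "\<exists>a\<le>N. (\<forall>s W'. s = 1 \<or> s = -1 \<longrightarrow> W' \<in> M \<longrightarrow> adj W' = W' \<longrightarrow> W' * W' = 1\<^sub>m N \<longrightarrow>
      mat_trace W' = s * (2 * of_nat a - of_nat N) \<longrightarrow> (\<exists>Q\<in>M. det Q \<noteq> 0 \<and> adj Q * W' * Q = s \<cdot>\<^sub>m S))"
proof -
  obtain T W where T: "T \<in> M" "adj T = T" "det T \<noteq> 0" and STW: "S = T * W * T"
    and W: "W \<in> M" "adj W = 1 \<cdot>\<^sub>m W" "W * W = 1 \<cdot>\<^sub>m 1\<^sub>m N"
    using polar_normalisation[OF S(1,2), of 1] S(3) by (auto simp: smult_one)
  have W1: "W \<in> M" "adj W = W" "W * W = 1\<^sub>m N" using W by (simp_all add: smult_one)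
  obtain a where a: "a \<le> N" "mat_trace W = 2 * of_nat a - of_nat N"
    using hermitian_involution_signature[OF W1] by blast
  have "\<exists>Q\<in>M. det Q \<noteq> 0 \<and> adj Q * W' * Q = s \<cdot>\<^sub>m S"
    if s: "s = 1 \<or> s = -1" and W': "W' \<in> M" "adj W' = W'" "W' * W' = 1\<^sub>m N"
      and tr: "mat_trace W' = s * (2 * of_nat a - of_nat N)" for s W'
  proof -
    have sW: "s \<cdot>\<^sub>m W \<in> M" "adj (s \<cdot>\<^sub>m W) = 1 \<cdot>\<^sub>m (s \<cdot>\<^sub>m W)" "(s \<cdot>\<^sub>m W) * (s \<cdot>\<^sub>m W) = 1 \<cdot>\<^sub>m 1\<^sub>m N"
      using hermitian_involution_sign[OF W1 s] by auto
    have W'1: "W' \<in> M" "adj W' = 1 \<cdot>\<^sub>m W'" "W' * W' = 1 \<cdot>\<^sub>m 1\<^sub>m N" using W' by (simp_all add: smult_one)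
    have "mat_trace (s \<cdot>\<^sub>m W) = mat_trace W'" using a(2) tr W(1) by (simp add: mat_trace_smult[of _ N])
    from sesquilinear_normal_form[OF T scaled_congruence[OF T(1) W(1) STW] sW W'1 _ this]
    show ?thesis by simp
  qed
  then show ?thesis using a by blast
qed

text \<open>The determinant of \<open>W\<close> is recorded because the multiplicity \<open>N - a\<close> of the eigenvalue \<open>- 1\<close> is even in the
symplectic case.\<close>

lemma hermitian_target_isometry:
  assumes F: "F \<in> M" "conj_mat F = F" "F * F = h \<cdot>\<^sub>m 1\<^sub>m N" "F\<^sup>T = h \<cdot>\<^sub>m F" and h: "h = 1 \<or> h = -1"
    and S: "S \<in> M" "det S \<noteq> 0" "adj S = S" "isometry F S"
  shows "\<exists>W\<in>M. \<exists>a\<le>N. isometry F W \<and> det W = (- 1) ^ (N - a) \<and>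
    (\<forall>s W'. s = 1 \<or> s = -1 \<longrightarrow> W' \<in> M \<longrightarrow> adj W' = W' \<longrightarrow> W' * W' = 1\<^sub>m N \<longrightarrow> W'\<^sup>T * F * W' = F \<longrightarrow>
      mat_trace W' = s * (2 * of_nat a - of_nat N) \<longrightarrow>
      (\<exists>Q\<in>M. det Q \<noteq> 0 \<and> Q\<^sup>T * F * Q = F \<and> adj Q * W' * Q = s \<cdot>\<^sub>m S))"
proof -
  obtain T W where T: "T \<in> M" "adj T = T" "det T \<noteq> 0" and STW: "S = T * W * T"
    and W: "W \<in> M" "adj W = 1 \<cdot>\<^sub>m W" "W * W = 1 \<cdot>\<^sub>m 1\<^sub>m N"
    and fm: "\<forall>F\<in>M. isometry F S \<longrightarrow> T\<^sup>T * F * T = F \<and> W\<^sup>T * F * W = F"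
    using polar_normalisation[OF S(1,2), of 1] S(3) by (auto simp: smult_one)
  have TF: "isometry F T" and WF: "isometry F W" using fm F(1) S(4) by auto
  have W1: "W \<in> M" "adj W = W" "W * W = 1\<^sub>m N" using W by (simp_all add: smult_one)
  obtain a where a: "a \<le> N" "mat_trace W = 2 * of_nat a - of_nat N" "det W = (- 1) ^ (N - a)"
    using hermitian_involution_signature[OF W1] by blast
  have "\<exists>Q\<in>M. det Q \<noteq> 0 \<and> Q\<^sup>T * F * Q = F \<and> adj Q * W' * Q = s \<cdot>\<^sub>m S"
    if s: "s = 1 \<or> s = -1" and W': "W' \<in> M" "adj W' = W'" "W' * W' = 1\<^sub>m N" and W'F: "isometry F W'"
      and tr: "mat_trace W' = s * (2 * of_nat a - of_nat N)" for s W'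
  proof -
    have sW: "s \<cdot>\<^sub>m W \<in> M" "adj (s \<cdot>\<^sub>m W) = 1 \<cdot>\<^sub>m (s \<cdot>\<^sub>m W)" "(s \<cdot>\<^sub>m W) * (s \<cdot>\<^sub>m W) = 1 \<cdot>\<^sub>m 1\<^sub>m N"
      using hermitian_involution_sign[OF W1 s] by auto
    have W'1: "W' \<in> M" "adj W' = 1 \<cdot>\<^sub>m W'" "W' * W' = 1 \<cdot>\<^sub>m 1\<^sub>m N" using W' by (simp_all add: smult_one)
    have "s * s = 1" using s by auto
    then have sWF: "(s \<cdot>\<^sub>m W)\<^sup>T * F * (s \<cdot>\<^sub>m W) = F" using WF W(1) F(1) by (simp add: mat_simps)
    have "mat_trace (s \<cdot>\<^sub>m W) = mat_trace W'" using a(2) tr W(1) by (simp add: mat_trace_smult[of _ N])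
    from sesquilinear_normal_form_isometry[OF F h T TF scaled_congruence[OF T(1) W(1) STW] sW sWF W'1 W'F _ this]
    show ?thesis by simp
  qed
  then show ?thesis using W(1) WF a(1,3) by blast
qed

text \<open>Composing the change of basis with a sign matrix \<open>E\<close> that preserves the normal form up to a sign
does not alter the normal form, but it may alter the determinant.\<close>

lemma sign_change:
  assumes E: "E \<in> M" "adj E = E" "E\<^sup>T = E" "E * E = 1\<^sub>m N" "E * W * E = t \<cdot>\<^sub>m W" and t: "t = 1 \<or> t = -1" and W: "W \<in> M"
    and Q: "Q \<in> M" "Q\<^sup>T * Q = 1\<^sub>m N" and A: "A \<in> M" and B: "unitary_for W (Q * A * ginv Q)"
  shows "unitary_for W ((E * Q) * A * ginv (E * Q))"
proof -
  have d: "det Q \<noteq> 0" using Q det_M_mult[of "Q\<^sup>T" Q] by (auto simp: transpose_M)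
  have dE: "det E \<noteq> 0" by (rule det_nonzero_if_inverse[OF E(1,1,4)])
  have gE: "ginv E = E" by (rule ginv_eq[OF E(1,1,4)])
  have tt: "t * t = 1" using t by auto
  let ?B = "Q * A * ginv Q"
  have BM: "?B \<in> M" using Q A ginv(1)[OF Q(1) d] by simp
  have e: "(E * Q) * A * ginv (E * Q) = E * ?B * E"
    unfolding ginv_mult[OF E(1) dE Q(1) d] gE using E(1) Q(1) A ginv(1)[OF Q(1) d] by (simp add: mat_simps)
  have "adj (E * ?B * E) = E * adj ?B * E"
  proof -
    define B where "B = ?B"
    have "B \<in> M" using BM by (simp add: B_def)
    moreover have "conj_mat E = E" using E(2,3) by (metis transpose_transpose)
    ultimately show ?thesis unfolding B_def[symmetric] using E(1,3) by (simp add: mat_simps)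
  qed
  then have "adj (E * ?B * E) * W * (E * ?B * E) = E * (adj ?B * (E * W * E) * ?B) * E"
    using E(1) BM W by (simp add: assoc_M mult_M transpose_M conj_M del: conj_mult_M transpose_mult_M)
  also have "\<dots> = t \<cdot>\<^sub>m (E * (adj ?B * W * ?B) * E)"
    unfolding E(5) using E(1) BM W by (simp add: assoc_M mult_M transpose_M conj_M smult_left smult_right smult_M)
  also have "\<dots> = W" unfolding B E(5) by (simp add: smult_smult tt smult_one)
  finally show ?thesis unfolding e .
qed

end

context irreducible_matrix_set
begin

lemma normal_form_transfer:
  assumes Q: "Q \<in> M" "det Q \<noteq> 0" "adj Q * W * Q = s \<cdot>\<^sub>m S" and W: "W \<in> M" and S: "S \<in> M" "\<forall>A\<in>\<A>. unitary_for S A"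
    and A: "A \<in> \<A>"
  shows "unitary_for W (Q * A * ginv Q)"
proof (rule sesquilinear_transfer[OF \<A>M[OF A] smult_M[OF S(1)] W Q(1) ginv(1)[OF Q(1,2)] ginv(2)[OF Q(1,2)] _ Q(3)])
  have e: "unitary_for S A" using S(2) A by blast
  have "adj A * (s \<cdot>\<^sub>m S) * A = s \<cdot>\<^sub>m (adj A * S * A)" using S(1) \<A>M[OF A] by (simp add: mat_simps)
  then show "adj A * (s \<cdot>\<^sub>m S) * A = s \<cdot>\<^sub>m S" unfolding e .
qed

theorem unitary_form:
  assumes form: "P \<in> M" "det P \<noteq> 0" "\<forall>A\<in>\<A>. unitary_for P A"
  shows "\<exists>Q\<in>M. det Q \<noteq> 0 \<and> (\<exists>p q. q \<le> p \<and> p + q = N \<and>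
    (\<forall>A\<in>\<A>. unitary_for (I_mat p q) (Q * A * ginv Q)))"
proof -
  have P: "P \<in> M" "det P \<noteq> 0" "\<And>A. A \<in> \<A> \<Longrightarrow> unitary_for P A" using form by auto
  obtain S where S: "S \<in> M" "det S \<noteq> 0" "adj S = S" "\<forall>A\<in>\<A>. unitary_for S A"
    using hermitian_invariant_form[OF P] by blast
  obtain a where a: "a \<le> N" and main: "\<forall>s W'. s = 1 \<or> s = -1 \<longrightarrow> W' \<in> M \<longrightarrow> adj W' = W' \<longrightarrow> W' * W' = 1\<^sub>m N \<longrightarrow>
      mat_trace W' = s * (2 * of_nat a - of_nat N) \<longrightarrow> (\<exists>Q\<in>M. det Q \<noteq> 0 \<and> adj Q * W' * Q = s \<cdot>\<^sub>m S)"
    using hermitian_target[OF S(1-3)] by blast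
  obtain s p q where s: "s = 1 \<or> s = (-1 :: complex)" "q \<le> p" "p + q = N" "s * (2 * of_nat a - of_nat N) = of_nat p - of_nat q"
    using balance_signature[OF a] by blast
  have I: "I_mat p q = signs N {..<p}" using s(3) by (simp add: I_mat_signs)
  have "mat_trace (I_mat p q) = s * (2 * of_nat a - of_nat N)"
    unfolding s(4) I using s(3) mat_trace_signs[of "{..<p}"] by (auto simp: algebra_simps)
  then obtain Q where Q: "Q \<in> M" "det Q \<noteq> 0" "adj Q * I_mat p q * Q = s \<cdot>\<^sub>m S"
    using main s(1) signs_facts[of N "{..<p}"] unfolding I by metis
  have IM: "I_mat p q \<in> M" unfolding I by (rule signs_facts)
  show ?thesis
    by (intro bexI[of _ Q] conjI exI[of _ p] exI[of _ q] ballI normal_form_transfer[OF Q IM S(1,4)] Q(1,2) s(2,3))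
qed

text \<open>The Hermitian case leads to a signature, and the skew-Hermitian case to a quaternionic structure. In the latter
the size is even because \<open>S\<close> times its conjugate is \<open>- 1\<close>.\<close>

theorem orthogonal_form:
  assumes isometries: "\<forall>A\<in>\<A>. A\<^sup>T * A = 1\<^sub>m N"
    and form: "P \<in> M" "det P \<noteq> 0" "\<forall>A\<in>\<A>. unitary_for P A"
  shows "\<exists>Q\<in>M. Q\<^sup>T * Q = 1\<^sub>m N \<and>
    ((\<exists>p q. q \<le> p \<and> p + q = N \<and> (\<forall>A\<in>\<A>. unitary_for (I_mat p q) (Q * A * ginv Q))) \<or>
     (\<exists>m. N = 2 * m \<and> (\<forall>A\<in>\<A>. unitary_for (J_mat m) (Q * A * ginv Q))))"
proof -
  have P: "P \<in> M" "det P \<noteq> 0" "\<And>A. A \<in> \<A> \<Longrightarrow> unitary_for P A" using form by auto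
  note O = bspec[OF isometries]
  have F: "1\<^sub>m N \<in> M" "conj_mat (1\<^sub>m N) = 1\<^sub>m N" "1\<^sub>m N * 1\<^sub>m N = 1 \<cdot>\<^sub>m (1\<^sub>m N :: complex mat)" "(1\<^sub>m N)\<^sup>T = 1 \<cdot>\<^sub>m (1\<^sub>m N :: complex mat)"
    by (simp_all add: mat_simps)
  have F1: "X\<^sup>T * 1\<^sub>m N * X = X\<^sup>T * X" if "X \<in> M" for X :: "complex mat" using that by (simp add: mat_simps)
  obtain S e where S: "S \<in> M" "det S \<noteq> 0" "adj S = e \<cdot>\<^sub>m S" "isometry (1\<^sub>m N) S" "\<forall>A\<in>\<A>. unitary_for S A"
    and e: "e = 1 \<or> e = -1"
    using isometric_invariant_form[OF F _ _ P] O \<A>M by (auto simp: F1)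
  from e show ?thesis
  proof
    assume e: "e = 1"
    then have S3: "adj S = S" using S(3) by (simp add: smult_one)
    obtain W a where a: "a \<le> N" and main: "\<forall>s W'. s = 1 \<or> s = -1 \<longrightarrow> W' \<in> M \<longrightarrow> adj W' = W' \<longrightarrow> W' * W' = 1\<^sub>m N \<longrightarrow>
      isometry (1\<^sub>m N) W' \<longrightarrow> mat_trace W' = s * (2 * of_nat a - of_nat N) \<longrightarrow>
      (\<exists>Q\<in>M. det Q \<noteq> 0 \<and> Q\<^sup>T * 1\<^sub>m N * Q = 1\<^sub>m N \<and> adj Q * W' * Q = s \<cdot>\<^sub>m S)"
      using hermitian_target_isometry[OF F _ S(1,2) S3 S(4)] by blast
    obtain s p q where s: "s = 1 \<or> s = (-1 :: complex)" "q \<le> p" "p + q = N" "s * (2 * of_nat a - of_nat N) = of_nat p - of_nat q"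
      using balance_signature[OF a] by blast
    have I: "I_mat p q = signs N {..<p}" using s(3) by (simp add: I_mat_signs)
    have IM: "I_mat p q \<in> M" unfolding I by (rule signs_facts)
    have "mat_trace (I_mat p q) = s * (2 * of_nat a - of_nat N)"
      unfolding s(4) I using s(3) mat_trace_signs[of "{..<p}"] by (auto simp: algebra_simps)
    moreover have "(I_mat p q)\<^sup>T * 1\<^sub>m N * I_mat p q = 1\<^sub>m N"
      unfolding F1[OF IM] unfolding I signs_facts ..
    moreover have "adj (I_mat p q) = I_mat p q" "I_mat p q * I_mat p q = 1\<^sub>m N"
      unfolding I by (rule signs_adj signs_facts)+
    ultimately obtain Q where Q: "Q \<in> M" "det Q \<noteq> 0" "isometry (1\<^sub>m N) Q" "adj Q * I_mat p q * Q = s \<cdot>\<^sub>m S"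
      using main s(1) IM by blast
    have "Q\<^sup>T * Q = 1\<^sub>m N" using Q(1,3) F1 by simp
    then show ?thesis
      by (intro bexI[of _ Q] conjI disjI1 exI[of _ p] exI[of _ q] ballI normal_form_transfer[OF Q(1,2,4) IM S(1,5)] Q(1) s(2,3))
  next
    assume e: "e = -1"
    have "S * conj_mat S = (- 1) \<cdot>\<^sub>m 1\<^sub>m N"
    proof -
      have "S * S\<^sup>T = 1\<^sub>m N" by (rule isometry_transpose_one) (use S F1 in auto)
      then have "conj_mat (S * S\<^sup>T) = 1\<^sub>m N" by (simp add: conj_one)
      then have "conj_mat S * adj S = 1\<^sub>m N" using S(1) by (simp add: mat_simps)
      then have "(- 1) \<cdot>\<^sub>m (conj_mat S * S) = 1\<^sub>m N" unfolding S(3) e using S(1) by (simp add: mat_simps)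
      then have "conj_mat ((- 1) \<cdot>\<^sub>m (conj_mat S * S)) = 1\<^sub>m N" by (simp add: conj_one)
      then have "(- 1) \<cdot>\<^sub>m (S * conj_mat S) = 1\<^sub>m N" using S(1) by (simp add: mat_simps)
      then have "(- 1) \<cdot>\<^sub>m ((- 1) \<cdot>\<^sub>m (S * conj_mat S)) = (- 1) \<cdot>\<^sub>m 1\<^sub>m N" by simp
      then show ?thesis by (simp add: smult_smult smult_one)
    qed
    then have "det (S * conj_mat S) = (- 1) ^ N" by (simp add: det_smult)
    moreover have "det (S * conj_mat S) = det S * cnj (det S)" using S(1) by (simp add: det_M_mult det_conj)
    ultimately have "(- 1) ^ N = det S * cnj (det S)" by simp
    then have "even N" by (rule even_if_sign_eq_norm)
    then obtain m where m: "N = 2 * m" by blast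
    have JM: "J_mat m \<in> M" and JJ: "J_mat m * J_mat m = (- 1) \<cdot>\<^sub>m 1\<^sub>m N"
      using J_carrier[of m] J_square[of m] by (simp_all add: m)
    have J1: "(J_mat m)\<^sup>T * 1\<^sub>m N * J_mat m = 1\<^sub>m N"
      unfolding F1[OF JM] J_transpose uminus_smult using JM JJ by (simp add: mat_simps)
    have S3: "adj S = (- 1) \<cdot>\<^sub>m S" using S(3) e by simp
    obtain Q where Q: "Q \<in> M" "det Q \<noteq> 0" "isometry (1\<^sub>m N) Q" "adj Q * J_mat m * Q = S"
      using skew_hermitian_target[OF F _ _ S(1,2) S3 S(4) JM J_adj JJ J1] by auto
    have Q4: "adj Q * J_mat m * Q = 1 \<cdot>\<^sub>m S" using Q(4) by (simp add: smult_one)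
    have "Q\<^sup>T * Q = 1\<^sub>m N" using Q(1,3) F1 by simp
    then show ?thesis
      by (intro bexI[of _ Q] conjI disjI2 exI[of _ m] ballI normal_form_transfer[OF Q(1,2) Q4 JM S(1,5)] m Q(1))
  qed
qed

text \<open>In the Hermitian case the unitary part \<open>W\<close> has determinant one, so both eigenvalues have even
multiplicity and \<open>K_mat p q\<close> has the same trace for suitable \<open>p\<close> and \<open>q\<close>. In the skew-Hermitian case the
normal form is \<open>J_mat n\<close>, so the image preserves the same matrix as a bilinear and as a sesquilinear
form, which means that it is real.\<close>

theorem symplectic_form:
  assumes n: "N = 2 * n" and isometries: "\<forall>A\<in>\<A>. isometry (J_mat n) A"
    and form: "P \<in> M" "det P \<noteq> 0" "\<forall>A\<in>\<A>. unitary_for P A"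
  shows "\<exists>Q\<in>M. isometry (J_mat n) Q \<and> det Q = 1 \<and>
    ((\<exists>p q. q \<le> p \<and> p + q = n \<and> (\<forall>A\<in>\<A>. unitary_for (K_mat p q) (Q * A * ginv Q))) \<or>
     (\<forall>A\<in>\<A>. unitary_for (J_mat n) (Q * A * ginv Q)))"
proof -
  have P: "P \<in> M" "det P \<noteq> 0" "\<And>A. A \<in> \<A> \<Longrightarrow> unitary_for P A" using form by auto
  note O = bspec[OF isometries]
  have F: "J_mat n \<in> M" "conj_mat (J_mat n) = J_mat n" "J_mat n * J_mat n = (- 1) \<cdot>\<^sub>m 1\<^sub>m N" "(J_mat n)\<^sup>T = (- 1) \<cdot>\<^sub>m J_mat n"
    using J_carrier[of n] J_square[of n] by (simp_all add: n conj_J J_transpose uminus_smult)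
  have minus: "- 1 = 1 \<or> - 1 = (- 1 :: complex)" by simp
  have dF: "det (J_mat n) \<noteq> 0" by (rule det_J)
  have det1: "det X = 1" if "X \<in> M" "isometry (J_mat n) X" for X
    by (rule det_isometry_alternating[OF F(1) J_transpose dF that])
  obtain S e where S: "S \<in> M" "det S \<noteq> 0" "adj S = e \<cdot>\<^sub>m S" "isometry (J_mat n) S" "\<forall>A\<in>\<A>. unitary_for S A"
    and e: "e = 1 \<or> e = -1"
    using isometric_invariant_form[OF F minus O P] by blast
  from e show ?thesis
  proof
    assume e: "e = 1"
    then have S3: "adj S = S" using S(3) by (simp add: smult_one)
    obtain W a where W: "W \<in> M" "isometry (J_mat n) W" "det W = (- 1) ^ (N - a)"
      and a: "a \<le> N" and main: "\<forall>s W'. s = 1 \<or> s = -1 \<longrightarrow> W' \<in> M \<longrightarrow> adj W' = W' \<longrightarrow> W' * W' = 1\<^sub>m N \<longrightarrow>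
      isometry (J_mat n) W' \<longrightarrow> mat_trace W' = s * (2 * of_nat a - of_nat N) \<longrightarrow>
      (\<exists>Q\<in>M. det Q \<noteq> 0 \<and> Q\<^sup>T * J_mat n * Q = J_mat n \<and> adj Q * W' * Q = s \<cdot>\<^sub>m S)"
      using hermitian_target_isometry[OF F minus S(1,2) S3 S(4)]
      by - (elim bexE exE conjE, rule that, assumption+)
    have "(- 1 :: complex) ^ (N - a) = 1" using det1[OF W(1,2)] W(3) by simp
    then have "even (N - a)" by (metis neg_one_odd_power one_neq_neg_one)
    then have "even a" using a n by (metis dvd_diff_nat dvd_triv_left diff_diff_cancel)
    then obtain b where b: "a = 2 * b" by blast
    obtain s p' q' where s: "s = 1 \<or> s = (-1 :: complex)" "q' \<le> p'" "p' + q' = N"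
      "s * (2 * of_nat a - of_nat N) = of_nat p' - of_nat q'" "p' = a \<or> p' = N - a"
      using balance_signature[OF a] by blast
    have "even p'" using s(5) b \<open>even (N - a)\<close> by auto
    then obtain p where p: "p' = 2 * p" by blast
    obtain q where q: "q' = 2 * q" using s(3) p n by (metis even_add dvd_triv_left evenE)
    have pq: "q \<le> p" "p + q = n" using s(2,3) p q n by auto
    let ?A = "{..<p} \<union> {p + q..<p + q + p}"
    have K: "K_mat p q = signs N ?A" using pq by (simp add: K_mat_signs n)
    have KM: "K_mat p q \<in> M" unfolding K by (rule signs_facts)
    have cA: "card ?A = 2 * p" using pq by (subst card_Un_disjoint) auto
    have "mat_trace (K_mat p q) = 2 * of_nat (2 * p) - of_nat N"
      unfolding K cA[symmetric] using pq n by (intro mat_trace_signs) auto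
    also have "\<dots> = s * (2 * of_nat a - of_nat N)"
      unfolding s(4) using pq n p q by (auto simp: algebra_simps)
    finally have tr: "mat_trace (K_mat p q) = s * (2 * of_nat a - of_nat N)" .
    have "(K_mat p q)\<^sup>T * J_mat n * K_mat p q = J_mat n" using K_isometry_J[of p q] pq by simp
    moreover have "adj (K_mat p q) = K_mat p q" "K_mat p q * K_mat p q = 1\<^sub>m N"
      unfolding K by (rule signs_adj signs_facts)+
    ultimately obtain Q where Q: "Q \<in> M" "det Q \<noteq> 0" "isometry (J_mat n) Q" "adj Q * K_mat p q * Q = s \<cdot>\<^sub>m S"
      using main s(1) KM tr by blast
    show ?thesis
      by (intro bexI[of _ Q] conjI disjI1 exI[of _ p] exI[of _ q] ballI normal_form_transfer[OF Q(1,2,4) KM S(1,5)]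
          Q(1,3) det1[OF Q(1,3)] pq)
  next
    assume e: "e = -1"
    have S3: "adj S = (- 1) \<cdot>\<^sub>m S" using S(3) e by simp
    have JJJ: "(J_mat n)\<^sup>T * J_mat n * J_mat n = J_mat n"
      unfolding F(4) using F(1,3) by (simp add: mat_simps)
    obtain Q where Q: "Q \<in> M" "det Q \<noteq> 0" "isometry (J_mat n) Q" "adj Q * J_mat n * Q = S"
      using skew_hermitian_target[OF F dF minus S(1,2) S3 S(4) F(1) J_adj F(3) JJJ] by auto
    have Q4: "adj Q * J_mat n * Q = 1 \<cdot>\<^sub>m S" using Q(4) by (simp add: smult_one)
    show ?thesis
      by (intro bexI[of _ Q] conjI disjI2 ballI normal_form_transfer[OF Q(1,2) Q4 F(1) S(1,5)] Q(1,3) det1[OF Q(1,3)])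
  qed
qed

end

section \<open>Matrix description of the real forms\<close>

lemma cgroup_set_subset_GL: "A \<in> cgroup_set F n \<Longrightarrow> A \<in> carrier (GL (mat_size F n))"
  using subgroup.subset[OF subgroup_cgroup] by auto

lemma cgroup_set_conjugate:
  assumes "Q \<in> cgroup_set F n" "A \<in> cgroup_set F n"
  shows "Q * A * inv\<^bsub>GL (mat_size F n)\<^esub> Q \<in> cgroup_set F n"
proof -
  interpret subgroup "cgroup_set F n" "GL (mat_size F n)" by (rule subgroup_cgroup)
  have "Q \<otimes>\<^bsub>GL (mat_size F n)\<^esub> A \<otimes>\<^bsub>GL (mat_size F n)\<^esub> inv\<^bsub>GL (mat_size F n)\<^esub> Q \<in> cgroup_set F n"
    using assms by (intro m_closed m_inv_closed)
  then show ?thesis by (simp add: GL_ops)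
qed

lemma real_entries_iff_conj: "real_entries A \<longleftrightarrow> conj_mat A = A"
proof
  assume r: "real_entries A"
  show "conj_mat A = A"
  proof (rule eq_matI)
    fix i j assume "i < dim_row A" "j < dim_col A"
    then have "A $$ (i,j) \<in> elements_mat A"
      by (intro elements_matI[of A "dim_row A" "dim_col A" i j]) auto
    then have "A $$ (i,j) \<in> \<real>" using r by (auto simp: real_entries_def)
    then show "conj_mat A $$ (i,j) = A $$ (i,j)"
      using \<open>i < dim_row A\<close> \<open>j < dim_col A\<close> by (simp add: Reals_cnj_iff)
  qed auto
next
  assume c: "conj_mat A = A"
  show "real_entries A" unfolding real_entries_def
  proof
    fix x assume "x \<in> elements_mat A"
    then obtain i j where ij: "i < dim_row A" "j < dim_col A" "x = A $$ (i,j)" by (auto simp: elements_mat_def)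
    then have "cnj x = x" using arg_cong[OF c, of "\<lambda>X. X $$ (i,j)"] by simp
    then show "x \<in> \<real>" by (simp add: Reals_cnj_iff)
  qed
qed

context square_mats
begin

text \<open>For an orthogonal matrix the inverse of the adjoint is the conjugate.\<close>

lemma orthogonal_unitary_twist:
  assumes B: "B \<in> M" "B\<^sup>T * B = 1\<^sub>m N" "unitary_for J B" and J: "J \<in> M"
  shows "J * B = conj_mat B * J"
proof -
  have "conj_mat (B * B\<^sup>T) = 1\<^sub>m N" using isometry_transpose_one[OF B(1,2)] by (simp add: conj_one)
  then have c: "conj_mat B * adj B = 1\<^sub>m N" using B(1) by (simp add: mat_simps)
  have "conj_mat B * (adj B * J * B) = J * B" using B(1) J cancel[OF c] by (simp add: mat_simps)
  then show ?thesis unfolding B(3) ..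
qed

end

text \<open>The square of \<open>D_mat p q\<close> is \<open>I_mat p q\<close> and its inverse is its conjugate. So conjugation by it turns the
twisted reality condition given by \<open>I_mat p q\<close> into reality, and the standard bilinear form into
\<open>I_mat p q\<close>.\<close>

lemma O_std_member:
  assumes B: "B \<in> carrier_mat (p + q) (p + q)" "B\<^sup>T * B = 1\<^sub>m (p + q)" "adj B * I_mat p q * B = I_mat p q"
  shows "\<exists>X\<in>O_pq p q. det X = det B \<and> B = D_mat p q * X * inv\<^bsub>GL (p + q)\<^esub> (D_mat p q)"
proof -
  define N where "N = p + q"
  interpret square_mats N .
  let ?I = "I_mat p q" and ?D = "D_mat p q"
  define C where "C = mat_diag N (\<lambda>i. if i < p then 1 else - \<i>)"
  have I: "?I = signs N {..<p}" by (simp add: I_mat_signs N_def)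
  have D: "?D = mat_diag N (\<lambda>i. if i < p then 1 else \<i>)"
    unfolding D_mat_def N_def by (rule eq_matI) (auto simp: mat_diag_def)
  have M: "B \<in> M" "?I \<in> M" "?D \<in> M" "C \<in> M" using B(1) by (simp_all add: I D C_def N_def)
  have diag: "mat_diag N f = mat_diag N g" if "\<And>i. f i = g i" for f g :: "nat \<Rightarrow> complex"
    using that by presburger
  have one: "1\<^sub>m N = mat_diag N (\<lambda>i. 1 :: complex)" by simp
  have r: "?D * C = 1\<^sub>m N" "C * ?D = 1\<^sub>m N" "?I * C = ?D" "?D * ?I = C" "?D * ?D = ?I" "C * (?I * C) = 1\<^sub>m N"
    unfolding D C_def I one mat_diag_diag by (intro diag; simp)+
  have t: "conj_mat ?D = C" "conj_mat C = ?D" "?D\<^sup>T = ?D" "C\<^sup>T = C"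
    unfolding D C_def by (intro eq_matI; auto simp: mat_diag_def)+
  have inv: "inv\<^bsub>GL N\<^esub> ?D = C" by (rule GL_inv_unique(2)[OF M(3,4) r(2)])
  define X where "X = C * B * ?D"
  have X: "X \<in> M" using M by (simp add: X_def)
  have IB: "?I * B = conj_mat B * ?I"
    by (rule orthogonal_unitary_twist) (use B M in \<open>simp_all add: N_def\<close>)
  have "conj_mat X * ?D = ?D * conj_mat B"
    unfolding X_def using M r by (simp add: mat_simps t)
  also have "\<dots> = ?D * (conj_mat B * (?I * ?I))"
    unfolding I signs_facts using M by (simp add: mat_simps)
  also have "\<dots> = ?D * (?I * (B * ?I))" using M rewrite_prefix[OF IB[symmetric]] by (simp add: mat_simps)
  also have "\<dots> = X * ?D" unfolding X_def using M r(5) rewrite_prefix[OF r(4) M(3,2)] by (simp add: mat_simps)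
  finally have "conj_mat X = X"
    by (rule mult_right_cancel[OF M(3) conj_M[OF X] X, rotated]) (rule det_nonzero_if_inverse[OF M(3,4) r(1)])
  then have real: "real_entries X" by (simp add: real_entries_iff_conj)
  have dB: "det C * det ?D = 1" using det_M_mult[OF M(4,3)] r(2) by simp
  have detX: "det X = det B" unfolding X_def using M dB by (simp add: det_M_mult mult_M del: assoc_mult_mat)
  have "det B \<noteq> 0" using det_M_mult[of "B\<^sup>T" B] M(1) B(2) by (auto simp: N_def)
  then have GLX: "X \<in> GL_R N" using X real detX by (simp add: GL_R_def GL_C_def GL_carrier)
  have "X\<^sup>T * ?I * X = ?D * (B\<^sup>T * ((C * (?I * C)) * (B * ?D)))"
    unfolding X_def using M by (simp add: mat_simps t)
  also have "\<dots> = ?D * (B\<^sup>T * (B * ?D))" unfolding r(6) using M by (simp add: mat_simps)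
  also have "\<dots> = ?I" using M r(5) cancel[of "B\<^sup>T" B "?D"] B(2) by (simp add: N_def)
  finally have "X \<in> O_pq p q" using GLX by (simp add: O_pq_def N_def)
  moreover have "B = ?D * X * C" unfolding X_def using M r(1) cancel[OF r(1)] by (simp add: mat_simps)
  ultimately show ?thesis using detX inv by (auto simp: N_def)
qed

section \<open>Conjugation into a real form\<close>

lemma conjugate_into_real_form:
  assumes \<Gamma>: "group \<Gamma>" and h: "\<rho> \<in> hom \<Gamma> (cgroup F n)"
    and H: "H \<in> real_forms P0 F n" and P: "P \<in> cgroup_set F n"
    and mem: "\<And>\<gamma>. \<gamma> \<in> carrier \<Gamma> \<Longrightarrow> P * \<rho> \<gamma> * inv\<^bsub>GL (mat_size F n)\<^esub> P \<in> H"
  shows "\<exists>H\<in>real_forms P0 F n. \<exists>\<sigma>\<in>hom \<Gamma> ((cgroup F n)\<lparr>carrier := H\<rparr>). \<exists>P\<in>carrier (cgroup F n).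
           \<forall>\<gamma>\<in>carrier \<Gamma>. P * \<rho> \<gamma> * inv\<^bsub>cgroup F n\<^esub> P = \<sigma> \<gamma>"
proof -
  define N where "N = mat_size F n"
  interpret square_mats N .
  have PG: "P \<in> carrier (cgroup F n)" using P by (simp add: cgroup_def)
  have PM: "P \<in> M" "det P \<noteq> 0" using cgroup_set_subset_GL[OF P] by (simp_all add: GL_carrier N_def)
  let ?\<sigma> = "\<lambda>\<gamma>. P * \<rho> \<gamma> * inv\<^bsub>GL (mat_size F n)\<^esub> P"
  have "?\<sigma> \<in> hom \<Gamma> ((cgroup F n)\<lparr>carrier := H\<rparr>)"
  proof (rule homI)
    show "?\<sigma> x \<in> carrier ((cgroup F n)\<lparr>carrier := H\<rparr>)" if "x \<in> carrier \<Gamma>" for x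
      using mem[OF that] by simp
    fix x y assume xy: "x \<in> carrier \<Gamma>" "y \<in> carrier \<Gamma>"
    have c: "\<rho> x \<in> M" "\<rho> y \<in> M" using hom_cgroup(3)[OF \<Gamma> h] xy by (auto simp: GL_carrier N_def)
    have "?\<sigma> (x \<otimes>\<^bsub>\<Gamma>\<^esub> y) = ?\<sigma> x * ?\<sigma> y"
      unfolding hom_cgroup(4)[OF \<Gamma> h xy] N_def[symmetric]
      using c PM(1) ginv[OF PM] cancel[OF ginv(3)[OF PM]] by (simp add: mat_simps)
    then show "?\<sigma> (x \<otimes>\<^bsub>\<Gamma>\<^esub> y) = ?\<sigma> x \<otimes>\<^bsub>(cgroup F n)\<lparr>carrier := H\<rparr>\<^esub> ?\<sigma> y"
      by (simp add: cgroup_ops)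
  qed
  then show ?thesis using H PG cgroup_inv[OF PG] by (intro bexI[of _ H] bexI[of _ ?\<sigma>] bexI[of _ P]) auto
qed

context irreducible_matrix_set
begin

text \<open>All three conditions are unchanged when \<open>Q\<close> is multiplied by a scalar, so \<open>Q\<close> may be chosen in \<open>SL\<close>.\<close>

lemma linear_case:
  assumes P: "P \<in> M" "det P \<noteq> 0"
    and c: "(\<forall>A\<in>\<A>. conj_mat A * P = P * A) \<or> (\<forall>A\<in>\<A>. unitary_for P A)"
  shows "\<exists>Q\<in>M. det Q = 1 \<and>
    ((\<forall>A\<in>\<A>. conj_mat (Q * A * ginv Q) = Q * A * ginv Q) \<or>
     (\<exists>m. N = 2 * m \<and> (\<forall>A\<in>\<A>. (Q * A * ginv Q) * J_mat m = J_mat m * conj_mat (Q * A * ginv Q))) \<or>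
     (\<exists>p q. q \<le> p \<and> p + q = N \<and> (\<forall>A\<in>\<A>. unitary_for (I_mat p q) (Q * A * ginv Q))))"
proof -
  define C where "C f \<longleftrightarrow> (\<forall>A\<in>\<A>. conj_mat (f A) = f A) \<or>
     (\<exists>m. N = 2 * m \<and> (\<forall>A\<in>\<A>. f A * J_mat m = J_mat m * conj_mat (f A))) \<or>
     (\<exists>p q. q \<le> p \<and> p + q = N \<and> (\<forall>A\<in>\<A>. adj (f A) * I_mat p q * f A = I_mat p q))"
    for f :: "complex mat \<Rightarrow> complex mat"
  have "\<exists>Q\<in>M. det Q \<noteq> 0 \<and> C (\<lambda>A. Q * A * ginv Q)"
    using c
  proof
    assume "\<forall>A\<in>\<A>. conj_mat A * P = P * A"
    then have "\<exists>Q\<in>M. det Q \<noteq> 0 \<and> ((\<forall>A\<in>\<A>. conj_mat (Q * A * ginv Q) = Q * A * ginv Q) \<or>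
      (\<exists>m. N = 2 * m \<and> (\<forall>A\<in>\<A>. conj_mat (Q * A * ginv Q) * J_mat m = J_mat m * (Q * A * ginv Q))))"
      by (intro real_or_quaternionic[OF P]) blast
    then obtain Q where Q: "Q \<in> M" "det Q \<noteq> 0"
      and r: "(\<forall>A\<in>\<A>. conj_mat (Q * A * ginv Q) = Q * A * ginv Q) \<or>
      (\<exists>m. N = 2 * m \<and> (\<forall>A\<in>\<A>. conj_mat (Q * A * ginv Q) * J_mat m = J_mat m * (Q * A * ginv Q)))"
      by - (elim bexE conjE, rule that, assumption+)
    from r have "C (\<lambda>A. Q * A * ginv Q)"
    proof (elim disjE exE conjE)
      assume "\<forall>A\<in>\<A>. conj_mat (Q * A * ginv Q) = Q * A * ginv Q"
      then show ?thesis unfolding C_def by (rule disjI1)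
    next
      fix m assume m: "N = 2 * m"
        and q: "\<forall>A\<in>\<A>. conj_mat (Q * A * ginv Q) * J_mat m = J_mat m * (Q * A * ginv Q)"
      have "(Q * A * ginv Q) * J_mat m = J_mat m * conj_mat (Q * A * ginv Q)" if A: "A \<in> \<A>" for A
      proof -
        define B where "B = Q * A * ginv Q"
        have B: "B \<in> M" using Q(1) ginv(1)[OF Q] \<A>M[OF A] by (simp add: B_def)
        have "conj_mat B * J_mat m = J_mat m * B" using q A by (simp add: B_def)
        then have "conj_mat (conj_mat B * J_mat m) = conj_mat (J_mat m * B)" by (simp only:)
        then show ?thesis unfolding B_def[symmetric]
          using B J_carrier[of m] by (simp add: mat_simps m[symmetric] conj_J)
      qed
      then show ?thesis unfolding C_def using m by (intro disjI2 disjI1 exI[of _ m] conjI ballI)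
    qed
    then show ?thesis using Q by (intro bexI[of _ Q] conjI)
  next
    assume "\<forall>A\<in>\<A>. unitary_for P A"
    from unitary_form[OF P this] obtain Q where Q: "Q \<in> M" "det Q \<noteq> 0" and r: "\<exists>p q. q \<le> p \<and> p + q = N \<and>
      (\<forall>A\<in>\<A>. unitary_for (I_mat p q) (Q * A * ginv Q))"
      by - (elim bexE conjE, rule that, assumption+)
    from r have "C (\<lambda>A. Q * A * ginv Q)" unfolding C_def by (intro disjI2)
    then show ?thesis using Q by (intro bexI[of _ Q] conjI)
  qed
  then obtain Q where Q: "Q \<in> M" "det Q \<noteq> 0" and QC: "C (\<lambda>A. Q * A * ginv Q)"
    by - (elim bexE conjE, rule that, assumption+)
  obtain k where k: "k \<noteq> 0" "det (k \<cdot>\<^sub>m Q) = 1" using scale_to_det_one[OF Q N0] by blast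
  have "(k \<cdot>\<^sub>m Q) * A * ginv (k \<cdot>\<^sub>m Q) = Q * A * ginv Q" if "A \<in> \<A>" for A
    by (rule scaled_conjugation[OF Q k(1) \<A>M[OF that]])
  then have "C (\<lambda>A. (k \<cdot>\<^sub>m Q) * A * ginv (k \<cdot>\<^sub>m Q)) = C (\<lambda>A. Q * A * ginv Q)"
    unfolding C_def by (simp cong: ball_cong)
  then have "C (\<lambda>A. (k \<cdot>\<^sub>m Q) * A * ginv (k \<cdot>\<^sub>m Q))" using QC by (simp only:)
  then show ?thesis unfolding C_def using k(2) smult_M[OF Q(1)] by (intro bexI[of _ "k \<cdot>\<^sub>m Q"] conjI)
qed

text \<open>On the isometry group of a real form \<open>F\<close>, the conjugate of \<open>A\<close> and the inverse of \<open>adj A\<close> are intertwined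
by \<open>F\<close>.\<close>

lemma form_from_intertwiner:
  assumes F: "F \<in> M" "conj_mat F = F" "det F \<noteq> 0" and AF: "\<And>A. A \<in> \<A> \<Longrightarrow> A\<^sup>T * F * A = F"
    and P: "P \<in> M" "det P \<noteq> 0"
    and c: "(\<forall>A\<in>\<A>. conj_mat A * P = P * A) \<or> (\<forall>A\<in>\<A>. unitary_for P A)"
  shows "\<exists>P\<in>M. det P \<noteq> 0 \<and> (\<forall>A\<in>\<A>. unitary_for P A)"
  using c
proof
  assume c: "\<forall>A\<in>\<A>. conj_mat A * P = P * A"
  have "adj A * (F * P) * A = F * P" if A: "A \<in> \<A>" for A
  proof -
    note AM = \<A>M[OF A]
    have e: "adj A * F * conj_mat A = F"
      using arg_cong[OF AF[OF A], of conj_mat] AM F(1,2) by (simp add: mat_simps)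
    have "adj A * (F * P) * A = adj A * F * (P * A)" using AM F(1) P(1) by (simp add: mat_simps)
    also have "P * A = conj_mat A * P" using c A by simp
    also have "adj A * F * (conj_mat A * P) = (adj A * F * conj_mat A) * P" using AM F(1) P(1) by (simp add: mat_simps)
    finally show ?thesis unfolding e .
  qed
  moreover have "det (F * P) \<noteq> 0" using F P by (simp add: det_M_mult)
  ultimately show ?thesis using F(1) P(1) by (intro bexI[of _ "F * P"]) auto
qed (use P in blast)

text \<open>For a signature, changing the sign of one basis vector corrects the determinant. For the quaternionic
structure the sign matrix with \<open>m\<close> entries \<open>- 1\<close> maps \<open>J_mat m\<close> to its negative, and it corrects the
determinant if \<open>m\<close> is odd.\<close>

lemma special_orthogonal_case:
  assumes O: "\<forall>A\<in>\<A>. A\<^sup>T * A = 1\<^sub>m N"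
    and P: "P \<in> M" "det P \<noteq> 0" "\<forall>A\<in>\<A>. unitary_for P A"
  shows "\<exists>Q\<in>M. Q\<^sup>T * Q = 1\<^sub>m N \<and>
    ((\<exists>p q. det Q = 1 \<and> q \<le> p \<and> p + q = N \<and> (\<forall>A\<in>\<A>. unitary_for (I_mat p q) (Q * A * ginv Q))) \<or>
     (\<exists>m. (det Q = 1 \<or> det Q = -1 \<and> even m) \<and> N = 2 * m \<and> (\<forall>A\<in>\<A>. unitary_for (J_mat m) (Q * A * ginv Q))))"
proof -
  obtain Q where Q: "Q \<in> M" "Q\<^sup>T * Q = 1\<^sub>m N" and
    C: "((\<exists>p q. q \<le> p \<and> p + q = N \<and> (\<forall>A\<in>\<A>. unitary_for (I_mat p q) (Q * A * ginv Q))) \<or>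
     (\<exists>m. N = 2 * m \<and> (\<forall>A\<in>\<A>. unitary_for (J_mat m) (Q * A * ginv Q))))"
    using orthogonal_form[OF O P]
      by - (elim bexE conjE, rule that, assumption+)
  have "det Q * det Q = 1" using det_M_mult[of "Q\<^sup>T" Q] Q by (simp add: det_transpose[of _ N])
  then have dQ: "det Q = 1 \<or> det Q = -1" by (simp add: square_eq_1_iff)
  have sc: "unitary_for W ((E * Q) * A * ginv (E * Q))"
    if E: "E = signs N Y" and W: "W \<in> M" and t: "E * W * E = t \<cdot>\<^sub>m W" "t = 1 \<or> t = -1"
      and B: "\<forall>A\<in>\<A>. unitary_for W (Q * A * ginv Q)" and A: "A \<in> \<A>" for E Y W t A
  proof (rule sign_change[OF _ _ _ _ t W Q \<A>M[OF A]])
    show "E \<in> M" "adj E = E" "E\<^sup>T = E" "E * E = 1\<^sub>m N" unfolding E by (rule signs_facts signs_adj)+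
    show "unitary_for W (Q * A * ginv Q)" using B A by blast
  qed
  have EQ: "(signs N Y * Q)\<^sup>T * (signs N Y * Q) = 1\<^sub>m N" for Y
    using Q cancel[OF signs_facts(4) signs_facts(1,1) Q(1)] by (simp add: mat_simps signs_facts del: mat_diag_diag)
  have dE: "det (signs N Y) = (- 1) ^ card ({..<N} - Y)" for Y
    unfolding det_mat_diag by (simp add: prod.If_cases Diff_eq)
  have dEQ: "det (signs N Y * Q) = (- 1) ^ card ({..<N} - Y) * det Q" for Y
    by (simp only: det_M_mult signs_facts(1) Q(1) dE)
  from C show ?thesis
  proof (elim disjE exE conjE)
    fix p q assume pq: "q \<le> p" "p + q = N"
      and B: "\<forall>A\<in>\<A>. unitary_for (I_mat p q) (Q * A * ginv Q)"
    show ?thesis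
    proof (cases "det Q = 1")
      case True then show ?thesis using Q pq B by blast
    next
      case False
      then have d: "det Q = -1" using dQ by simp
      \<comment> \<open>The reflection in the first coordinate commutes with \<open>I_mat p q\<close>.\<close>
      let ?E = "signs N {1..}"
      have I: "I_mat p q = signs N {..<p}" using pq by (simp add: I_mat_signs)
      have IM: "I_mat p q \<in> M" unfolding I by (rule signs_facts)
      have "?E * I_mat p q * ?E = I_mat p q"
        unfolding I signs_commute[of N "{1..}" "{..<p}"]
        using signs_facts(1,4)[of N "{1..}"] signs_facts(1)[of N "{..<p}"] by (simp add: mat_simps del: mat_diag_diag)
      then have t: "?E * I_mat p q * ?E = 1 \<cdot>\<^sub>m I_mat p q" by (simp add: smult_one)
      have "{..<N} - {1..} = {0}" using N0 by auto
      then have "det (?E * Q) = 1" unfolding dEQ d by simp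
      moreover have "?E * Q \<in> M" using Q(1) signs_facts(1) by (intro mult_M)
      ultimately show ?thesis using EQ[of "{1..}"] pq sc[OF refl IM t _ B]
        by (intro bexI[of _ "?E * Q"] conjI disjI1 exI[of _ p] exI[of _ q]) auto
    qed
  next
    fix m assume m: "N = 2 * m"
      and B: "\<forall>A\<in>\<A>. unitary_for (J_mat m) (Q * A * ginv Q)"
    show ?thesis
    proof (cases "det Q = 1 \<or> even m")
      case True
      then have d: "det Q = 1 \<or> det Q = -1 \<and> even m" using dQ by blast
      show ?thesis by (rule bexI[of _ Q], rule conjI, rule Q(2), rule disjI2, rule exI[of _ m])
        (rule conjI[OF d conjI[OF m B]], rule Q(1))
    next
      case False
      then have d: "det Q = -1" "odd m" using dQ by simp_all
      \<comment> \<open>This matrix exchanges \<open>J_mat m\<close> with its negative and has determinant \<open>(- 1)\<^sup>m = - 1\<close>.\<close>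
      let ?E = "signs N {..<m}"
      have JM: "J_mat m \<in> M" using J_carrier[of m] by (simp add: m)
      have "?E * J_mat m = J_mat m * signs N {m..}" unfolding m by (rule signs_J) auto
      moreover have "signs N {m..} * ?E = (- 1) \<cdot>\<^sub>m 1\<^sub>m N"
        unfolding mat_diag_diag by (intro eq_matI) (auto simp: mat_diag_def)
      ultimately have t: "?E * J_mat m * ?E = (- 1) \<cdot>\<^sub>m J_mat m"
        using JM signs_facts(1)[of N "{..<m}"] signs_facts(1)[of N "{m..}"] by (simp add: mat_simps del: mat_diag_diag)
      have "card ({..<N} - {..<m}) = m" using m by (subst card_Diff_subset) auto
      then have "det (?E * Q) = 1" unfolding dEQ d(1) using d(2) by simp
      then have dd: "det (?E * Q) = 1 \<or> det (?E * Q) = -1 \<and> even m" by (rule disjI1)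
      have EQM: "?E * Q \<in> M" using Q(1) signs_facts(1) by (intro mult_M)
      have BE: "\<forall>A\<in>\<A>. unitary_for (J_mat m) ((?E * Q) * A * ginv (?E * Q))"
        by (rule ballI[OF sc[OF refl JM t _ B]]) simp
      show ?thesis by (rule bexI[of _ "?E * Q"], rule conjI, rule EQ, rule disjI2, rule exI[of _ m])
        (rule conjI[OF dd conjI[OF m BE]], rule EQM)
    qed
  qed
qed

end

theorem theorem1p1:
  fixes \<Gamma> :: "'g monoid" and S :: "'g set"
    and n :: nat and F :: family
    and \<theta> :: "complex mat \<Rightarrow> complex mat"
    and \<rho> :: "'g \<Rightarrow> complex mat"
    and P0 :: "nat \<Rightarrow> complex mat"
  assumes "n \<ge> 1"
    and "group \<Gamma>"
    and "finite S" and "S \<subseteq> carrier \<Gamma>" and "generate \<Gamma> S = carrier \<Gamma>"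
    and "\<theta> \<in> involutions (mat_size F n)"
    and "\<rho> \<in> hom \<Gamma> (cgroup F n)"
    and "irreducible_rep \<Gamma> (mat_size F n) \<rho>"
    and "Phi \<Gamma> S (mat_size F n) (cgroup F n) \<theta> (chi \<Gamma> S (mat_size F n) (cgroup F n) \<rho>)
         = chi \<Gamma> S (mat_size F n) (cgroup F n) \<rho>"
    and "\<And>m. m \<ge> 1 \<Longrightarrow> P0 m \<in> O_C (4 * m) \<and> det (P0 m) = - 1"
  shows "\<exists>H\<in>real_forms P0 F n. \<exists>\<sigma>\<in>hom \<Gamma> ((cgroup F n)\<lparr>carrier := H\<rparr>). \<exists>P\<in>carrier (cgroup F n).
           \<forall>\<gamma>\<in>carrier \<Gamma>. P * \<rho> \<gamma> * inv\<^bsub>cgroup F n\<^esub> P = \<sigma> \<gamma>"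
proof -
  define N where "N = mat_size F n"
  define \<A> where "\<A> = \<rho> ` carrier \<Gamma>"
  have N0: "N > 0" using assms(1) by (cases F) (auto simp: N_def)
  have G: "\<rho> \<gamma> \<in> cgroup_set F n" if "\<gamma> \<in> carrier \<Gamma>" for \<gamma>
    using hom_in_carrier[OF assms(7) that] by (simp add: cgroup_def)
  have \<A>G: "A \<in> cgroup_set F n" if "A \<in> \<A>" for A using that G by (auto simp: \<A>_def)
  have \<A>GL: "A \<in> carrier (GL N)" if "A \<in> \<A>" for A
    using cgroup_set_subset_GL[OF \<A>G[OF that]] by (simp add: N_def)
  have irr: "irreducible_mats N \<A>"
    unfolding \<A>_def N_def by (rule irreducible_rep_imp_mats[OF assms(8)])
  interpret irreducible_matrix_set N \<A>
    by unfold_locales (use N0 \<A>GL irr in \<open>auto simp: GL_carrier\<close>)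
  obtain P where P: "P \<in> M" "det P \<noteq> 0" and int: "\<forall>\<gamma>\<in>carrier \<Gamma>. \<theta> (\<rho> \<gamma>) * P = P * \<rho> \<gamma>"
    using intertwiner_exists[OF assms(2,4,5,6,7,9,8)] N0 unfolding N_def by blast
  have c: "(\<forall>A\<in>\<A>. conj_mat A * P = P * A) \<or> (\<forall>A\<in>\<A>. unitary_for P A)"
  proof -
    consider "\<theta> = conj_mat" | "\<theta> = (\<lambda>A. ginv ((conj_mat A)\<^sup>T))"
      using assms(6) by (auto simp: involutions_def N_def)
    then show ?thesis
    proof cases
      case 1 then show ?thesis using int by (auto simp: \<A>_def)
    next
      case 2
      have "unitary_for P A" if A: "A \<in> \<A>" for A
      proof -
        note AM = \<A>M[OF A] \<A>det[OF A]
        have aA: "adj A \<in> M" "det (adj A) \<noteq> 0" using AM by (simp_all add: det_adj)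
        have e: "ginv (adj A) * P = P * A" using int A unfolding \<A>_def 2 by auto
        have "adj A * P * A = adj A * (ginv (adj A) * P)" unfolding e using AM aA P by (simp add: assoc_M)
        also have "\<dots> = P" by (rule cancel[OF ginv(2)[OF aA] aA(1) ginv(1)[OF aA] P(1)])
        finally show ?thesis .
      qed
      then show ?thesis by blast
    qed
  qed
  have mem: "Q * A * ginv Q \<in> cgroup_set F n" if "Q \<in> cgroup_set F n" "A \<in> \<A>" for Q A
    using cgroup_set_conjugate[OF that(1) \<A>G[OF that(2)]] by (simp add: N_def)
  have fin: ?thesis if "H \<in> real_forms P0 F n" "Q \<in> cgroup_set F n" "\<And>A. A \<in> \<A> \<Longrightarrow> Q * A * ginv Q \<in> H" for H Q
    by (rule conjugate_into_real_form[OF assms(2,7) that(1,2)]) (use that(3) in \<open>auto simp: \<A>_def N_def\<close>)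
  have linear: ?thesis if F: "F = GL_fam \<or> F = SL_fam"
  proof -
    have n: "N = n" using F by (auto simp: N_def)
    obtain Q where Q: "Q \<in> M" "det Q = 1" and C: "((\<forall>A\<in>\<A>. conj_mat (Q * A * ginv Q) = Q * A * ginv Q) \<or>
     (\<exists>m. N = 2 * m \<and> (\<forall>A\<in>\<A>. (Q * A * ginv Q) * J_mat m = J_mat m * conj_mat (Q * A * ginv Q))) \<or>
     (\<exists>p q. q \<le> p \<and> p + q = N \<and> (\<forall>A\<in>\<A>. unitary_for (I_mat p q) (Q * A * ginv Q))))"
      using linear_case[OF P c]
      by - (elim bexE conjE, rule that, assumption+)
    have QG: "Q \<in> cgroup_set F n"
      using F Q by (auto simp: GL_C_def SL_C_def GL_carrier n[symmetric])
    have BGL: "Q * A * ginv Q \<in> GL_C n" if "A \<in> \<A>" for A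
      using cgroup_set_subset_GL[OF mem[OF QG that], folded N_def] by (simp add: GL_C_def n)
    have BSL: "Q * A * ginv Q \<in> SL_C n" if "A \<in> \<A>" "F = SL_fam" for A
      using mem[OF QG that(1)] that(2) by simp
    from C show ?thesis
    proof (elim disjE exE conjE)
      assume r: "\<forall>A\<in>\<A>. conj_mat (Q * A * ginv Q) = Q * A * ginv Q"
      have "GL_R n \<in> real_forms P0 GL_fam n" "SL_R n \<in> real_forms P0 SL_fam n"
        unfolding real_forms.simps by blast+
      then show ?thesis using F fin[of "GL_R n", OF _ QG] fin[of "SL_R n", OF _ QG] r BGL BSL
        by (auto simp: GL_R_def SL_R_def real_entries_iff_conj simp del: real_forms.simps)
    next
      fix m assume m: "N = 2 * m" and r: "\<forall>A\<in>\<A>. (Q * A * ginv Q) * J_mat m = J_mat m * conj_mat (Q * A * ginv Q)"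
      have GLH: "Q * A * ginv Q \<in> GL_H m" if "A \<in> \<A>" for A
        using r that BGL[OF that] by (simp add: GL_H_def m[symmetric] n)
      have "GL_H m \<in> real_forms P0 GL_fam n" "SL_H m \<in> real_forms P0 SL_fam n"
        unfolding real_forms.simps n[symmetric] using m by blast+
      then show ?thesis using F fin[of "GL_H m", OF _ QG] fin[of "SL_H m", OF _ QG] GLH BSL
        by (auto simp: SL_H_def m[symmetric] n simp del: real_forms.simps)
    next
      fix p q assume pq: "q \<le> p" "p + q = N"
        and r: "\<forall>A\<in>\<A>. unitary_for (I_mat p q) (Q * A * ginv Q)"
      have U: "Q * A * ginv Q \<in> U_pq p q" if "A \<in> \<A>" for A
        using r that BGL[OF that] by (simp add: U_pq_def pq(2) n)
      have "U_pq p q \<in> real_forms P0 GL_fam n" "SU_pq p q \<in> real_forms P0 SL_fam n"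
        unfolding real_forms.simps n[symmetric] using pq by blast+
      then show ?thesis using F fin[of "U_pq p q", OF _ QG] fin[of "SU_pq p q", OF _ QG] U BSL
        by (auto simp: SU_pq_def pq(2) n simp del: real_forms.simps)
    qed
  qed
  have orth: "\<forall>A\<in>\<A>. A\<^sup>T * A = 1\<^sub>m N" if "F = O_fam \<or> F = SO_fam"
    using that \<A>G by (auto simp: N_def O_C_def SO_C_def)
  have orth_form: "\<exists>P\<in>M. det P \<noteq> 0 \<and> (\<forall>A\<in>\<A>. unitary_for P A)" if F: "F = O_fam \<or> F = SO_fam"
    by (rule form_from_intertwiner[OF one_M conj_one _ _ P c]) (use orth[OF F] \<A>M in \<open>auto simp: mat_simps\<close>)
  show ?thesis
  proof (cases F)
    case GL_fam then show ?thesis using linear by simp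
  next
    case SL_fam then show ?thesis using linear by simp
  next
    case O_fam
    have n: "N = n" using O_fam by (simp add: N_def)
    obtain P' where P': "P' \<in> M" "det P' \<noteq> 0" "\<forall>A\<in>\<A>. unitary_for P' A"
      using orth_form O_fam by blast
    obtain Q where Q: "Q \<in> M" "Q\<^sup>T * Q = 1\<^sub>m N" and C: "
      (\<exists>p q. q \<le> p \<and> p + q = N \<and> (\<forall>A\<in>\<A>. unitary_for (I_mat p q) (Q * A * ginv Q))) \<or>
      (\<exists>m. N = 2 * m \<and> (\<forall>A\<in>\<A>. unitary_for (J_mat m) (Q * A * ginv Q)))"
      using orthogonal_form[OF orth[OF disjI1[OF O_fam]] P']
      by - (elim bexE conjE, rule that, assumption+)
    have "det Q \<noteq> 0" using Q det_M_mult[of "Q\<^sup>T" Q] by (auto simp: transpose_M)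
    then have QG: "Q \<in> cgroup_set F n" using Q O_fam by (simp add: O_C_def GL_C_def GL_carrier n)
    have BO: "Q * A * ginv Q \<in> O_C N" if "A \<in> \<A>" for A using mem[OF QG that] O_fam by (simp add: n)
    then have B: "Q * A * ginv Q \<in> M" "(Q * A * ginv Q)\<^sup>T * (Q * A * ginv Q) = 1\<^sub>m N" if "A \<in> \<A>" for A
      using that by (auto simp: O_C_def GL_C_def GL_carrier simp del: transpose_mult)
    from C show ?thesis
    proof (elim disjE exE conjE)
      fix p q assume pq: "q \<le> p" "p + q = N"
        and r: "\<forall>A\<in>\<A>. unitary_for (I_mat p q) (Q * A * ginv Q)"
      show ?thesis
      proof (rule fin[of "O_std p q", OF _ QG])
        show "O_std p q \<in> real_forms P0 F n"
          unfolding O_fam real_forms.simps n[symmetric] using pq by blast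
        fix A assume A: "A \<in> \<A>"
        show "Q * A * ginv Q \<in> O_std p q"
          using O_std_member[of "Q * A * ginv Q" p q] B[OF A] r A unfolding O_std_def conj_set_def pq(2) by blast
      qed
    next
      fix m assume m: "N = 2 * m" and r: "\<forall>A\<in>\<A>. unitary_for (J_mat m) (Q * A * ginv Q)"
      have JM: "J_mat m \<in> M" using J_carrier[of m] by (simp add: m)
      show ?thesis
      proof (rule fin[of "O_H m", OF _ QG])
        show "O_H m \<in> real_forms P0 F n"
          unfolding O_fam real_forms.simps n[symmetric] using m by blast
        fix A assume A: "A \<in> \<A>"
        show "Q * A * ginv Q \<in> O_H m"
          using orthogonal_unitary_twist[OF B[OF A] _ JM] r A BO[OF A] unfolding O_H_def m[symmetric] by blast
      qed
    qed
  next
    case SO_fam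
    have n: "N = n" using SO_fam by (simp add: N_def)
    obtain P' where P': "P' \<in> M" "det P' \<noteq> 0" "\<forall>A\<in>\<A>. unitary_for P' A"
      using orth_form SO_fam by blast
    obtain Q where Q: "Q \<in> M" "Q\<^sup>T * Q = 1\<^sub>m N" and C: "
      (\<exists>p q. det Q = 1 \<and> q \<le> p \<and> p + q = N \<and> (\<forall>A\<in>\<A>. unitary_for (I_mat p q) (Q * A * ginv Q))) \<or>
      (\<exists>m. (det Q = 1 \<or> det Q = -1 \<and> even m) \<and> N = 2 * m \<and> (\<forall>A\<in>\<A>. unitary_for (J_mat m) (Q * A * ginv Q)))"
      using special_orthogonal_case[OF orth[OF disjI2[OF SO_fam]] P']
      by - (elim bexE conjE, rule that, assumption+)
    have dQ: "det Q \<noteq> 0" using Q det_M_mult[of "Q\<^sup>T" Q] by (auto simp: transpose_M)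
    have QO: "Q \<in> cgroup_set O_fam n" using Q dQ by (simp add: O_C_def GL_C_def GL_carrier n)
    have \<A>O: "A \<in> cgroup_set O_fam n" "det A = 1" if "A \<in> \<A>" for A
      using \<A>G[OF that] SO_fam by (auto simp: SO_C_def SL_C_def)
    have BO: "Q * A * ginv Q \<in> O_C N" if "A \<in> \<A>" for A
      using cgroup_set_conjugate[OF QO \<A>O(1)[OF that]] by (simp add: n)
    then have B: "Q * A * ginv Q \<in> M" "(Q * A * ginv Q)\<^sup>T * (Q * A * ginv Q) = 1\<^sub>m N" if "A \<in> \<A>" for A
      using that by (auto simp: O_C_def GL_C_def GL_carrier simp del: transpose_mult)
    have dB: "det (Q * A * ginv Q) = 1" if A: "A \<in> \<A>" for A
    proof -
      have "det (Q * A * ginv Q) = det Q * det (ginv Q) * det A"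
        using Q(1) \<A>M[OF A] ginv(1)[OF Q(1) dQ] by (simp add: det_M_mult mult_M mult_ac del: assoc_mult_mat)
      also have "det Q * det (ginv Q) = 1"
        using det_M_mult[OF Q(1) ginv(1)[OF Q(1) dQ]] ginv(2)[OF Q(1) dQ] by simp
      finally show ?thesis using \<A>O(2)[OF A] by simp
    qed
    have BSL: "Q * A * ginv Q \<in> SL_C N" if A: "A \<in> \<A>" for A
      using BO[OF A] dB[OF A] by (simp add: SL_C_def O_C_def)
    have QG: "Q \<in> cgroup_set F n" if "det Q = 1"
      using QO that SO_fam by (simp add: SO_C_def SL_C_def O_C_def)
    from C show ?thesis
    proof (elim exE disjE conjE)
      fix p q assume d: "det Q = 1" and pq: "q \<le> p" "p + q = N"
        and r: "\<forall>A\<in>\<A>. unitary_for (I_mat p q) (Q * A * ginv Q)"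
      show ?thesis
      proof (rule fin[of "SO_std p q", OF _ QG[OF d]])
        show "SO_std p q \<in> real_forms P0 F n"
          unfolding SO_fam real_forms.simps n[symmetric] using pq by blast
        fix A assume A: "A \<in> \<A>"
        obtain X where X: "X \<in> O_pq p q" "det X = det (Q * A * ginv Q)"
          "Q * A * ginv Q = D_mat p q * X * inv\<^bsub>GL (p + q)\<^esub> D_mat p q"
          using O_std_member[of "Q * A * ginv Q" p q] B[OF A] r A unfolding pq(2) by blast
        have "X \<in> SO_pq p q" using X(1,2) dB[OF A] by (simp add: SO_pq_def SL_C_def O_pq_def GL_R_def)
        then show "Q * A * ginv Q \<in> SO_std p q" unfolding X(3) SO_std_def conj_set_def by (rule imageI)
      qed
    next
      fix m assume d: "det Q = 1" and m: "N = 2 * m"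
        and r: "\<forall>A\<in>\<A>. unitary_for (J_mat m) (Q * A * ginv Q)"
      have JM: "J_mat m \<in> M" using J_carrier[of m] by (simp add: m)
      have H: "Q * A * ginv Q \<in> SO_H m" if A: "A \<in> \<A>" for A
        using orthogonal_unitary_twist[OF B[OF A] _ JM] r A BO[OF A] BSL[OF A]
        unfolding SO_H_def O_H_def m[symmetric] by blast
      have "SO_H m \<in> real_forms P0 F n"
      proof (cases "even m")
        case True
        then obtain k where "m = 2 * k" by blast
        moreover from this have "N = 4 * k" using m by simp
        ultimately show ?thesis unfolding SO_fam real_forms.simps n[symmetric] by blast
      next
        case False
        then obtain k where "m = 2 * k + 1" using oddE by blast
        moreover from this have "N = 4 * k + 2" using m by simp
        ultimately show ?thesis unfolding SO_fam real_forms.simps n[symmetric] by blast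
      qed
      from fin[OF this QG[OF d] H] show ?thesis .
    next
      fix m assume d: "det Q = -1" "even m" and m: "N = 2 * m"
        and r: "\<forall>A\<in>\<A>. unitary_for (J_mat m) (Q * A * ginv Q)"
      obtain k where k: "m = 2 * k" using d(2) by blast
      have N4: "N = 4 * k" using m k by simp
      then have "k \<ge> 1" using N0 by simp
      then have P0: "P0 k \<in> O_C N" "det (P0 k) = -1" using assms(10)[of k] by (simp_all add: N4)
      have P0G: "P0 k \<in> cgroup_set O_fam n" using P0 by (simp add: n)
      have P0M: "P0 k \<in> M" "det (P0 k) \<noteq> 0" using P0 by (auto simp: O_C_def GL_C_def GL_carrier)
      interpret O: subgroup "cgroup_set O_fam n" "GL N" using subgroup_cgroup[of O_fam n] by (simp add: n)
      have "P0 k * Q \<in> cgroup_set O_fam n" using O.m_closed[OF P0G QO] by (simp add: GL_ops)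
      moreover have "det (P0 k * Q) = 1" using det_M_mult[OF P0M(1) Q(1)] P0(2) d(1) by simp
      ultimately have PQ: "P0 k * Q \<in> cgroup_set F n"
        using SO_fam by (simp add: SO_C_def SL_C_def O_C_def)
      have JM: "J_mat m \<in> M" using J_carrier[of m] by (simp add: m)
      have H: "Q * A * ginv Q \<in> SO_H m" if A: "A \<in> \<A>" for A
        using orthogonal_unitary_twist[OF B[OF A] _ JM] r A BO[OF A] BSL[OF A]
        unfolding SO_H_def O_H_def m[symmetric] by blast
      show ?thesis
      proof (rule fin[of "SO_H_minus (P0 k) k", OF _ PQ])
        show "SO_H_minus (P0 k) k \<in> real_forms P0 F n"
          unfolding SO_fam real_forms.simps n[symmetric] using N4 by blast
        fix A assume A: "A \<in> \<A>"
        have "P0 k * Q * A * ginv (P0 k * Q) = P0 k * (Q * A * ginv Q) * ginv (P0 k)"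
          unfolding ginv_mult[OF P0M Q(1) dQ]
          using P0M(1) Q(1) \<A>M[OF A] ginv(1)[OF Q(1) dQ] ginv(1)[OF P0M] by (simp add: mat_simps)
        then show "P0 k * Q * A * ginv (P0 k * Q) \<in> SO_H_minus (P0 k) k"
          using H[OF A] unfolding SO_H_minus_def conj_set_def N4 k by (simp only:) (rule imageI)
      qed
    qed
  next
    case Sp_fam
    have n: "N = 2 * n" using Sp_fam by (simp add: N_def)
    have JM: "J_mat n \<in> M" using J_carrier[of n] by (simp add: n)
    have sp: "isometry (J_mat n) A" if "A \<in> \<A>" for A
      using \<A>G[OF that] Sp_fam by (simp add: Sp_C_def)
    obtain P' where P': "P' \<in> M" "det P' \<noteq> 0" "\<forall>A\<in>\<A>. unitary_for P' A"
      using form_from_intertwiner[OF JM conj_J det_J sp P c] by blast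
    have sp': "\<forall>A\<in>\<A>. isometry (J_mat n) A" using sp by blast
    obtain Q where Q: "Q \<in> M" "isometry (J_mat n) Q" "det Q = 1" and C: "
      (\<exists>p q. q \<le> p \<and> p + q = n \<and> (\<forall>A\<in>\<A>. unitary_for (K_mat p q) (Q * A * ginv Q))) \<or>
      (\<forall>A\<in>\<A>. unitary_for (J_mat n) (Q * A * ginv Q))"
      using symplectic_form[OF n sp' P']
      by - (elim bexE conjE, rule that, assumption+)
    have QG: "Q \<in> cgroup_set F n" using Q Sp_fam by (simp add: Sp_C_def SL_C_def GL_C_def GL_carrier n)
    have BSp: "Q * A * ginv Q \<in> Sp_C n" if "A \<in> \<A>" for A using mem[OF QG that] Sp_fam by simp
    from C show ?thesis
    proof (elim disjE exE conjE)
      fix p q assume pq: "q \<le> p" "p + q = n"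
        and r: "\<forall>A\<in>\<A>. unitary_for (K_mat p q) (Q * A * ginv Q)"
      show ?thesis
        by (rule fin[of "Sp_pq p q", OF _ QG]) (use Sp_fam pq r BSp in \<open>auto simp: Sp_pq_def\<close>)
    next
      assume r: "\<forall>A\<in>\<A>. unitary_for (J_mat n) (Q * A * ginv Q)"
      show ?thesis
      proof (rule fin[of "Sp_R n", OF _ QG])
        show "Sp_R n \<in> real_forms P0 F n" using Sp_fam by simp
        fix A assume A: "A \<in> \<A>"
        define B where "B = Q * A * ginv Q"
        have BC: "B \<in> Sp_C n" using BSp[OF A] by (simp add: B_def)
        then have B: "B \<in> M" "det B \<noteq> 0" "isometry (J_mat n) B"
          by (auto simp: Sp_C_def SL_C_def GL_C_def GL_carrier n)
        have "adj B * J_mat n * B = B\<^sup>T * J_mat n * B" using r A B(3) by (simp add: B_def)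
        from mult_right_cancel[OF B(1) _ _ B(2) this] have "adj B * J_mat n = B\<^sup>T * J_mat n"
          using B(1) JM by simp
        from mult_right_cancel[OF JM _ _ det_J this] have "adj B = B\<^sup>T" using B(1) by simp
        then have "conj_mat B = B" by (metis transpose_transpose)
        then show "Q * A * ginv Q \<in> Sp_R n" using BC by (simp add: Sp_R_def real_entries_iff_conj B_def)
      qed
    qed
  qed
qed

end
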